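(* Let $s,t,r$ be integers with $1\le t\le s/2$ and $r\ge 3$, and let $$F=\bigl(tK_2\cup \overline{K}_{s-2t}\bigr)\vee T_{s(r-1),\,r-1}.$$ Then, for all sufficiently large $n$, $K_{t-1}\vee T_{n-t+1,r}$ is the unique graph (up to isomorphism) in $\mathrm{EX}_{q}(n,F)$.
   Context: All graphs are finite and simple. $K_n$ is the complete graph on $n$ vertices ($K_0$ is the empty graph, so for $t=1$ the graph $K_{t-1}\vee T_{n-t+1,r}$ is $T_{n,r}$), $\overline{K}_n$ is its complement ($n$ isolated vertices), and $tK_2$ is the disjoint union of $t$ copies of $K_2$. $G_1\cup G_2$ is the disjoint union of vertex-disjoint graphs, and the join $G_1\vee G_2$ is obtained from $G_1\cup G_2$ by adding all edges between $V(G_1)$ and $V(G_2)$. The Turán graph $T_{n,r}$ is the complete $r$-partite graph on $n$ vertices with parts as balanced as possible. A graph is $F$-free if it contains no copy of $F$ as a (not necessarily induced) subgraph. The signless Laplacian matrix is $Q(G)=D(G)+A(G)$ (diagonal degree matrix plus adjacency matrix), and $q(G)$ is its largest eigenvalue. $\mathrm{EX}_q(n,F)$ is the set of $n$-vertex $F$-free graphs attaining the maximum of $q$ among all $n$-vertex $F$-free graphs. *)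

theory Defs
  imports
    "Graph_Theory.Pair_Digraph"
    "Graph_Theory.Digraph_Isomorphism"
    "Jordan_Normal_Form.Spectral_Radius"
begin

text \<open>
  A finite simple graph is a \<^locale>\<open>pair_graph\<close>: finite, loop-free, with a symmetric set of arcs,
  so an undirected edge between \<open>u\<close> and \<open>v\<close> is the pair of arcs \<open>(u, v)\<close>, \<open>(v, u)\<close>.
  Every graph below is labelled: a graph of order \<open>n\<close> has vertex set \<open>{..<n}\<close>.  Up to isomorphism
  this loses nothing, and it lets the vertices index the rows of a matrix.
\<close>

definition simple_graphs :: "nat \<Rightarrow> nat pair_pre_digraph set" where
  "simple_graphs n = {G. pair_graph G \<and> pverts G = {..<n}}"

definition num_verts :: "nat pair_pre_digraph \<Rightarrow> nat" where
  "num_verts G = card (pverts G)"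

definition complete_graph :: "nat \<Rightarrow> nat pair_pre_digraph" where
  "complete_graph n = \<lparr>pverts = {..<n}, parcs = {(i, j). i < n \<and> j < n \<and> i \<noteq> j}\<rparr>"

definition complement :: "nat pair_pre_digraph \<Rightarrow> nat pair_pre_digraph" where
  "complement G = \<lparr>pverts = pverts G,
     parcs = {(i, j). i \<in> pverts G \<and> j \<in> pverts G \<and> i \<noteq> j \<and> (i, j) \<notin> parcs G}\<rparr>"

text \<open>
  The second graph is made vertex-disjoint from the first by adding the order of the first graph
  to each of its vertices; the result again has an initial segment as its vertex set.
\<close>

definition shift_graph :: "nat \<Rightarrow> nat pair_pre_digraph \<Rightarrow> nat pair_pre_digraph" where
  "shift_graph k G = \<lparr>pverts = (\<lambda>i. k + i) ` pverts G, parcs = (\<lambda>(i, j). (k + i, k + j)) ` parcs G\<rparr>"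

definition disjoint_union ::
    "nat pair_pre_digraph \<Rightarrow> nat pair_pre_digraph \<Rightarrow> nat pair_pre_digraph" where
  "disjoint_union G H = (let H' = shift_graph (num_verts G) H in
     \<lparr>pverts = pverts G \<union> pverts H', parcs = parcs G \<union> parcs H'\<rparr>)"

definition graph_join ::
    "nat pair_pre_digraph \<Rightarrow> nat pair_pre_digraph \<Rightarrow> nat pair_pre_digraph" where
  "graph_join G H = (let H' = shift_graph (num_verts G) H in
     \<lparr>pverts = pverts (disjoint_union G H),
      parcs = parcs (disjoint_union G H) \<union> pverts G \<times> pverts H' \<union> pverts H' \<times> pverts G\<rparr>)"

primrec disjoint_copies :: "nat \<Rightarrow> nat pair_pre_digraph \<Rightarrow> nat pair_pre_digraph" where
  "disjoint_copies 0 G = complete_graph 0"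
| "disjoint_copies (Suc m) G = disjoint_union G (disjoint_copies m G)"

text \<open>
  For \<open>r > 0\<close> the \<open>r\<close> parts are the residue classes modulo \<open>r\<close> in \<open>{..<n}\<close>; their sizes differ by
  at most one.
\<close>

definition turan_graph :: "nat \<Rightarrow> nat \<Rightarrow> nat pair_pre_digraph" where
  "turan_graph n r = \<lparr>pverts = {..<n}, parcs = {(i, j). i < n \<and> j < n \<and> i mod r \<noteq> j mod r}\<rparr>"

definition graph_iso :: "nat pair_pre_digraph \<Rightarrow> nat pair_pre_digraph \<Rightarrow> bool" where
  "graph_iso G H \<longleftrightarrow> digraph_iso (with_proj G) (with_proj H)"

definition free_of :: "nat pair_pre_digraph \<Rightarrow> nat pair_pre_digraph \<Rightarrow> bool" where
  "free_of F G \<longleftrightarrow> \<not> (\<exists>H. subgraph (with_proj H) (with_proj G) \<and> graph_iso F H)"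

definition adjacency_matrix :: "nat pair_pre_digraph \<Rightarrow> real mat" where
  "adjacency_matrix G = mat (num_verts G) (num_verts G) (\<lambda>(i, j). if (i, j) \<in> parcs G then 1 else 0)"

text \<open>In a symmetric digraph the out-degree of a vertex is its degree as an undirected graph.\<close>

definition degree_matrix :: "nat pair_pre_digraph \<Rightarrow> real mat" where
  "degree_matrix G = mat (num_verts G) (num_verts G)
     (\<lambda>(i, j). if i = j then real (out_degree (with_proj G) i) else 0)"

definition signless_laplacian :: "nat pair_pre_digraph \<Rightarrow> real mat" where
  "signless_laplacian G = degree_matrix G + adjacency_matrix G"

text \<open>
  The matrix is real symmetric, so its real spectrum is its whole spectrum; it is finite, and
  nonempty for graphs of positive order (the value at order 0 is unspecified).
\<close>

definition q_index :: "nat pair_pre_digraph \<Rightarrow> real" where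
  "q_index G = Max (spectrum (signless_laplacian G))"

definition EX_q :: "nat \<Rightarrow> nat pair_pre_digraph \<Rightarrow> nat pair_pre_digraph set" where
  "EX_q n F = {G \<in> simple_graphs n. free_of F G \<and>
     (\<forall>H \<in> simple_graphs n. free_of F H \<longrightarrow> q_index H \<le> q_index G)}"

end

theory Submission
  imports Defs "HOL-Analysis.Function_Topology" "HOL-Analysis.Convex"
begin

text \<open>
  Graphs are handled as a vertex set \<open>V\<close> with a symmetric irreflexive relation \<open>E\<close>. The sum of
  \<open>(x u + x v)\<^sup>2\<close> over the edges is \<open>qform V E x\<close>; its maximum \<open>qrad V E\<close> over unit vectors is the
  largest eigenvalue of the signless Laplacian, attained at a nonnegative eigenvector
  (\<open>qrad_eigenvector\<close>, \<open>q_index_eq_qrad\<close>). The value of \<open>qrad\<close> at the join of \<open>K\<^sub>k\<close> with the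
  \<open>r\<close>-partite Turan graph, on \<open>n\<close> vertices in total, is \<open>turan_q k r n\<close>. The claim is that, for
  large \<open>n\<close>, an \<open>F\<close>-free graph on \<open>n\<close> vertices has \<open>qrad\<close> at most \<open>turan_q (t - 1) r n\<close>, with
  equality only for that join (\<open>F_free_qrad_extremal\<close>).

  Reduction to flat eigenvectors. Deleting the vertex \<open>v\<close> with the smallest eigenvector entry
  lowers \<open>qrad\<close> by about \<open>1 + (qrad - n) (x v)\<^sup>2\<close>. When \<open>(x v)\<^sup>2\<close> is noticeably below the average
  \<open>1/n\<close>, this falls short, by a fixed amount, of \<open>2 - 2/r\<close>, the growth rate of \<open>turan_q\<close>
  (\<open>delete_gain\<close>, \<open>turan_q_increment\<close>). Repeated deletion from a graph that reaches the benchmark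
  therefore makes the excess over the benchmark grow linearly in the number of deleted vertices.
  As \<open>qrad\<close> is at most twice the order, the process stops at a large subgraph, and it can stop
  only because the eigenvector there is nearly constant (\<open>reduce_to_flat\<close>). A nearly constant
  eigenvector forces all degrees to be at least about \<open>qrad / 2\<close>, hence about \<open>(1 - 1/r) n\<close>
  (\<open>flat_min_degree\<close>).

  Structure. Under this degree condition the Erdos-Stone argument (\<open>erdos_stone_min_degree\<close>) finds
  a large complete \<open>r\<close>-partite subgraph. Since \<open>F\<close> embeds into a complete \<open>(r+1)\<close>-partite graph
  with parts of order \<open>s\<close>, and since \<open>t\<close> disjoint edges inside one part suffice for \<open>F\<close>, all but
  few vertices split into \<open>r\<close> independent sets of nearly equal order
  (\<open>independent_parts_of_min_degree\<close>). The vertices with many neighbours in every part, the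
  dominators, are bounded in number (\<open>dominators_bounded\<close>); every other vertex has a home part in
  which it has few neighbours.

  Exchange. The graph is compared with the join of a clique on \<open>t - 1\<close> vertices, chosen among the
  dominators as far as possible, with the complete \<open>r\<close>-partite graph on the home classes. Absence
  of \<open>F\<close> makes the edges gained outweigh the edges lost, measured at the nearly constant
  eigenvector, unless the two graphs coincide (\<open>exchange\<close>). Among joins of this type the one with
  balanced classes is best, by concavity of \<open>m / (c + 2 m)\<close> (\<open>qrad_coloured_le_turan\<close>).

  The deletion step needs to know beforehand that \<open>qrad\<close> of an \<open>F\<close>-free graph is at most
  \<open>(2 - 2/r + \<epsilon>) n\<close>. This follows from the same deletion argument: the maximum of \<open>qrad\<close> over
  \<open>F\<close>-free graphs of order \<open>n\<close>, divided by \<open>n - 1\<close>, decreases to a limit, and if the limit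
  exceeded \<open>2 - 2/r\<close> there would be arbitrarily large \<open>F\<close>-free graphs with minimum degree at least
  \<open>(1 - 1/r + \<eta>) n\<close>, against Erdos-Stone (\<open>F_free_asymptotic_bound\<close>).
\<close>

section \<open>The quadratic form of the signless Laplacian\<close>

definition nbs :: "'a set \<Rightarrow> ('a \<Rightarrow> 'a \<Rightarrow> bool) \<Rightarrow> 'a \<Rightarrow> 'a set" where
  "nbs V E v = {u \<in> V. E v u}"

definition sgraph :: "'a set \<Rightarrow> ('a \<Rightarrow> 'a \<Rightarrow> bool) \<Rightarrow> bool" where
  "sgraph V E \<longleftrightarrow> finite V \<and> (\<forall>u v. E u v \<longrightarrow> E v u) \<and> (\<forall>u. \<not> E u u)"

text \<open>
  The inner sums run over ordered adjacent pairs, so every edge is met twice; hence the factor \<open>1/2\<close>.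
\<close>

definition qform :: "'a set \<Rightarrow> ('a \<Rightarrow> 'a \<Rightarrow> bool) \<Rightarrow> ('a \<Rightarrow> real) \<Rightarrow> real" where
  "qform V E x = (\<Sum>v\<in>V. \<Sum>u\<in>nbs V E v. (x v + x u)\<^sup>2) / 2"

definition sqnorm :: "'a set \<Rightarrow> ('a \<Rightarrow> real) \<Rightarrow> real" where
  "sqnorm V x = (\<Sum>v\<in>V. (x v)\<^sup>2)"

text \<open>
  The Rayleigh quotient characterisation of the largest eigenvalue of \<open>D + A\<close>. It is meaningful only
  for finite nonempty \<open>V\<close>.
\<close>

definition qrad :: "'a set \<Rightarrow> ('a \<Rightarrow> 'a \<Rightarrow> bool) \<Rightarrow> real" where
  "qrad V E = Sup (qform V E ` {x. sqnorm V x = 1})"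

lemma finite_nbs[simp]: "finite V \<Longrightarrow> finite (nbs V E v)"
  by (simp add: nbs_def)

lemma sgraphD: assumes "sgraph V E" shows "finite V" "E u v \<Longrightarrow> E v u" "\<not> E u u"
  using assms by (auto simp: sgraph_def)

lemma sgraph_mono: "sgraph V E \<Longrightarrow> U \<subseteq> V \<Longrightarrow> sgraph U E"
  by (auto simp: sgraph_def finite_subset)

lemma sqnorm_nonneg: "0 \<le> sqnorm V x"
  by (simp add: sqnorm_def sum_nonneg)

lemma sum_nbs_swap:
  assumes "sgraph V E"
  shows "(\<Sum>v\<in>V. \<Sum>u\<in>nbs V E v. f v u) = (\<Sum>v\<in>V. \<Sum>u\<in>nbs V E v. (f u v :: real))"
proof -
  have fin: "finite V" using assms by (rule sgraphD)
  have "(\<Sum>v\<in>V. \<Sum>u\<in>nbs V E v. f v u) = (\<Sum>v\<in>V. \<Sum>u\<in>V. if E v u then f v u else 0)"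
    unfolding nbs_def by (intro sum.cong refl sum.inter_filter fin)
  also have "\<dots> = (\<Sum>u\<in>V. \<Sum>v\<in>V. if E v u then f v u else 0)" by (rule sum.swap)
  also have "\<dots> = (\<Sum>u\<in>V. \<Sum>v\<in>V. if E u v then f v u else 0)"
    by (intro sum.cong refl) (use sgraphD(2)[OF assms] in auto)
  also have "\<dots> = (\<Sum>v\<in>V. \<Sum>u\<in>nbs V E v. f u v)"
    unfolding nbs_def by (intro sum.cong refl sum.inter_filter[symmetric] fin)
  finally show ?thesis .
qed

lemma qform_bilinear:
  fixes x h :: "'a \<Rightarrow> real"
  assumes "sgraph V E"
  shows "(\<Sum>v\<in>V. \<Sum>u\<in>nbs V E v. (x v + x u) * (h v + h u)) =
    2 * (\<Sum>v\<in>V. h v * (\<Sum>u\<in>nbs V E v. x v + x u))"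
proof -
  have "(\<Sum>v\<in>V. \<Sum>u\<in>nbs V E v. (x v + x u) * (h v + h u)) =
     (\<Sum>v\<in>V. \<Sum>u\<in>nbs V E v. (x v + x u) * h v) + (\<Sum>v\<in>V. \<Sum>u\<in>nbs V E v. (x v + x u) * h u)"
    by (simp only: distrib_left sum.distrib)
  also have "(\<Sum>v\<in>V. \<Sum>u\<in>nbs V E v. (x v + x u) * h u) = (\<Sum>v\<in>V. \<Sum>u\<in>nbs V E v. (x u + x v) * h v)"
    by (rule sum_nbs_swap[OF assms])
  also have "\<dots> = (\<Sum>v\<in>V. h v * (\<Sum>u\<in>nbs V E v. x v + x u))"
    unfolding sum_distrib_left by (intro sum.cong refl) (simp add: algebra_simps)
  also have "(\<Sum>v\<in>V. \<Sum>u\<in>nbs V E v. (x v + x u) * h v) = (\<Sum>v\<in>V. h v * (\<Sum>u\<in>nbs V E v. x v + x u))"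
    unfolding sum_distrib_left by (intro sum.cong refl) (simp add: algebra_simps)
  finally show ?thesis by simp
qed

lemma qform_self:
  assumes "sgraph V E"
  shows "qform V E x = (\<Sum>v\<in>V. x v * (\<Sum>u\<in>nbs V E v. x v + x u))"
  using qform_bilinear[OF assms, of x x] by (simp add: qform_def power2_eq_square)

text \<open>
  Entries outside \<open>V\<close> do not influence \<open>qform\<close>, so they may be taken to be zero; the unit vectors of
  this form lie in a product of compact intervals, which is compact by Tychonoff's theorem.
\<close>

lemma qform_attains_max:
  fixes V :: "'a set"
  assumes fin: "finite V" and ne: "V \<noteq> {}"
  shows "\<exists>x. sqnorm V x = 1 \<and> (\<forall>y. sqnorm V y = 1 \<longrightarrow> qform V E y \<le> qform V E x)"
proof -
  define S where "S = (\<lambda>v::'a. if v \<in> V then {-1..1} else {0::real})"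
  define K where "K = PiE UNIV S \<inter> {x. sqnorm V x = 1}"
  have "compactin (product_topology (\<lambda>_. euclidean) UNIV) (PiE UNIV S)"
    unfolding compactin_PiE by (simp add: S_def)
  then have c1: "compact (PiE UNIV S)"
    by (simp add: euclidean_product_topology)
  have "closed {x. sqnorm V x = 1}"
    unfolding sqnorm_def by (intro closed_Collect_eq continuous_intros continuous_on_product_coordinates)
  with c1 have cK: "compact K" unfolding K_def by (rule compact_Int_closed)
  obtain w where w: "w \<in> V" using ne by auto
  have "(\<lambda>v. if v = w then 1 else 0) \<in> K"
    using w fin by (auto simp: K_def S_def sqnorm_def if_distrib[of "\<lambda>x. x^2"] cong: if_cong)
  then have neK: "K \<noteq> {}" by auto
  have cont: "continuous_on K (qform V E)"
    unfolding qform_def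
    by (intro continuous_intros continuous_on_subset[OF continuous_on_product_coordinates]) auto
  obtain x where x: "x \<in> K" "\<And>y. y \<in> K \<Longrightarrow> qform V E y \<le> qform V E x"
    using continuous_attains_sup[OF cK neK cont] by auto
  show ?thesis
  proof (intro exI conjI allI impI)
    show "sqnorm V x = 1" using x(1) by (simp add: K_def)
    fix y assume y: "sqnorm V y = 1"
    \<comment> \<open>Truncation outside \<open>V\<close> brings an arbitrary unit vector into the compact set.\<close>
    define y' where "y' = (\<lambda>v. if v \<in> V then y v else 0)"
    have "\<bar>y v\<bar> \<le> 1" if "v \<in> V" for v
    proof -
      have "(y v)\<^sup>2 \<le> sqnorm V y" unfolding sqnorm_def by (rule member_le_sum) (use that fin in auto)
      then show ?thesis using y by (simp add: abs_square_le_1)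
    qed
    then have "y' \<in> PiE UNIV S" by (auto simp: S_def y'_def abs_le_iff)
    moreover have "sqnorm V y' = 1" using y by (simp add: sqnorm_def y'_def)
    ultimately have "qform V E y' \<le> qform V E x" using x(2) by (auto simp: K_def)
    moreover have "qform V E y' = qform V E y"
      unfolding qform_def y'_def nbs_def
      by (intro arg_cong[of _ _ "\<lambda>z. z/2"] sum.cong refl) auto
    ultimately show "qform V E y \<le> qform V E x" by simp
  qed
qed

lemma qform_scale: "qform V E (\<lambda>v. c * x v) = c\<^sup>2 * qform V E x"
proof -
  have "(c * x v + c * x u)\<^sup>2 = c\<^sup>2 * (x v + x u)\<^sup>2" for u v
    by (simp add: power2_eq_square algebra_simps)
  then show ?thesis by (simp add: qform_def sum_distrib_left)
qed

lemma sqnorm_scale: "sqnorm V (\<lambda>v. c * x v) = c\<^sup>2 * sqnorm V x"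
  by (simp add: sqnorm_def sum_distrib_left power_mult_distrib)

lemma qform_le_qrad:
  assumes "finite V"
  shows "qform V E y \<le> qrad V E * sqnorm V y"
proof (cases "sqnorm V y = 0")
  case True
  then have "y v = 0" if "v \<in> V" for v
    using assms that by (auto simp: sqnorm_def sum_nonneg_eq_0_iff)
  then have "qform V E y = 0"
    by (auto simp: qform_def nbs_def intro!: sum.neutral)
  with True show ?thesis by simp
next
  case False
  then have "V \<noteq> {}" by (auto simp: sqnorm_def)
  then obtain x where x: "sqnorm V x = 1" "\<And>y. sqnorm V y = 1 \<Longrightarrow> qform V E y \<le> qform V E x"
    using qform_attains_max[OF assms, of E] by auto
  have pos: "sqnorm V y > 0" using False sqnorm_nonneg[of V y] by simp
  define c where "c = 1 / sqrt (sqnorm V y)"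
  have c2: "c\<^sup>2 = 1 / sqnorm V y" using pos by (simp add: c_def power_divide)
  have "sqnorm V (\<lambda>v. c * y v) = 1" unfolding sqnorm_scale c2 using pos by simp
  then have "qform V E (\<lambda>v. c * y v) \<le> qrad V E"
    unfolding qrad_def by (intro cSUP_upper bdd_aboveI2[of _ _ "qform V E x"]) (use x in auto)
  then show ?thesis unfolding qform_scale c2 using pos by (simp add: field_simps)
qed

text \<open>
  First order condition for a maximum: a quadratic polynomial in \<open>e\<close> without constant term and with
  nonzero linear term takes positive values near zero.
\<close>

lemma linear_term_zero:
  fixes a b :: real
  assumes "\<And>e. 2 * e * a + e\<^sup>2 * b \<le> 0"
  shows "a = 0"
proof -
  \<comment> \<open>The step size \<open>a / d\<close> is small enough for the linear term to dominate.\<close>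
  define d where "d = \<bar>b\<bar> + 1"
  have d: "d > 0" "d \<ge> - b" by (auto simp: d_def)
  have "2 * (a / d) * a + (a / d)\<^sup>2 * b \<le> 0" by (rule assms)
  then have "(2 * (a / d) * a + (a / d)\<^sup>2 * b) * d\<^sup>2 \<le> 0"
    using d by (simp add: mult_le_0_iff)
  also have "(2 * (a / d) * a + (a / d)\<^sup>2 * b) * d\<^sup>2 = a\<^sup>2 * (2 * d + b)"
    using d by (simp add: field_simps power2_eq_square)
  finally show ?thesis using d by (auto simp: mult_le_0_iff)
qed

text \<open>
  Replacing the entries of a maximiser by their absolute values does not lower the form, so there is a
  nonnegative maximiser. Varying one coordinate of it yields the eigenvalue equation.
\<close>

lemma qrad_eigenvector:
  assumes G: "sgraph V E" and ne: "V \<noteq> {}"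
  obtains x where "\<And>v. x v \<ge> 0" "sqnorm V x = 1" "qform V E x = qrad V E"
    "\<And>v. v \<in> V \<Longrightarrow> qrad V E * x v = (\<Sum>u\<in>nbs V E v. x v + x u)"
proof -
  have fin: "finite V" using G by (rule sgraphD)
  obtain x0 where x0: "sqnorm V x0 = 1" "\<And>y. sqnorm V y = 1 \<Longrightarrow> qform V E y \<le> qform V E x0"
    using qform_attains_max[OF fin ne, of E] by auto
  define x where "x = (\<lambda>v. \<bar>x0 v\<bar>)"
  have nx: "sqnorm V x = 1" using x0(1) by (simp add: x_def sqnorm_def)
  have "qform V E x0 \<le> qform V E x"
    unfolding qform_def x_def
    by (intro divide_right_mono sum_mono) (auto simp: abs_le_square_iff[symmetric])
  then have mx: "\<And>y. sqnorm V y = 1 \<Longrightarrow> qform V E y \<le> qform V E x" using x0(2) order_trans by blast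
  have q: "qform V E x = qrad V E"
    unfolding qrad_def by (rule cSup_eq_maximum[symmetric]) (use mx nx in auto)
  show ?thesis
  proof (rule that[of x])
    show "x v \<ge> 0" for v by (simp add: x_def)
    show "sqnorm V x = 1" by fact
    show "qform V E x = qrad V E" by fact
    fix v assume v: "v \<in> V"
    define h where "h = (\<lambda>u. if u = v then 1 else 0 :: real)"
    define L where "L = (\<Sum>u\<in>nbs V E v. x v + x u)"
    have "2 * e * (L - qrad V E * x v) + e\<^sup>2 * (qform V E h - qrad V E) \<le> 0" for e
    proof -
      have "qform V E (\<lambda>u. x u + e * h u) = (\<Sum>v\<in>V. \<Sum>u\<in>nbs V E v. (x v + x u)\<^sup>2
          + 2 * e * ((x v + x u) * (h v + h u)) + e\<^sup>2 * (h v + h u)\<^sup>2) / 2"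
        unfolding qform_def by (intro arg_cong[of _ _ "\<lambda>z. z/2"] sum.cong refl) (simp add: power2_eq_square algebra_simps)
      also have "\<dots> = qform V E x + e * (\<Sum>v\<in>V. \<Sum>u\<in>nbs V E v. (x v + x u) * (h v + h u)) + e\<^sup>2 * qform V E h"
        unfolding qform_def sum.distrib by (simp only: sum_distrib_left[symmetric] mult.assoc) (simp add: add_divide_distrib)
      also have "(\<Sum>v\<in>V. \<Sum>u\<in>nbs V E v. (x v + x u) * (h v + h u)) = 2 * (\<Sum>w\<in>V. h w * (\<Sum>u\<in>nbs V E w. x w + x u))"
        by (rule qform_bilinear[OF G])
      also have "(\<Sum>w\<in>V. h w * (\<Sum>u\<in>nbs V E w. x w + x u)) = (\<Sum>w\<in>V. if w = v then L else 0)"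
        by (intro sum.cong refl) (auto simp: h_def L_def)
      also have "\<dots> = L" using v fin by simp
      finally have 1: "qform V E (\<lambda>u. x u + e * h u) = qrad V E + 2 * e * L + e\<^sup>2 * qform V E h" by (simp add: q)
      have "sqnorm V (\<lambda>u. x u + e * h u) = (\<Sum>u\<in>V. (x u)\<^sup>2 + (if u = v then 2 * e * x v + e\<^sup>2 else 0))"
        unfolding sqnorm_def by (intro sum.cong refl) (simp add: h_def power2_eq_square algebra_simps)
      also have "\<dots> = 1 + 2 * e * x v + e\<^sup>2" using v fin nx by (simp add: sum.distrib sqnorm_def)
      finally have 2: "sqnorm V (\<lambda>u. x u + e * h u) = 1 + 2 * e * x v + e\<^sup>2" .
      show ?thesis using qform_le_qrad[OF fin, of E "\<lambda>u. x u + e * h u"] unfolding 1 2 by (simp add: algebra_simps)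
    qed
    then have "L - qrad V E * x v = 0" by (rule linear_term_zero)
    then show "qrad V E * x v = (\<Sum>u\<in>nbs V E v. x v + x u)" by (simp add: L_def)
  qed
qed

text \<open>
  This uses only \<open>(a + b)\<^sup>2 \<le> 2 a\<^sup>2 + 2 b\<^sup>2\<close> on each edge; it is the source of the crude bound
  \<open>qrad_le\<close>, which makes the deletion process terminate.
\<close>

lemma qform_le_degree:
  assumes G: "sgraph V E"
  shows "qform V E x \<le> 2 * (\<Sum>v\<in>V. real (card (nbs V E v)) * (x v)\<^sup>2)"
proof -
  have fin: "finite V" using G by (rule sgraphD)
  have "(x v + x u)\<^sup>2 \<le> 2 * ((x v)\<^sup>2 + (x u)\<^sup>2)" for u v
    using sum_squares_ge_zero[of "x v - x u" 0] by (simp add: power2_eq_square algebra_simps)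
  then have "qform V E x \<le> (\<Sum>v\<in>V. \<Sum>u\<in>nbs V E v. 2 * ((x v)\<^sup>2 + (x u)\<^sup>2)) / 2"
    unfolding qform_def by (intro divide_right_mono sum_mono) auto
  also have "\<dots> = (\<Sum>v\<in>V. \<Sum>u\<in>nbs V E v. (x v)\<^sup>2) + (\<Sum>v\<in>V. \<Sum>u\<in>nbs V E v. (x u)\<^sup>2)"
    unfolding sum_distrib_left[symmetric] sum.distrib by simp
  also have "(\<Sum>v\<in>V. \<Sum>u\<in>nbs V E v. (x u)\<^sup>2) = (\<Sum>v\<in>V. \<Sum>u\<in>nbs V E v. (x v)\<^sup>2)"
    by (rule sum_nbs_swap[OF G])
  finally have "qform V E x \<le> (\<Sum>v\<in>V. real (card (nbs V E v)) * (x v)\<^sup>2) + (\<Sum>v\<in>V. real (card (nbs V E v)) * (x v)\<^sup>2)"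
    by (simp only: sum_constant)
  then show ?thesis by linarith
qed

lemma qrad_le:
  assumes G: "sgraph V E" and ne: "V \<noteq> {}"
  shows "qrad V E \<le> 2 * real (card V)"
proof -
  have fin: "finite V" using G by (rule sgraphD)
  obtain x where x: "sqnorm V x = 1" "qform V E x = qrad V E" by (rule qrad_eigenvector[OF assms])
  have "card (nbs V E v) \<le> card V" for v by (rule card_mono) (auto simp: fin nbs_def)
  then have "(\<Sum>v\<in>V. real (card (nbs V E v)) * (x v)\<^sup>2) \<le> (\<Sum>v\<in>V. real (card V) * (x v)\<^sup>2)"
    by (intro sum_mono mult_right_mono) auto
  also have "\<dots> = real (card V)" using x(1) by (simp add: sqnorm_def flip: sum_distrib_left)
  finally show ?thesis using qform_le_degree[OF G, of x] x(2) by simp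
qed

section \<open>Vertex deletion and flat eigenvectors\<close>

text \<open>
  The smallest squared entry of a unit vector on \<open>V\<close> is at most \<open>1 / card V\<close>; flatness means that it
  almost reaches this value. Small \<open>\<delta>\<close> thus says that the vector is nearly constant.
\<close>

definition flat_eig :: "real \<Rightarrow> 'a set \<Rightarrow> ('a \<Rightarrow> 'a \<Rightarrow> bool) \<Rightarrow> bool" where
  "flat_eig \<delta> V E \<longleftrightarrow> (\<exists>x. (\<forall>v. x v \<ge> 0) \<and> sqnorm V x = 1 \<and>
     (\<forall>v\<in>V. qrad V E * x v = (\<Sum>u\<in>nbs V E v. x v + x u)) \<and>
     (\<forall>v\<in>V. (x v)\<^sup>2 \<ge> (1 - \<delta>) / real (card V)))"

lemma qform_remove:
  assumes G: "sgraph V E" and v: "v \<in> V"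
  shows "qform V E x = qform (V - {v}) E x + (\<Sum>u\<in>nbs V E v. (x v + x u)\<^sup>2)"
proof -
  have fin: "finite V" using G by (rule sgraphD)
  define f where "f = (\<lambda>w u. (x w + x u)\<^sup>2)"
  have inner: "(\<Sum>u\<in>nbs V E w. f w u) = (\<Sum>u\<in>nbs (V - {v}) E w. f w u) + (if E w v then f w v else 0)" for w
  proof (cases "E w v")
    case True
    then have "nbs V E w = insert v (nbs (V - {v}) E w)" "v \<notin> nbs (V - {v}) E w"
      using v by (auto simp: nbs_def)
    with True fin show ?thesis by simp
  next
    case False
    then have "nbs V E w = nbs (V - {v}) E w" by (auto simp: nbs_def)
    with False show ?thesis by simp
  qed
  have "(\<Sum>w\<in>V. \<Sum>u\<in>nbs V E w. f w u) = (\<Sum>u\<in>nbs V E v. f v u) + (\<Sum>w\<in>V-{v}. \<Sum>u\<in>nbs V E w. f w u)"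
    using fin v by (simp add: sum.remove)
  also have "(\<Sum>w\<in>V-{v}. \<Sum>u\<in>nbs V E w. f w u) = (\<Sum>w\<in>V-{v}. \<Sum>u\<in>nbs (V - {v}) E w. f w u) + (\<Sum>w\<in>V-{v}. if E w v then f w v else 0)"
    unfolding inner by (rule sum.distrib)
  also have "(\<Sum>w\<in>V-{v}. if E w v then f w v else 0) = (\<Sum>w\<in>{w\<in>V-{v}. E w v}. f w v)"
    using fin by (intro sum.inter_filter[symmetric]) auto
  also have "{w\<in>V-{v}. E w v} = nbs V E v"
    using sgraphD(2,3)[OF G] by (auto simp: nbs_def)
  also have "(\<Sum>w\<in>nbs V E v. f w v) = (\<Sum>u\<in>nbs V E v. f v u)"
    by (intro sum.cong refl) (simp add: f_def add.commute)
  finally show ?thesis unfolding qform_def f_def by simp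
qed

text \<open>
  The restriction of the eigenvector to \<open>V - {v}\<close> is a test vector for the smaller graph. The edges at
  \<open>v\<close> contribute \<open>2 q (x v)\<^sup>2\<close> plus the squared entries of the neighbours minus \<open>d (x v)\<^sup>2\<close>, where \<open>d\<close>
  is the degree of \<open>v\<close>; as \<open>x v\<close> is smallest, the \<open>n - d\<close> other vertices carry at least
  \<open>(n - d) (x v)\<^sup>2\<close> of the unit mass, and the unknown degree cancels.
\<close>

lemma qrad_delete:
  fixes x :: "'a \<Rightarrow> real"
  assumes G: "sgraph V E" and v: "v \<in> V"
    and x0: "\<And>u. x u \<ge> 0" and x1: "sqnorm V x = 1" and x2: "qform V E x = qrad V E"
    and x3: "qrad V E * x v = (\<Sum>u\<in>nbs V E v. x v + x u)"
    and min: "\<And>u. u \<in> V \<Longrightarrow> x v \<le> x u"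
  shows "qrad V E * (1 - (x v)\<^sup>2) - (1 + (qrad V E - card V) * (x v)\<^sup>2) \<le> qrad (V - {v}) E * (1 - (x v)\<^sup>2)"
    "card V * (x v)\<^sup>2 \<le> 1"
proof -
  have fin: "finite V" using G by (rule sgraphD)
  have min2: "u \<in> V \<Longrightarrow> (x v)\<^sup>2 \<le> (x u)\<^sup>2" for u using min x0 by (simp add: power_mono)
  define N where "N = nbs V E v"
  have N: "finite N" "N \<subseteq> V" using fin by (auto simp: N_def nbs_def)
  have "(\<Sum>u\<in>N. (x v + x u)\<^sup>2) = (\<Sum>u\<in>N. 2 * x v * (x v + x u) + (x u)\<^sup>2 - (x v)\<^sup>2)"
    by (intro sum.cong refl) (simp add: power2_eq_square algebra_simps)
  also have "\<dots> = 2 * x v * (\<Sum>u\<in>N. x v + x u) + (\<Sum>u\<in>N. (x u)\<^sup>2) - card N * (x v)\<^sup>2"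
    by (simp add: sum_subtractf sum.distrib algebra_simps power2_eq_square sum_distrib_left sum_distrib_right)
  also have "(\<Sum>u\<in>N. x v + x u) = qrad V E * x v" using x3 by (simp add: N_def)
  finally have 1: "(\<Sum>u\<in>N. (x v + x u)\<^sup>2) = 2 * qrad V E * (x v)\<^sup>2 + (\<Sum>u\<in>N. (x u)\<^sup>2) - card N * (x v)\<^sup>2"
    by (simp add: power2_eq_square algebra_simps)
  have "(\<Sum>u\<in>V - N. (x v)\<^sup>2) \<le> (\<Sum>u\<in>V - N. (x u)\<^sup>2)" by (intro sum_mono) (use min2 in auto)
  then have "(card V - card N) * (x v)\<^sup>2 \<le> (\<Sum>u\<in>V - N. (x u)\<^sup>2)"
    using N fin by (simp add: card_Diff_subset)
  also have "(\<Sum>u\<in>V - N. (x u)\<^sup>2) = 1 - (\<Sum>u\<in>N. (x u)\<^sup>2)"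
    using x1 N fin by (simp add: sqnorm_def sum_diff)
  finally have 2: "(\<Sum>u\<in>N. (x u)\<^sup>2) \<le> 1 - (real (card V) - card N) * (x v)\<^sup>2"
    using card_mono[OF fin N(2)] by (simp add: of_nat_diff)
  have 3: "sqnorm (V - {v}) x = 1 - (x v)\<^sup>2"
    using x1 fin v by (simp add: sqnorm_def sum_diff)
  have "qrad V E = qform (V - {v}) E x + (\<Sum>u\<in>N. (x v + x u)\<^sup>2)"
    using qform_remove[OF G v, of x] x2 by (simp add: N_def)
  also have "qform (V - {v}) E x \<le> qrad (V - {v}) E * (1 - (x v)\<^sup>2)"
    using qform_le_qrad[of "V - {v}" E x] fin 3 by simp
  finally have "qrad V E \<le> qrad (V - {v}) E * (1 - (x v)\<^sup>2) + (2 * qrad V E * (x v)\<^sup>2 + 1 - card V * (x v)\<^sup>2)"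
    using 1 2 by (simp add: algebra_simps)
  then show "qrad V E * (1 - (x v)\<^sup>2) - (1 + (qrad V E - card V) * (x v)\<^sup>2) \<le> qrad (V - {v}) E * (1 - (x v)\<^sup>2)"
    by (simp add: algebra_simps)
  have "(\<Sum>u\<in>V. (x v)\<^sup>2) \<le> (\<Sum>u\<in>V. (x u)\<^sup>2)" by (intro sum_mono) (use min2 in auto)
  then show "card V * (x v)\<^sup>2 \<le> 1" using x1 by (simp add: sqnorm_def)
qed

lemma ex_min_entry:
  assumes "finite V" "V \<noteq> {}"
  obtains v where "v \<in> V" "\<And>u. u \<in> V \<Longrightarrow> (x v :: real) \<le> x u"
  using ex_min_if_finite[of "x ` V"] assms
  by (metis (no_types, lifting) finite_imageI image_iff image_is_empty linorder_not_le)

text \<open>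
  This inequality makes the extremal values of \<open>qrad\<close>, divided by one less than the order, a decreasing
  sequence.
\<close>

lemma qrad_delete_ratio:
  assumes G: "sgraph V E" and n: "card V \<ge> 2" and q: "qrad V E \<ge> real (card V) - 1"
  shows "\<exists>v\<in>V. qrad V E * (real (card V) - 2) \<le> qrad (V - {v}) E * (real (card V) - 1)"
proof -
  have fin: "finite V" using G by (rule sgraphD)
  have ne: "V \<noteq> {}" using n by auto
  define q where "q = qrad V E"
  define n where "n = real (card V)"
  obtain x where x: "\<And>v. x v \<ge> 0" "sqnorm V x = 1" "qform V E x = qrad V E"
    "\<And>v. v \<in> V \<Longrightarrow> qrad V E * x v = (\<Sum>u\<in>nbs V E v. x v + x u)"
    by (rule qrad_eigenvector[OF G ne]) auto
  obtain v where v: "v \<in> V" "\<And>u. u \<in> V \<Longrightarrow> x v \<le> x u" using ex_min_entry[OF fin ne] by blast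
  define z where "z = (x v)\<^sup>2"
  define q' where "q' = qrad (V - {v}) E"
  have 1: "q * (1 - z) - (1 + (q - n) * z) \<le> q' * (1 - z)"
    and nz: "n * z \<le> 1"
    using qrad_delete[OF G v(1) x(1-3) x(4)[OF v(1)] v(2)] by (auto simp: q_def n_def z_def q'_def)
  have n2: "n \<ge> 2" using n by (simp add: n_def)
  have z0: "z \<ge> 0" by (simp add: z_def)
  have z1: "z \<le> 1/2" using mult_right_mono[OF n2 z0] nz by simp
  have "(q - n + 1) * (n * z) \<le> (q - n + 1) * 1"
    using assms(3) nz by (intro mult_left_mono) (auto simp: q_def n_def)
  then have "(1 + (q - n) * z) * (n - 1) \<le> q * (1 - z)"
    by (simp add: algebra_simps)
  moreover have "(q * (1 - z) - (1 + (q - n) * z)) * (n - 1) \<le> q' * (1 - z) * (n - 1)"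
    using 1 n2 by (intro mult_right_mono) auto
  ultimately have "(1 - z) * (q * (n - 2)) \<le> (1 - z) * (q' * (n - 1))"
    by (simp add: algebra_simps)
  then have "q * (n - 2) \<le> q' * (n - 1)" using z1 by (simp add: mult_le_cancel_left)
  then show ?thesis using v(1) by (auto simp: q_def q'_def n_def)
qed

text \<open>
  If the eigenvector is not flat, the smallest entry satisfies \<open>n (x v)\<^sup>2 \<le> 1 - \<delta>\<close>, so that the loss
  \<open>1 + (q - n) (x v)\<^sup>2\<close> is at most about \<open>\<theta> - \<delta> (\<theta> - 1)\<close>. Here \<open>\<theta>\<close> is the expected growth rate of
  \<open>qrad\<close> per vertex; \<open>\<theta> - 1 \<ge> 1/3\<close> and \<open>\<delta> \<ge> 24 \<epsilon>\<close> turn the saving into \<open>5 \<epsilon>\<close>.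
\<close>

lemma delete_gain:
  assumes G: "sgraph V E" and nf: "\<not> flat_eig \<delta> V E" and n: "real (card V) \<ge> 1 / \<epsilon>" "card V \<ge> 2"
    and q: "qrad V E \<le> (\<theta> + \<epsilon>) * card V"
    and c: "0 < \<epsilon>" "24 * \<epsilon> \<le> \<delta>" "\<delta> \<le> 1" "4/3 \<le> \<theta>" "\<theta> \<le> 2"
  shows "\<exists>v\<in>V. qrad (V - {v}) E \<ge> qrad V E - (\<theta> - 5 * \<epsilon>)"
proof -
  have fin: "finite V" using G by (rule sgraphD)
  have ne: "V \<noteq> {}" using n by auto
  define q where "q = qrad V E"
  define n where "n = real (card V)"
  obtain x where x: "\<And>v. x v \<ge> 0" "sqnorm V x = 1" "qform V E x = qrad V E"
    "\<And>v. v \<in> V \<Longrightarrow> qrad V E * x v = (\<Sum>u\<in>nbs V E v. x v + x u)"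
    by (rule qrad_eigenvector[OF G ne]) auto
  obtain v where v: "v \<in> V" "\<And>u. u \<in> V \<Longrightarrow> x v \<le> x u" using ex_min_entry[OF fin ne] by blast
  define z where "z = (x v)\<^sup>2"
  define q' where "q' = qrad (V - {v}) E"
  have 1: "q * (1 - z) - (1 + (q - n) * z) \<le> q' * (1 - z)"
    and nz: "n * z \<le> 1"
    using qrad_delete[OF G v(1) x(1-3) x(4)[OF v(1)] v(2)] by (auto simp: q_def n_def z_def q'_def)
  have z0: "z \<ge> 0" by (simp add: z_def)
  have n0: "n > 0" using n by (simp add: n_def)
  have "\<exists>u\<in>V. (x u)\<^sup>2 < (1 - \<delta>) / n"
    using nf x unfolding flat_eig_def n_def by (metis not_le)
  then obtain u where u: "u \<in> V" "(x u)\<^sup>2 < (1 - \<delta>) / n" by auto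
  have "z \<le> (x u)\<^sup>2" unfolding z_def using v(2)[OF u(1)] x(1) by (simp add: power_mono)
  then have "n * z \<le> n * (x u)\<^sup>2" using n0 by simp
  also have "\<dots> \<le> 1 - \<delta>" using u n0 by (simp add: field_simps)
  finally have nz2: "n * z \<le> 1 - \<delta>" .
  have "(q - n) * z \<le> (\<theta> + \<epsilon> - 1) * n * z"
    using assms(5) z0 by (intro mult_right_mono) (auto simp: q_def n_def algebra_simps)
  also have "\<dots> \<le> (\<theta> + \<epsilon> - 1) * (1 - \<delta>)"
    using nz2 c by (simp add: mult.assoc mult_left_mono)
  finally have 2: "1 + (q - n) * z \<le> \<theta> + \<epsilon> - \<delta> * (\<theta> - 1 + \<epsilon>)" by (simp add: algebra_simps)
  have "\<delta> * (1/3) \<le> \<delta> * (\<theta> - 1 + \<epsilon>)" using c by (intro mult_left_mono) auto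
  with 2 c have 3: "1 + (q - n) * z \<le> \<theta> - 7 * \<epsilon>" by linarith
  have "z \<le> \<epsilon>"
  proof -
    have "1 \<le> n * \<epsilon>" using n(1) c(1) n_def by (simp add: field_simps)
    with nz have "n * z \<le> n * \<epsilon>" by linarith
    then show ?thesis using n0 by simp
  qed
  moreover have "(\<theta> - 5 * \<epsilon>) * z \<le> 2 * z" using c z0 by (intro mult_right_mono) auto
  ultimately have "\<theta> - 7 * \<epsilon> \<le> (\<theta> - 5 * \<epsilon>) * (1 - z)" by (simp add: algebra_simps)
  with 3 1 have 4: "(1 - z) * (q - (\<theta> - 5 * \<epsilon>)) \<le> (1 - z) * q'" by (simp add: algebra_simps)
  have "n \<ge> 2" using assms(4) by (simp add: n_def)
  then have "2 * z \<le> 1" using mult_right_mono[OF _ z0, of 2 n] nz by simp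
  then have "1 - z > 0" by simp
  with 4 have "q - (\<theta> - 5 * \<epsilon>) \<le> q'" using mult_le_cancel_left_pos by blast
  then show ?thesis using v(1) by (auto simp: q_def q'_def)
qed

text \<open>
  For a hereditary class \<open>K\<close> of graphs and a benchmark \<open>b\<close> that grows by at least \<open>\<theta> - \<epsilon>\<close> per vertex,
  each deletion from a graph without flat eigenvector raises \<open>qrad - b\<close> by at least \<open>4 \<epsilon>\<close>. Going all
  the way down to order \<open>N1\<close> would make this excess unbounded, contradicting \<open>qrad_le\<close>. The last
  clause records that the excess is strictly positive as soon as one vertex has been deleted; this is
  what makes uniqueness survive the reduction.
\<close>

lemma reduce_to_flat:
  fixes K :: "'a set \<Rightarrow> ('a \<Rightarrow> 'a \<Rightarrow> bool) \<Rightarrow> bool" and b :: "nat \<Rightarrow> real"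
  assumes sg: "\<And>V E. K V E \<Longrightarrow> sgraph V E"
    and her: "\<And>V E U. K V E \<Longrightarrow> U \<subseteq> V \<Longrightarrow> K U E"
    and c: "0 < \<epsilon>" "24 * \<epsilon> \<le> \<delta>" "\<delta> \<le> 1" "4/3 \<le> \<theta>" "\<theta> \<le> 2"
    and N1: "N1 \<ge> 2" "real N1 \<ge> 1 / \<epsilon>"
    and up: "\<And>V E. K V E \<Longrightarrow> card V \<ge> N1 \<Longrightarrow> qrad V E \<le> (\<theta> + \<epsilon>) * card V"
    and incr: "\<And>m. m \<ge> N1 \<Longrightarrow> b (Suc m) \<ge> b m + \<theta> - \<epsilon>"
  shows "\<exists>N2. \<forall>V E. K V E \<longrightarrow> card V \<ge> N2 \<longrightarrow> qrad V E \<ge> b (card V) \<longrightarrow>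
    (\<exists>U\<subseteq>V. card U \<ge> N1 \<and> flat_eig \<delta> U E \<and> qrad U E \<ge> b (card U) \<and> (U = V \<or> qrad U E > b (card U)))"
proof -
  have step: "\<exists>U\<subseteq>V. card U \<ge> N1 \<and> (card U = N1 \<or> flat_eig \<delta> U E) \<and>
      qrad U E - b (card U) \<ge> qrad V E - b (card V) + 4 * \<epsilon> * (real (card V) - card U)"
    if "K V E" "card V = N1 + k" for V E k
    using that
  proof (induction k arbitrary: V)
    case 0
    then show ?case by (intro exI[of _ V]) auto
  next
    case (Suc k)
    show ?case
    proof (cases "flat_eig \<delta> V E")
      case True
      then show ?thesis using Suc by (intro exI[of _ V]) auto
    next
      case False
      have G: "sgraph V E" using sg Suc by auto
      have fin: "finite V" using G by (rule sgraphD)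
      have cd: "real (card V) \<ge> 1 / \<epsilon>" "card V \<ge> 2" using N1 Suc(3) by auto
      obtain v where v: "v \<in> V" "qrad (V - {v}) E \<ge> qrad V E - (\<theta> - 5 * \<epsilon>)"
        using delete_gain[OF G False cd up[OF Suc(2)] c] Suc(3) by auto
      have cv: "card (V - {v}) = N1 + k" using v fin Suc(3) by simp
      obtain U where U: "U \<subseteq> V - {v}" "card U \<ge> N1" "card U = N1 \<or> flat_eig \<delta> U E"
        "qrad U E - b (card U) \<ge> qrad (V - {v}) E - b (N1 + k) + 4 * \<epsilon> * (real (N1 + k) - card U)"
        using Suc.IH[OF her[OF Suc(2)] cv] cv by auto
      have "b (card V) \<ge> b (N1 + k) + \<theta> - \<epsilon>" using incr[of "N1 + k"] Suc(3) by simp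
      with U(4) v(2) have "qrad U E - b (card U) \<ge> qrad V E - b (card V) + 4 * \<epsilon> * (real (card V) - card U)"
        unfolding Suc(3) by (simp add: algebra_simps)
      with U show ?thesis by (intro exI[of _ U]) auto
    qed
  qed
  \<comment> \<open>Beyond this order the excess accumulated on the way down to order \<open>N1\<close> would exceed \<open>2 N1 - b N1\<close>.\<close>
  obtain N2 :: nat where N2: "real N2 > N1 + \<bar>2 * N1 - b N1\<bar> / (4 * \<epsilon>)" using reals_Archimedean2 by blast
  show ?thesis
  proof (intro exI[of _ N2] allI impI)
    fix V E assume A: "K V E" "card V \<ge> N2" "qrad V E \<ge> b (card V)"
    have "N1 \<le> N2" using N2 c by (smt (verit) divide_nonneg_pos of_nat_le_iff abs_ge_zero)
    then obtain k where "card V = N1 + k" using A(2) le_trans nat_le_iff_add by blast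
    from step[OF A(1) this] obtain U where U: "U \<subseteq> V" "card U \<ge> N1" "card U = N1 \<or> flat_eig \<delta> U E"
      "qrad U E - b (card U) \<ge> qrad V E - b (card V) + 4 * \<epsilon> * (real (card V) - card U)" by auto
    have GV: "sgraph V E" "sgraph U E" using A sg U(1) her by blast+
    have fin: "finite V" using GV by (auto dest: sgraphD)
    have cUV: "card U \<le> card V" using U fin by (simp add: card_mono)
    have "card U \<noteq> N1"
    proof
      assume e: "card U = N1"
      then have "U \<noteq> {}" using N1 by auto
      then have "qrad U E \<le> 2 * N1" using qrad_le[OF GV(2)] e by simp
      then have "4 * \<epsilon> * (real (card V) - N1) \<le> 2 * N1 - b N1" using U(4) A(3) e by simp
      then have "real (card V) \<le> N1 + \<bar>2 * N1 - b N1\<bar> / (4 * \<epsilon>)" using c(1) by (simp add: field_simps)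
      then show False using N2 A(2) by (meson not_le of_nat_le_iff order_trans order_less_le_trans)
    qed
    moreover have "U = V \<or> qrad U E > b (card U)"
    proof (cases "U = V")
      case False
      then have "card U < card V" using U(1) fin by (simp add: psubset_card_mono)
      then have "4 * \<epsilon> * (real (card V) - card U) > 0" using c by simp
      then show ?thesis using U(4) A(3) by simp
    qed simp
    moreover have "4 * \<epsilon> * (real (card V) - card U) \<ge> 0" using c cUV by simp
    then have "qrad U E \<ge> b (card U)" using U(4) A(3) by linarith
    ultimately show "\<exists>U\<subseteq>V. card U \<ge> N1 \<and> flat_eig \<delta> U E \<and> qrad U E \<ge> b (card U) \<and> (U = V \<or> qrad U E > b (card U))"
      using U by auto
  qed
qed

text \<open>
  The eigenvalue equation at \<open>v\<close> reads \<open>(q - d) x v =\<close> sum of the entries of the \<open>d\<close> neighbours. By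
  Cauchy-Schwarz and flatness \<open>(q - d)\<^sup>2\<close> is at most about \<open>d\<^sup>2\<close>, which means \<open>d \<ge> q / 2\<close> up to a small
  error.
\<close>

lemma flat_min_degree:
  assumes G: "sgraph V E" and fl: "flat_eig \<delta> V E" and v: "v \<in> V" and \<delta>: "0 \<le> \<delta>" "\<delta> \<le> 1"
    and q: "qrad V E \<ge> card V"
  shows "real (card (nbs V E v)) \<ge> qrad V E / 2 - 5/2 * \<delta> * card V"
proof -
  have fin: "finite V" using G by (rule sgraphD)
  define q where "q = qrad V E"
  define n where "n = real (card V)"
  define d where "d = real (card (nbs V E v))"
  obtain x where x: "\<And>v. x v \<ge> 0" "sqnorm V x = 1"
    "\<And>v. v \<in> V \<Longrightarrow> q * x v = (\<Sum>u\<in>nbs V E v. x v + x u)" "\<And>v. v \<in> V \<Longrightarrow> (x v)\<^sup>2 \<ge> (1 - \<delta>) / n"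
    using fl unfolding flat_eig_def q_def n_def by blast
  have n0: "n > 0" using v fin by (auto simp: n_def card_gt_0_iff)
  define N where "N = nbs V E v"
  have N: "finite N" "N \<subseteq> V" "d = card N" using fin by (auto simp: N_def nbs_def d_def)
  have dn: "0 \<le> d" "d \<le> n" using card_mono[OF fin N(2)] by (auto simp: N n_def)
  have "(\<Sum>u\<in>V - N. (1 - \<delta>) / n) \<le> (\<Sum>u\<in>V - N. (x u)\<^sup>2)" by (intro sum_mono) (use x in auto)
  also have "(\<Sum>u\<in>V - N. (x u)\<^sup>2) = 1 - (\<Sum>u\<in>N. (x u)\<^sup>2)"
    using x N fin by (simp add: sqnorm_def sum_diff)
  finally have "(n - d) * ((1 - \<delta>) / n) \<le> 1 - (\<Sum>u\<in>N. (x u)\<^sup>2)"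
    using N fin card_mono[OF fin N(2)] by (simp add: card_Diff_subset n_def of_nat_diff)
  then have 1: "n * (\<Sum>u\<in>N. (x u)\<^sup>2) \<le> n - (n - d) * (1 - \<delta>)"
    using n0 by (simp add: field_simps)
  have "q * x v = d * x v + (\<Sum>u\<in>N. x u)" using x(3)[OF v] by (simp add: sum.distrib N_def d_def)
  then have "(q - d)\<^sup>2 * (x v)\<^sup>2 = (\<Sum>u\<in>N. x u)\<^sup>2" by (simp add: algebra_simps flip: power_mult_distrib)
  also have "\<dots> \<le> (\<Sum>u\<in>N. (x u)\<^sup>2) * d"
    using sum_squared_le_sum_of_squares[of x N] by (simp add: N)
  finally have 2: "(q - d)\<^sup>2 * (x v)\<^sup>2 \<le> (\<Sum>u\<in>N. (x u)\<^sup>2) * d" .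
  have "(q - d)\<^sup>2 * (1 - \<delta>) = n * ((q - d)\<^sup>2 * ((1 - \<delta>) / n))" using n0 by simp
  also have "\<dots> \<le> n * ((q - d)\<^sup>2 * (x v)\<^sup>2)"
    using x(4)[OF v] n0 by (intro mult_left_mono) auto
  also have "\<dots> \<le> n * ((\<Sum>u\<in>N. (x u)\<^sup>2) * d)" using 2 n0 by (intro mult_left_mono) auto
  also have "\<dots> = (n * (\<Sum>u\<in>N. (x u)\<^sup>2)) * d" by simp
  also have "\<dots> \<le> (n - (n - d) * (1 - \<delta>)) * d" using 1 dn by (intro mult_right_mono) auto
  also have "\<dots> = d\<^sup>2 + \<delta> * ((n - d) * d)" by (simp add: power2_eq_square algebra_simps)
  also have "\<dots> \<le> d\<^sup>2 + \<delta> * (n * n)"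
    using dn \<delta> by (intro add_left_mono mult_left_mono mult_mono) auto
  finally have 3: "(q - d)\<^sup>2 * (1 - \<delta>) \<le> d\<^sup>2 + \<delta> * n\<^sup>2" by (simp add: power2_eq_square)
  have q2: "q \<le> 2 * n" using qrad_le[OF G] v by (auto simp: q_def n_def)
  have "(q - d)\<^sup>2 \<le> (2 * n)\<^sup>2" using q2 dn q by (intro power_mono) (auto simp: q_def n_def)
  then have "\<delta> * (q - d)\<^sup>2 \<le> \<delta> * (4 * n\<^sup>2)" using \<delta> by (intro mult_left_mono) (auto simp: power2_eq_square)
  with 3 have "q\<^sup>2 - 2 * q * d \<le> 5 * \<delta> * n\<^sup>2" by (simp add: power2_eq_square algebra_simps)
  also have "\<dots> \<le> 5 * \<delta> * (n * q)"
    using q \<delta> n0 by (intro mult_left_mono) (auto simp: q_def n_def power2_eq_square intro: mult_left_mono)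
  finally have "q * (q - 2 * d) \<le> q * (5 * \<delta> * n)" by (simp add: power2_eq_square algebra_simps)
  then have "q - 2 * d \<le> 5 * \<delta> * n" using q n0 by (simp add: q_def n_def mult_le_cancel_left)
  then show ?thesis by (simp add: q_def n_def d_def)
qed

text \<open>
  Scaling by the square root of the order makes the typical entry \<open>1\<close>. The last property bounds the
  entries from above: the eigenvalue equation and \<open>y u \<le> (1 + (y u)\<^sup>2) / 2\<close> give
  \<open>(q - n) y v \<le> n\<close>.
\<close>

lemma flat_scaled:
  assumes G: "sgraph V E" and fl: "flat_eig \<delta> V E" and q: "qrad V E > card V"
  obtains y where "\<And>v. y v \<ge> 0" "sqnorm V y = card V" "qform V E y = qrad V E * card V"
    "\<And>v. v \<in> V \<Longrightarrow> (y v)\<^sup>2 \<ge> 1 - \<delta>"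
    "\<And>v. v \<in> V \<Longrightarrow> y v * (qrad V E - card V) \<le> card V"
proof -
  have fin: "finite V" using G by (rule sgraphD)
  define q where "q = qrad V E"
  define n where "n = real (card V)"
  obtain x where x: "\<And>v. x v \<ge> 0" "sqnorm V x = 1"
    "\<And>v. v \<in> V \<Longrightarrow> q * x v = (\<Sum>u\<in>nbs V E v. x v + x u)" "\<And>v. v \<in> V \<Longrightarrow> (x v)\<^sup>2 \<ge> (1 - \<delta>) / n"
    using fl unfolding flat_eig_def q_def n_def by blast
  have "V \<noteq> {}" using x(2) by (auto simp: sqnorm_def)
  then have n0: "n > 0" using fin by (auto simp: n_def card_gt_0_iff)
  define y where "y = (\<lambda>v. sqrt n * x v)"
  have y0: "y v \<ge> 0" for v using x n0 by (simp add: y_def)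
  have ny: "sqnorm V y = n" unfolding y_def sqnorm_scale using x(2) n0 by simp
  have ey: "q * y v = (\<Sum>u\<in>nbs V E v. y v + y u)" if "v \<in> V" for v
  proof -
    have "q * y v = sqrt n * (q * x v)" by (simp add: y_def)
    also have "\<dots> = (\<Sum>u\<in>nbs V E v. y v + y u)"
      unfolding x(3)[OF that] y_def by (simp add: sum_distrib_left distrib_left)
    finally show ?thesis .
  qed
  have "qform V E y = (\<Sum>v\<in>V. y v * (q * y v))" unfolding qform_self[OF G] by (intro sum.cong refl) (simp add: ey)
  also have "\<dots> = q * n" unfolding ny[symmetric] sqnorm_def sum_distrib_left
    by (intro sum.cong refl) (simp add: power2_eq_square algebra_simps)
  finally have qy: "qform V E y = q * n" .
  have sy: "(\<Sum>u\<in>V. y u) \<le> n"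
  proof -
    have "y u \<le> (1 + (y u)\<^sup>2) / 2" for u using sum_squares_ge_zero[of "y u - 1" 0] by (simp add: power2_eq_square algebra_simps)
    then have "(\<Sum>u\<in>V. y u) \<le> (\<Sum>u\<in>V. (1 + (y u)\<^sup>2) / 2)" by (intro sum_mono)
    also have "\<dots> = (n + sqnorm V y) / 2" by (simp add: sqnorm_def n_def sum.distrib flip: sum_divide_distrib)
    finally show ?thesis using ny by simp
  qed
  show ?thesis
  proof (rule that[of y])
    show "y v \<ge> 0" for v by fact
    show "sqnorm V y = card V" using ny by (simp add: n_def)
    show "qform V E y = qrad V E * card V" using qy by (simp add: q_def n_def)
    fix v assume v: "v \<in> V"
    have "(y v)\<^sup>2 = n * (x v)\<^sup>2" using n0 by (simp add: y_def power_mult_distrib)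
    then show "(y v)\<^sup>2 \<ge> 1 - \<delta>" using x(4)[OF v] n0 by (simp add: field_simps)
    define N where "N = nbs V E v"
    have N: "finite N" "N \<subseteq> V" using fin by (auto simp: N_def nbs_def)
    have "q * y v = card N * y v + (\<Sum>u\<in>N. y u)" using ey[OF v] by (simp add: sum.distrib N_def)
    also have "card N * y v \<le> n * y v" using y0 card_mono[OF fin N(2)] by (intro mult_right_mono) (auto simp: n_def)
    also have "(\<Sum>u\<in>N. y u) \<le> (\<Sum>u\<in>V. y u)" using N fin y0 by (intro sum_mono2) auto
    finally have "y v * (q - n) \<le> n" using sy by (simp add: algebra_simps)
    then show "y v * (qrad V E - card V) \<le> card V" by (simp add: q_def n_def)
  qed
qed

section \<open>Matchings and complete multipartite subgraphs\<close>

text \<open>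
  The \<open>a\<close>-th edge of the matching joins the images of \<open>2 a\<close> and \<open>2 a + 1\<close>, in accordance with the
  numbering of the vertices of \<open>k\<close> disjoint copies of \<open>K\<^sub>2\<close>.
\<close>

definition matching :: "('a \<Rightarrow> 'a \<Rightarrow> bool) \<Rightarrow> 'a set \<Rightarrow> nat \<Rightarrow> bool" where
  "matching E X k \<longleftrightarrow> (\<exists>e. inj_on e {..<2 * k} \<and> e ` {..<2 * k} \<subseteq> X \<and> (\<forall>a<k. E (e (2 * a)) (e (2 * a + 1))))"

text \<open>
  The sets \<open>A 0, \<dots>, A (p - 1)\<close> span a graph containing the complete \<open>p\<close>-partite graph on them. They
  are automatically disjoint when \<open>E\<close> is irreflexive.
\<close>

definition complete_parts :: "('a \<Rightarrow> 'a \<Rightarrow> bool) \<Rightarrow> nat \<Rightarrow> (nat \<Rightarrow> 'a set) \<Rightarrow> bool" where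
  "complete_parts E p A \<longleftrightarrow> (\<forall>c<p. \<forall>d<p. c \<noteq> d \<longrightarrow> (\<forall>u\<in>A c. \<forall>v\<in>A d. E u v))"

text \<open>
  A copy of the forbidden graph with \<open>p = r - 1\<close>: the set \<open>P\<close> receives the \<open>t\<close> disjoint edges and the
  \<open>s - 2 t\<close> isolated vertices, and the sets \<open>Q c\<close> are the parts of the Turan graph on \<open>s p\<close> vertices,
  each of order exactly \<open>s\<close>.
\<close>

definition has_F :: "nat \<Rightarrow> nat \<Rightarrow> nat \<Rightarrow> 'a set \<Rightarrow> ('a \<Rightarrow> 'a \<Rightarrow> bool) \<Rightarrow> bool" where
  "has_F s t p V E \<longleftrightarrow> (\<exists>P Q. P \<subseteq> V \<and> card P = s \<and> matching E P t \<and>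
     (\<forall>c<p. Q c \<subseteq> V \<and> card (Q c) = s \<and> (\<forall>u\<in>P. \<forall>v\<in>Q c. E u v)) \<and> complete_parts E p Q)"

lemma has_F_mono: "has_F s t p U E \<Longrightarrow> U \<subseteq> V \<Longrightarrow> has_F s t p V E"
  unfolding has_F_def
proof (elim exE conjE, intro exI conjI)
  fix P Q
  assume "U \<subseteq> V" "P \<subseteq> U" and Q: "\<forall>c<p. Q c \<subseteq> U \<and> card (Q c) = s \<and> (\<forall>u\<in>P. \<forall>v\<in>Q c. E u v)"
  then show "P \<subseteq> V" "\<forall>c<p. Q c \<subseteq> V \<and> card (Q c) = s \<and> (\<forall>u\<in>P. \<forall>v\<in>Q c. E u v)" by blast+
qed

lemma complete_partsD:
  "complete_parts E p A \<Longrightarrow> c < p \<Longrightarrow> d < p \<Longrightarrow> c \<noteq> d \<Longrightarrow> u \<in> A c \<Longrightarrow> v \<in> A d \<Longrightarrow> E u v"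
  by (auto simp: complete_parts_def)

lemma complete_parts_disjoint:
  "complete_parts E p A \<Longrightarrow> (\<And>u. \<not> E u u) \<Longrightarrow> c < p \<Longrightarrow> d < p \<Longrightarrow> c \<noteq> d \<Longrightarrow> A c \<inter> A d = {}"
  using complete_partsD[of E p A c d] by blast

lemma matching_0[simp]: "matching E X 0"
  by (auto simp: matching_def)

lemma matching_mono: "matching E X k \<Longrightarrow> X \<subseteq> Y \<Longrightarrow> matching E Y k"
  unfolding matching_def by (meson order_trans)

lemma matching_insert:
  assumes "matching E X k" "u \<notin> X" "v \<notin> X" "u \<noteq> v" "E u v"
  shows "matching E (insert u (insert v X)) (Suc k)"
proof -
  obtain e where e: "inj_on e {..<2 * k}" "e ` {..<2 * k} \<subseteq> X" "\<And>a. a < k \<Longrightarrow> E (e (2 * a)) (e (2 * a + 1))"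
    using assms(1) by (auto simp: matching_def)
  define f where "f = e(2 * k := u, 2 * k + 1 := v)"
  have S: "{..<2 * Suc k} = insert (2 * k) (insert (2 * k + 1) {..<2 * k})" by auto
  have fe: "f i = e i" if "i < 2 * k" for i using that by (simp add: f_def)
  then have im: "f ` {..<2 * k} = e ` {..<2 * k}" by (intro image_cong) auto
  have inj: "inj_on f {..<2 * k}" using e(1) fe by (simp add: inj_on_def)
  have f2: "f (2 * k) = u" "f (2 * k + 1) = v" by (auto simp: f_def)
  have "inj_on f {..<2 * Suc k}"
    unfolding S inj_on_insert using inj f2 im e(2) assms(2-4) by auto
  moreover have "f ` {..<2 * Suc k} \<subseteq> insert u (insert v X)"
    unfolding S using f2 im e(2) by auto
  moreover have "E (f (2 * a)) (f (2 * a + 1))" if "a < Suc k" for a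
  proof (cases "a = k")
    case True
    then show ?thesis using f2 assms(5) by simp
  next
    case False
    then have "a < k" using that by simp
    then show ?thesis using e(3)[of a] fe[of "2 * a"] fe[of "2 * a + 1"] by simp
  qed
  ultimately show ?thesis unfolding matching_def by blast
qed

text \<open>
  The set \<open>Y\<close> consists of the end vertices of the matching.
\<close>

lemma matching_span:
  assumes "matching E X k"
  obtains Y where "Y \<subseteq> X" "finite Y" "card Y = 2 * k" "matching E Y k"
proof -
  obtain e where e: "inj_on e {..<2 * k}" "e ` {..<2 * k} \<subseteq> X" "\<And>a. a < k \<Longrightarrow> E (e (2 * a)) (e (2 * a + 1))"
    using assms(1) by (auto simp: matching_def)
  show ?thesis
    by (rule that[of "e ` {..<2 * k}"]) (use e in \<open>auto simp: card_image matching_def\<close>)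
qed

lemma matching_complete_bipartite:
  assumes "finite X" "finite Y" "k \<le> card X" "k \<le> card Y" "X \<inter> Y = {}" "\<And>x y. x \<in> X \<Longrightarrow> y \<in> Y \<Longrightarrow> E x y"
  shows "matching E (X \<union> Y) k"
  using assms
proof (induction k arbitrary: X Y)
  case (Suc k)
  obtain x y where xy: "x \<in> X" "y \<in> Y" using Suc.prems(3,4) by (metis all_not_in_conv card.empty not_less_eq_eq zero_le)
  have "matching E ((X - {x}) \<union> (Y - {y})) k"
    using Suc.prems xy by (intro Suc.IH) auto
  then have "matching E (insert x (insert y ((X - {x}) \<union> (Y - {y})))) (Suc k)"
    using xy Suc.prems by (intro matching_insert) auto
  then show ?case by (rule matching_mono) (use xy in auto)
qed simp

text \<open>
  The end vertices of a maximal matching meet every edge.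
\<close>

lemma vertex_cover_of_no_matching:
  assumes "sgraph X E" "\<not> matching E X (Suc k)"
  shows "\<exists>C\<subseteq>X. card C \<le> 2 * k \<and> (\<forall>u\<in>X - C. \<forall>v\<in>X - C. \<not> E u v)"
  using assms
proof (induction k arbitrary: X)
  case 0
  have "\<not> E u v" if "u \<in> X" "v \<in> X" for u v
  proof
    assume "E u v"
    then have "matching E (insert u (insert v {})) (Suc 0)"
      using sgraphD(3)[OF 0(1)] by (intro matching_insert) auto
    then show False using 0(2) that by (auto dest: matching_mono[where Y = X])
  qed
  then show ?case by (intro exI[of _ "{}"]) auto
next
  case (Suc k)
  show ?case
  proof (cases "\<exists>u\<in>X. \<exists>v\<in>X. E u v")
    case True
    then obtain u v where uv: "u \<in> X" "v \<in> X" "E u v" by auto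
    define X' where "X' = X - {u, v}"
    have G: "sgraph X' E" using Suc.prems(1) by (rule sgraph_mono) (auto simp: X'_def)
    have ne: "u \<noteq> v" using uv sgraphD(3)[OF G] by auto
    have "\<not> matching E X' (Suc k)"
    proof
      assume "matching E X' (Suc k)"
      then have "matching E (insert u (insert v X')) (Suc (Suc k))"
        using uv ne by (intro matching_insert) (auto simp: X'_def)
      then show False using Suc.prems(2) uv by (auto simp: X'_def dest: matching_mono[where Y = X])
    qed
    then obtain C where C: "C \<subseteq> X'" "card C \<le> 2 * k" "\<forall>u\<in>X' - C. \<forall>v\<in>X' - C. \<not> E u v"
      using Suc.IH[OF G] by auto
    have "finite C" using C(1) G by (auto simp: sgraph_def finite_subset)
    then have "card (insert u (insert v C)) \<le> 2 * Suc k" using C(2) by (auto simp: card_insert_if)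
    moreover have "\<forall>u'\<in>X - insert u (insert v C). \<forall>v'\<in>X - insert u (insert v C). \<not> E u' v'"
      using C(3) by (auto simp: X'_def)
    ultimately show ?thesis using uv C(1) by (intro exI[of _ "insert u (insert v C)"]) (auto simp: X'_def)
  qed (auto intro: exI[of _ "{}"])
qed

text \<open>
  Two of the parts are merged: \<open>s - t\<close> vertices of one and \<open>t\<close> of the other contain \<open>t\<close> disjoint edges
  because \<open>t \<le> s - t\<close>.
\<close>

lemma has_F_of_complete_parts:
  assumes "sgraph V E" "complete_parts E (Suc (Suc p)) A" "\<And>i. i < Suc (Suc p) \<Longrightarrow> A i \<subseteq> V \<and> card (A i) = s" "2 * t \<le> s"
  shows "has_F s t p V E"
proof -
  have fin: "finite (A i)" if "i < Suc (Suc p)" for i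
    using assms(1,3) that by (auto simp: sgraph_def intro: finite_subset)
  obtain X where X: "X \<subseteq> A p" "card X = s - t" "finite X"
    using obtain_subset_with_card_n[of "s - t" "A p"] assms(3)[of p] fin[of p] by auto
  obtain Y where Y: "Y \<subseteq> A (Suc p)" "card Y = t" "finite Y"
    using obtain_subset_with_card_n[of t "A (Suc p)"] assms(3)[of "Suc p"] assms(4) fin[of "Suc p"] by auto
  have cp: "E u v" if "c < Suc (Suc p)" "d < Suc (Suc p)" "c \<noteq> d" "u \<in> A c" "v \<in> A d" for c d u v
    using assms(2) that by (auto simp: complete_parts_def)
  have disj: "X \<inter> Y = {}" using cp[of p "Suc p"] X(1) Y(1) sgraphD(3)[OF assms(1)] by fastforce
  have "matching E (X \<union> Y) t"
    using X Y assms(4) disj by (intro matching_complete_bipartite) (auto intro: cp[of p "Suc p"])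
  moreover have "card (X \<union> Y) = s" using X Y disj assms(4) by (simp add: card_Un_disjoint)
  moreover have "X \<union> Y \<subseteq> V" using X Y assms(3)[of p] assms(3)[of "Suc p"] by auto
  moreover have "E u v" if "c < p" "u \<in> X \<union> Y" "v \<in> A c" for c u v
    using that cp[of p c u v] cp[of "Suc p" c u v] X(1) Y(1) by auto
  moreover have "complete_parts E p A" using assms(2) unfolding complete_parts_def by (meson less_SucI)
  ultimately show ?thesis unfolding has_F_def using assms(3)
    by (intro exI[of _ "X \<union> Y"] exI[of _ A]) auto
qed

text \<open>
  There are only \<open>2 ^ card A\<close> possible neighbourhoods in \<open>A\<close>.
\<close>

lemma nbhd_pigeonhole:
  assumes "finite D" "finite A" "m * 2 ^ card A \<le> card D"
  shows "\<exists>I\<subseteq>A. m \<le> card {v\<in>D. nbs A E v = I}"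
proof (rule ccontr)
  assume "\<not> ?thesis"
  then have lt: "card {v\<in>D. nbs A E v = I} < m" if "I \<subseteq> A" for I using that by auto
  have "nbs A E v \<in> Pow A" for v by (auto simp: nbs_def)
  then have "D = (\<Union>I\<in>Pow A. {v\<in>D. nbs A E v = I})" by blast
  moreover have "card (\<Union>I\<in>Pow A. {v\<in>D. nbs A E v = I}) \<le> (\<Sum>I\<in>Pow A. card {v\<in>D. nbs A E v = I})"
    by (rule card_UN_le) (use assms(2) in simp)
  ultimately have "card D \<le> (\<Sum>I\<in>Pow A. card {v\<in>D. nbs A E v = I})" by simp
  also have "\<dots> < (\<Sum>I\<in>Pow A. m)" using lt assms(2) by (intro sum_strict_mono) auto
  also have "\<dots> = m * 2 ^ card A" by (simp add: card_Pow assms(2))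
  finally show False using assms(3) by simp
qed

lemma double_count_nbs:
  assumes "finite V" "finite A" "\<And>u v. E u v \<Longrightarrow> E v u"
  shows "(\<Sum>v\<in>V. card (nbs A E v)) = (\<Sum>a\<in>A. card (nbs V E a))"
proof -
  have c: "card (nbs A E v) = (\<Sum>a\<in>A. if E v a then 1 else 0)" if "finite A" for A :: "'a set" and v
    using that by (simp add: nbs_def sum.If_cases Int_def)
  have "(\<Sum>v\<in>V. card (nbs A E v)) = (\<Sum>v\<in>V. \<Sum>a\<in>A. if E v a then 1 else 0)"
    using c assms by simp
  also have "\<dots> = (\<Sum>a\<in>A. \<Sum>v\<in>V. if E v a then 1 else 0)" by (rule sum.swap)
  also have "\<dots> = (\<Sum>a\<in>A. \<Sum>v\<in>V. if E a v then 1 else 0)"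
    by (intro sum.cong refl) (use assms(3) in auto)
  finally show ?thesis using c assms by simp
qed

text \<open>
  Among the vertices of \<open>D\<close> some \<open>m\<close> have the same neighbourhood in the union of the parts. They form
  the new part, and each old part is cut down to \<open>m\<close> elements of that common neighbourhood.
\<close>

lemma extend_complete_parts:
  assumes G: "sgraph V E" and A: "\<And>i. i < P \<Longrightarrow> A i \<subseteq> V" "complete_parts E P A"
    and D: "D \<subseteq> V" "\<And>v i. v \<in> D \<Longrightarrow> i < P \<Longrightarrow> m \<le> card (nbs (A i) E v)"
    and card: "m * 2 ^ card (\<Union>i<P. A i) \<le> card D"
  shows "\<exists>B. (\<forall>i<Suc P. B i \<subseteq> V \<and> card (B i) = m) \<and> complete_parts E (Suc P) B"
proof (cases "m = 0")
  case True
  then show ?thesis by (intro exI[of _ "\<lambda>_. {}"]) (auto simp: complete_parts_def)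
next
  case False
  have fin: "finite V" using G by (rule sgraphD)
  define AA where "AA = (\<Union>i<P. A i)"
  have fAA: "finite AA" using A(1) fin by (auto simp: AA_def intro: finite_subset)
  have fD: "finite D" using D(1) fin by (rule finite_subset)
  obtain I where I: "I \<subseteq> AA" "m \<le> card {v\<in>D. nbs AA E v = I}"
    using nbhd_pigeonhole[OF fD fAA, of m E] card by (auto simp: AA_def)
  obtain D' where D': "D' \<subseteq> {v\<in>D. nbs AA E v = I}" "card D' = m" "finite D'"
    using obtain_subset_with_card_n[OF I(2)] by auto
  have "D' \<noteq> {}" using D' False by auto
  then obtain v0 where v0: "v0 \<in> D'" by auto
  have "\<exists>S. S \<subseteq> I \<inter> A i \<and> card S = m" if "i < P" for i
  proof -
    have "nbs (A i) E v0 = I \<inter> A i" using v0 D'(1) that by (auto simp: nbs_def AA_def)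
    then have "m \<le> card (I \<inter> A i)" using D(2)[of v0 i] v0 D'(1) that by auto
    then show ?thesis by (metis obtain_subset_with_card_n)
  qed
  then obtain S where S: "\<And>i. i < P \<Longrightarrow> S i \<subseteq> I \<inter> A i \<and> card (S i) = m" by metis
  define B where "B = (\<lambda>i. if i < P then S i else D')"
  have DI: "E v a" "E a v" if "v \<in> D'" "a \<in> I" for v a
  proof -
    have "a \<in> nbs AA E v" using that D' by auto
    then show "E v a" "E a v" using sgraphD(2)[OF G] by (auto simp: nbs_def)
  qed
  have "complete_parts E (Suc P) B"
    unfolding complete_parts_def
  proof (intro allI impI ballI)
    fix c d u v assume cd: "c < Suc P" "d < Suc P" "c \<noteq> d" and uv: "u \<in> B c" "v \<in> B d"
    consider "c < P" "d < P" | "c = P" "d < P" | "c < P" "d = P" using cd by linarith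
    then show "E u v"
    proof cases
      case 1
      then have "u \<in> A c" "v \<in> A d" using uv S[of c] S[of d] unfolding B_def by auto
      then show ?thesis using complete_partsD[OF A(2) 1 cd(3)] by auto
    next
      case 2
      then show ?thesis using uv S[of d] DI[of u v] by (auto simp: B_def)
    next
      case 3
      then show ?thesis using uv S[of c] DI[of v u] by (auto simp: B_def)
    qed
  qed
  moreover have "B i \<subseteq> V \<and> card (B i) = m" if "i < Suc P" for i
  proof (cases "i < P")
    case True
    then show ?thesis using S[OF True] A(1)[OF True] unfolding B_def by auto
  next
    case False
    then show ?thesis using D(1) D' unfolding B_def by auto
  qed
  ultimately show ?thesis by blast
qed

lemma card_nbs_UN_le: fixes P :: nat shows "card (nbs (\<Union>i<P. A i) E v) \<le> (\<Sum>i<P. card (nbs (A i) E v))"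
proof -
  have "nbs (\<Union>i<P. A i) E v = (\<Union>i<P. nbs (A i) E v)" by (auto simp: nbs_def)
  moreover have "card (\<Union>i\<in>{..<P}. nbs (A i) E v) \<le> (\<Sum>i<P. card (nbs (A i) E v))" by (rule card_UN_le) simp
  ultimately show ?thesis by simp
qed

lemma complete_parts_card_UN:
  assumes "sgraph V E" "\<And>i. i < P \<Longrightarrow> A i \<subseteq> V \<and> card (A i) = m" "complete_parts E P A"
  shows "card (\<Union>i<P. A i) = P * m"
proof -
  have "card (\<Union>i<P. A i) = (\<Sum>i<P. card (A i))"
    using assms(2) sgraphD(1)[OF assms(1)] complete_parts_disjoint[OF assms(3) sgraphD(3)[OF assms(1)]]
    by (intro card_UN_disjoint) (auto intro: finite_subset)
  then show ?thesis using assms(2) by simp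
qed

lemma card_nbs_le: "finite A \<Longrightarrow> card (nbs A E v) \<le> card A"
  by (rule card_mono) (auto simp: nbs_def)

lemma card_nbs_UN_le_except:
  assumes "i < P" "\<And>j. j < P \<Longrightarrow> finite (A j) \<and> card (A j) = M"
  shows "card (nbs (\<Union>j<P. A j) E v) \<le> (P - 1) * M + card (nbs (A i) E v)"
proof -
  have "(\<Sum>j<P. card (nbs (A j) E v)) = card (nbs (A i) E v) + (\<Sum>j\<in>{..<P} - {i}. card (nbs (A j) E v))"
    using assms(1) by (intro sum.remove) auto
  also have "(\<Sum>j\<in>{..<P} - {i}. card (nbs (A j) E v)) \<le> (\<Sum>j\<in>{..<P} - {i}. M)"
  proof (intro sum_mono)
    fix j assume "j \<in> {..<P} - {i}"
    then have "finite (A j) \<and> card (A j) = M" using assms(2) by auto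
    then show "card (nbs (A j) E v) \<le> M" using card_nbs_le[of "A j" E v] by simp
  qed
  also have "\<dots> = (P - 1) * M" using assms(1) by simp
  finally show ?thesis using card_nbs_UN_le[of A P E v] by simp
qed

text \<open>
  Induction on the number of parts. Given \<open>p\<close> parts of a large constant order \<open>M\<close>, a vertex having
  fewer than \<open>m\<close> neighbours in one of them sends at most \<open>(p - 1) M + m\<close> edges to their union. Counting
  these edges from both sides, the degree condition leaves linearly many vertices with at least \<open>m\<close>
  neighbours in each part, and \<open>extend_complete_parts\<close> applies.
\<close>

lemma erdos_stone_min_degree:
  fixes \<eta> :: real
  assumes \<eta>: "\<eta> > 0"
  shows "\<exists>N. \<forall>V (E :: 'a \<Rightarrow> 'a \<Rightarrow> bool). sgraph V E \<longrightarrow> card V \<ge> N \<longrightarrow>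
    (p > 0 \<longrightarrow> (\<forall>v\<in>V. real (card (nbs V E v)) \<ge> (1 - 1 / p + \<eta>) * card V)) \<longrightarrow>
    (\<exists>A. (\<forall>i<Suc p. A i \<subseteq> V \<and> card (A i) = m) \<and> complete_parts E (Suc p) A)"
proof (induction p arbitrary: m)
  case 0
  have "\<exists>A. (\<forall>i<Suc 0. A i \<subseteq> V \<and> card (A i) = m) \<and> complete_parts E (Suc 0) A"
    if mV: "m \<le> card V" for V :: "'a set" and E
  proof -
    obtain S where "S \<subseteq> V" "card S = m" using obtain_subset_with_card_n[OF mV] by blast
    then show ?thesis by (intro exI[of _ "\<lambda>_. S"]) (auto simp: complete_parts_def)
  qed
  then show ?case by blast
next
  case (Suc p)
  define P where "P = Suc p"
  \<comment> \<open>With this \<open>M\<close> the surplus \<open>\<eta>\<close> in the degrees outweighs the error \<open>m\<close> in the edge count.\<close>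
  obtain M :: nat where M: "real M \<ge> 2 * m / (P * \<eta>)" "M > 0"
    by (meson dual_order.trans gt_ex linorder_le_cases not_less_iff_gr_or_eq of_nat_le_iff real_arch_simple zero_less_Suc Suc_le_eq less_le_trans)
  have "P * \<eta> > 0" using \<eta> by (simp add: P_def)
  then have "2 * real m \<le> M * (P * \<eta>)" using M(1) by (simp only: pos_divide_le_eq of_nat_mult of_nat_numeral)
  then have PM: "real m \<le> P * M * \<eta> / 2" by (simp add: algebra_simps)
  obtain N0 where N0: "\<And>V (E :: 'a \<Rightarrow> 'a \<Rightarrow> bool). sgraph V E \<Longrightarrow> card V \<ge> N0 \<Longrightarrow>
    (p > 0 \<longrightarrow> (\<forall>v\<in>V. real (card (nbs V E v)) \<ge> (1 - 1 / p + \<eta>) * card V)) \<Longrightarrow>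
    (\<exists>A. (\<forall>i<P. A i \<subseteq> V \<and> card (A i) = M) \<and> complete_parts E P A)"
    using Suc.IH[of M] unfolding P_def by blast
  obtain N1 :: nat where N1: "real N1 \<ge> 2 * (m * 2 ^ (P * M)) / \<eta>" using real_arch_simple by blast
  show ?case
  proof (intro exI[of _ "max N0 N1"] allI impI)
    fix V :: "'a set" and E assume G: "sgraph V E" and nV: "card V \<ge> max N0 N1"
      and "0 < Suc p \<longrightarrow> (\<forall>v\<in>V. real (card (nbs V E v)) \<ge> (1 - 1 / Suc p + \<eta>) * card V)"
    then have deg: "\<And>v. v \<in> V \<Longrightarrow> real (card (nbs V E v)) \<ge> (1 - 1 / P + \<eta>) * card V" by (auto simp: P_def)
    have fin: "finite V" using G by (rule sgraphD)
    define n where "n = real (card V)"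
    have "real (card (nbs V E v)) \<ge> (1 - 1 / p + \<eta>) * card V" if "p > 0" "v \<in> V" for v
    proof -
      have "1 / real P \<le> 1 / real p" using that by (simp add: P_def field_simps)
      then have "(1 - 1 / p + \<eta>) * card V \<le> (1 - 1 / P + \<eta>) * card V" by (intro mult_right_mono) auto
      then show ?thesis using deg[OF that(2)] by linarith
    qed
    then obtain A where A: "\<And>i. i < P \<Longrightarrow> A i \<subseteq> V \<and> card (A i) = M" "complete_parts E P A"
      using N0[OF G] nV by auto
    have fA: "finite (A i)" if "i < P" for i using A(1)[OF that] fin by (auto intro: finite_subset)
    define AA where "AA = (\<Union>i<P. A i)"
    have cAA: "card AA = P * M" unfolding AA_def by (rule complete_parts_card_UN[OF G A])
    have AAV: "AA \<subseteq> V" using A by (auto simp: AA_def)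
    have fAA: "finite AA" using AAV fin by (rule finite_subset)
    define D where "D = {v\<in>V. \<forall>i<P. m \<le> card (nbs (A i) E v)}"
    have fD: "finite D" using fin by (simp add: D_def)
    have DV: "D \<subseteq> V" by (auto simp: D_def)
    have le: "card (nbs AA E v) \<le> ((P - 1) * M + m) + (if v \<in> D then P * M else 0)" if vV: "v \<in> V" for v
    proof (cases "v \<in> D")
      case True
      have "card (nbs AA E v) \<le> P * M" using card_nbs_le[OF fAA, of E v] cAA by simp
      then show ?thesis using True by simp
    next
      case False
      then obtain i where i: "i < P" "card (nbs (A i) E v) < m" using vV by (auto simp: D_def)
      have "card (nbs AA E v) \<le> (P - 1) * M + card (nbs (A i) E v)"
        unfolding AA_def by (rule card_nbs_UN_le_except[OF i(1)]) (use A fA in auto)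
      then show ?thesis using i False by simp
    qed
    have "P * M * ((1 - 1 / P + \<eta>) * n) = (\<Sum>a\<in>AA. (1 - 1 / P + \<eta>) * n)" using cAA by simp
    also have "\<dots> \<le> (\<Sum>a\<in>AA. real (card (nbs V E a)))" using deg AAV by (intro sum_mono) (auto simp: n_def)
    also have "\<dots> = (\<Sum>v\<in>V. real (card (nbs AA E v)))"
      using double_count_nbs[OF fin fAA sgraphD(2)[OF G]] by (simp flip: of_nat_sum)
    also have "\<dots> \<le> (\<Sum>v\<in>V. real ((P - 1) * M + m) + (if v \<in> D then real (P * M) else 0))"
    proof (intro sum_mono)
      fix v assume "v \<in> V"
      from of_nat_mono[OF le[OF this], where 'a = real]
      show "real (card (nbs AA E v)) \<le> real ((P - 1) * M + m) + (if v \<in> D then real (P * M) else 0)"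
        by (auto split: if_splits)
    qed
    also have "\<dots> = n * real ((P - 1) * M + m) + card D * (P * M)"
      using fin DV by (simp add: sum.distrib n_def sum.If_cases Int_absorb1)
    finally have "P * M * ((1 - 1 / P + \<eta>) * n) \<le> n * ((real P - 1) * M + m) + card D * (P * M)"
      by (simp add: P_def)
    moreover have "P * M * ((1 - 1 / P + \<eta>) * n) = (real P - 1) * M * n + P * M * \<eta> * n"
      by (simp add: P_def field_simps)
    ultimately have "(real P - 1) * M * n + P * M * \<eta> * n \<le> n * ((real P - 1) * M + m) + card D * (P * M)" by linarith
    then have "n * (P * M * \<eta> - m) \<le> card D * (P * M)" by (simp add: algebra_simps)
    moreover have "n * (P * M * \<eta> / 2) \<le> n * (P * M * \<eta> - m)"
      using PM by (intro mult_left_mono) (auto simp: n_def mult_ac)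
    ultimately have "(P * M) * (n * \<eta> / 2) \<le> (P * M) * card D" by (simp add: algebra_simps)
    moreover have "real P * real M > 0" using M(2) by (simp add: P_def)
    ultimately have "n * \<eta> / 2 \<le> card D" by (simp only: mult_le_cancel_left_pos of_nat_mult)
    moreover have "real (m * 2 ^ (P * M)) \<le> n * \<eta> / 2"
    proof -
      have "2 * (m * 2 ^ (P * M)) / \<eta> \<le> n" using N1 nV by (simp add: n_def)
      then show ?thesis using \<eta> by (simp add: field_simps)
    qed
    ultimately have "m * 2 ^ card AA \<le> card D" unfolding cAA using of_nat_le_iff order_trans by blast
    then show "\<exists>A. (\<forall>i<Suc (Suc p). A i \<subseteq> V \<and> card (A i) = m) \<and> complete_parts E (Suc (Suc p)) A"
      using extend_complete_parts[OF G _ A(2) DV, of m] A(1) unfolding P_def D_def AA_def by auto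
  qed
qed

section \<open>Independent parts from a minimum degree condition\<close>

text \<open>
  \<open>skip i\<close> enumerates the numbers different from \<open>i\<close> in increasing order; it matches the indices of
  \<open>r - 1\<close> parts with the indices below \<open>r\<close> other than \<open>i\<close>.
\<close>

definition skip :: "nat \<Rightarrow> nat \<Rightarrow> nat" where
  "skip i c = (if c < i then c else Suc c)"

lemma skip_props: "c < r - 1 \<Longrightarrow> i < r \<Longrightarrow> skip i c < r" "skip i c \<noteq> i" "skip i c = skip i d \<longleftrightarrow> c = d"
  by (auto simp: skip_def)

text \<open>
  Union bound over the non-neighbours of the elements of \<open>Y\<close>.
\<close>

lemma card_common_nbs_sum:
  assumes "finite A" "finite Y"
  shows "real (card A) - (\<Sum>y\<in>Y. real (card (A - nbs A E y))) \<le> card {a\<in>A. \<forall>y\<in>Y. E y a}"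
proof -
  have "A - {a\<in>A. \<forall>y\<in>Y. E y a} = (\<Union>y\<in>Y. A - nbs A E y)" by (auto simp: nbs_def)
  then have "card (A - {a\<in>A. \<forall>y\<in>Y. E y a}) \<le> (\<Sum>y\<in>Y. card (A - nbs A E y))"
    using card_UN_le[OF assms(2), of "\<lambda>y. A - nbs A E y"] by simp
  moreover have "card A = card (A - {a\<in>A. \<forall>y\<in>Y. E y a}) + card {a\<in>A. \<forall>y\<in>Y. E y a}"
    using assms(1) card_Diff_subset[of "{a\<in>A. \<forall>y\<in>Y. E y a}" A] card_mono[of A "{a\<in>A. \<forall>y\<in>Y. E y a}"] by auto
  ultimately have "card A \<le> (\<Sum>y\<in>Y. card (A - nbs A E y)) + card {a\<in>A. \<forall>y\<in>Y. E y a}" by linarith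
  then have "real (card A) \<le> real ((\<Sum>y\<in>Y. card (A - nbs A E y)) + card {a\<in>A. \<forall>y\<in>Y. E y a})" by (rule of_nat_mono)
  then show ?thesis by simp
qed

lemma card_common_nbs:
  fixes b :: real
  assumes "finite A" "finite Y" "\<And>y. y \<in> Y \<Longrightarrow> real (card (A - nbs A E y)) \<le> b"
  shows "real (card {a\<in>A. \<forall>y\<in>Y. E y a}) \<ge> card A - card Y * b"
proof -
  have "(\<Sum>y\<in>Y. real (card (A - nbs A E y))) \<le> (\<Sum>y\<in>Y. b)" by (intro sum_mono assms(3))
  then show ?thesis using card_common_nbs_sum[OF assms(1,2), of E] by simp
qed

lemma card_diff_nbs: "finite A \<Longrightarrow> real (card (A - nbs A E v)) = real (card A) - card (nbs A E v)"
  by (subst card_Diff_subset) (auto simp: nbs_def card_mono of_nat_diff)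

text \<open>
  The vertices of \<open>X\<close> behave like vertices of the part \<open>A i\<close>: they are joined to almost everything in
  the other parts. A matching of \<open>t\<close> edges in \<open>X\<close>, filled up with vertices of \<open>A i\<close>, would be completed
  to a copy of the forbidden graph by common neighbours in the other parts.
\<close>

lemma few_neighbours_no_matching:
  fixes b :: real
  assumes G: "sgraph V E" and nF: "\<not> has_F s t (r - 1) V E" and st: "2 * t \<le> s"
    and A: "\<And>j. j < r \<Longrightarrow> A j \<subseteq> V \<and> card (A j) = M" "complete_parts E r A" and i: "i < r"
    and X: "X \<subseteq> V" "\<And>v j. v \<in> X \<Longrightarrow> j < r \<Longrightarrow> j \<noteq> i \<Longrightarrow> real (card (A j - nbs (A j) E v)) \<le> b"
    and M: "2 * t * b + s \<le> M" "0 \<le> b"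
  shows "\<not> matching E X t"
proof
  assume "matching E X t"
  then obtain Y where Y: "Y \<subseteq> X" "finite Y" "card Y = 2 * t" "matching E Y t" by (rule matching_span)
  have fin: "finite V" using G by (rule sgraphD)
  have fA: "finite (A j)" if "j < r" for j using A(1)[OF that] fin by (auto intro: finite_subset)
  have "real s \<le> M" using M by (smt (verit) mult_nonneg_nonneg of_nat_0_le_iff)
  then have "s \<le> M" by simp
  moreover have "card (A i) - card Y \<le> card (A i - Y)" using Y(2) by (rule diff_card_le_card_Diff)
  ultimately have "s - 2 * t \<le> card (A i - Y)" using A(1)[OF i] Y(3) by simp
  then obtain R where R: "R \<subseteq> A i - Y" "card R = s - 2 * t" "finite R"
    by (rule obtain_subset_with_card_n)
  have "\<exists>S\<subseteq>{a\<in>A j. \<forall>y\<in>Y. E y a}. card S = s" if j: "j < r" "j \<noteq> i" for j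
  proof -
    have "real (card (A j)) - card Y * b \<le> card {a\<in>A j. \<forall>y\<in>Y. E y a}"
      by (rule card_common_nbs[OF fA[OF j(1)] Y(2)]) (use X(2) j Y(1) in auto)
    then have "real s \<le> card {a\<in>A j. \<forall>y\<in>Y. E y a}" using M A(1)[OF j(1)] Y(3) by simp
    then show ?thesis by (meson obtain_subset_with_card_n of_nat_le_iff)
  qed
  then obtain S where S: "\<And>j. j < r \<Longrightarrow> j \<noteq> i \<Longrightarrow> S j \<subseteq> {a\<in>A j. \<forall>y\<in>Y. E y a} \<and> card (S j) = s"
    by metis
  define Q where "Q = (\<lambda>c. S (skip i c))"
  have Q: "Q c \<subseteq> A (skip i c)" "card (Q c) = s" "\<And>y v. y \<in> Y \<Longrightarrow> v \<in> Q c \<Longrightarrow> E y v"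
    and sk: "skip i c < r" "skip i c \<noteq> i" if "c < r - 1" for c
    using S[OF skip_props(1)[OF that i] skip_props(2)] skip_props(1)[OF that i] skip_props(2) by (auto simp: Q_def)
  have cR: "card (Y \<union> R) = s" using Y R st by (subst card_Un_disjoint) auto
  have "has_F s t (r - 1) V E"
    unfolding has_F_def
  proof (intro exI[of _ "Y \<union> R"] exI[of _ Q] conjI allI impI ballI)
    show "Y \<union> R \<subseteq> V" using Y(1) X(1) R(1) A(1)[OF i] by auto
    show "card (Y \<union> R) = s" by fact
    show "matching E (Y \<union> R) t" using Y(4) by (rule matching_mono) auto
    fix c assume c: "c < r - 1"
    show "Q c \<subseteq> V" using Q(1)[OF c] A(1)[OF sk(1)[OF c]] by auto
    show "card (Q c) = s" by (rule Q(2)[OF c])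
    fix u v assume uv: "u \<in> Y \<union> R" "v \<in> Q c"
    show "E u v"
    proof (cases "u \<in> Y")
      case True
      then show ?thesis using Q(3)[OF c] uv by auto
    next
      case False
      then have "u \<in> A i" using uv R(1) by auto
      then show ?thesis using complete_partsD[OF A(2) i sk(1)[OF c]] sk(2)[OF c] Q(1)[OF c] uv by auto
    qed
  next
    show "complete_parts E (r - 1) Q"
      unfolding complete_parts_def
    proof (intro allI impI ballI)
      fix c d u v assume cd: "c < r - 1" "d < r - 1" "c \<noteq> d" and uv: "u \<in> Q c" "v \<in> Q d"
      show "E u v"
        by (rule complete_partsD[OF A(2) sk(1)[OF cd(1)] sk(1)[OF cd(2)]])
          (use cd(3) skip_props(3) Q(1)[OF cd(1)] Q(1)[OF cd(2)] uv in auto)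
    qed
  qed
  then show False using nF by simp
qed

text \<open>
  Start from a complete \<open>r\<close>-partite subgraph with parts \<open>A i\<close> of a large constant order \<open>M\<close>. Only
  boundedly many vertices (the set \<open>D\<close>) have \<open>s\<close> neighbours in each part, since otherwise there would
  be \<open>r + 1\<close> complete parts of order \<open>s\<close>. Every other vertex has fewer than \<open>s\<close> neighbours in some
  \<open>A i\<close>; counting the edges to the union of the parts shows that, up to a set \<open>Bd\<close> of small proportion,
  these vertices miss only few vertices of the other parts. The vertices belonging in this sense to
  \<open>A i\<close> contain no matching of \<open>t\<close> edges, so a bounded set \<open>C i\<close> covers their edges, and the remaining
  set \<open>P i\<close> is independent. An independent set has at most \<open>(1/r + \<epsilon>) n\<close> vertices by the degree
  condition, which yields the lower bounds as well.
\<close>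

lemma independent_parts_of_min_degree:
  fixes \<gamma> :: real
  assumes \<gamma>: "\<gamma> > 0" and r: "r \<ge> 2" and t: "1 \<le> t" "2 * t \<le> s"
  shows "\<exists>\<epsilon>>0. \<exists>N. \<forall>V (E :: 'a \<Rightarrow> 'a \<Rightarrow> bool). sgraph V E \<longrightarrow> card V \<ge> N \<longrightarrow> \<not> has_F s t (r - 1) V E \<longrightarrow>
    (\<forall>v\<in>V. real (card (nbs V E v)) \<ge> (1 - 1 / r - \<epsilon>) * card V) \<longrightarrow>
    (\<exists>A. (\<forall>i<r. A i \<subseteq> V \<and> (1 / r - \<gamma>) * card V \<le> card (A i) \<and> card (A i) \<le> (1 / r + \<gamma>) * card V \<and>
          (\<forall>u\<in>A i. \<forall>v\<in>A i. \<not> E u v)) \<and>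
      (\<forall>i<r. \<forall>j<r. i \<noteq> j \<longrightarrow> A i \<inter> A j = {}) \<and> card (V - (\<Union>i<r. A i)) \<le> \<gamma> * card V)"
proof -
  define \<kappa> where "\<kappa> = 1 / (4 * real s)"
  have s0: "s \<ge> 2" using t by simp
  have \<kappa>: "\<kappa> > 0" "\<kappa> * (4 * s) = 1" "\<kappa> \<le> 1 / 4" using s0 by (auto simp: \<kappa>_def field_simps)
  obtain M :: nat where M: "real M \<ge> 16 * s * s / \<gamma> + 4 * (s * s + s)" using real_arch_simple by blast
  have Mpos: "real M > 0" "real M \<ge> 4 * (s * s + s)" "16 * s * s \<le> \<gamma> * M"
  proof -
    have p: "16 * s * s / \<gamma> \<ge> 0" using \<gamma> by simp
    have "s * s + s > 0" using s0 by simp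
    then have p2: "4 * real (s * s + s) > 0" by (simp del: of_nat_add of_nat_mult)
    then show "real M > 0" "real M \<ge> 4 * (s * s + s)" using M p p2 by linarith+
    have "16 * s * s / \<gamma> \<le> M" using M p2 by linarith
    then show "16 * s * s \<le> \<gamma> * M" using \<gamma> by (simp add: pos_divide_le_eq mult.commute)
  qed
  \<comment> \<open>Half the gap between the Turan densities for \<open>r\<close> and \<open>r - 1\<close> parts: the degree condition then
    exceeds the threshold for \<open>r\<close> complete parts.\<close>
  define \<eta> where "\<eta> = (1 / (real r - 1) - 1 / r) / 2"
  have \<eta>: "\<eta> > 0" using r by (simp add: \<eta>_def field_simps)
  define \<epsilon> where "\<epsilon> = min \<eta> (\<gamma> / (16 * s * r))"
  have \<epsilon>: "\<epsilon> > 0" "\<epsilon> \<le> \<eta>" "\<epsilon> * (16 * s * r) \<le> \<gamma>"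
  proof -
    have sr: "real (16 * s * r) > 0" using s0 r by simp
    show "\<epsilon> > 0" using \<eta> \<gamma> sr by (simp add: \<epsilon>_def)
    show "\<epsilon> \<le> \<eta>" by (simp add: \<epsilon>_def)
    have "\<epsilon> \<le> \<gamma> / (16 * s * r)" by (simp add: \<epsilon>_def)
    then show "\<epsilon> * (16 * s * r) \<le> \<gamma>" using sr by (simp only: pos_le_divide_eq of_nat_mult of_nat_numeral)
  qed
  define dm where "dm = s * 2 ^ (r * M)"
  obtain N0 where N0: "\<And>V (E :: 'a \<Rightarrow> 'a \<Rightarrow> bool). sgraph V E \<Longrightarrow> card V \<ge> N0 \<Longrightarrow>
    (r - 1 > 0 \<longrightarrow> (\<forall>v\<in>V. real (card (nbs V E v)) \<ge> (1 - 1 / real (r - 1) + \<eta>) * card V)) \<Longrightarrow>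
    (\<exists>A. (\<forall>i<Suc (r - 1). A i \<subseteq> V \<and> card (A i) = M) \<and> complete_parts E (Suc (r - 1)) A)"
    using erdos_stone_min_degree[OF \<eta>, where 'a = 'a, of "r - 1" M] by blast
  obtain N1 :: nat where N1: "real N1 \<ge> (4 * s * dm + dm + 2 * r * t) * 4 / \<gamma>" using real_arch_simple by blast
  show ?thesis
  proof (intro exI[of _ \<epsilon>] exI[of _ "max N0 N1"] conjI allI impI)
    show "\<epsilon> > 0" by fact
  next
    fix V :: "'a set" and E assume G: "sgraph V E" and nV: "max N0 N1 \<le> card V" and nF: "\<not> has_F s t (r - 1) V E"
      and deg: "\<forall>v\<in>V. real (card (nbs V E v)) \<ge> (1 - 1 / r - \<epsilon>) * card V"
    have fin: "finite V" using G by (rule sgraphD)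
    define n where "n = real (card V)"
    have nN1: "(4 * s * dm + dm + 2 * r * t) * 4 \<le> \<gamma> * n"
    proof -
      have "real N1 \<le> n" using nV by (simp add: n_def)
      then have "(4 * s * dm + dm + 2 * r * t) * 4 / \<gamma> \<le> n" using N1 by linarith
      then show ?thesis using \<gamma> by (simp add: pos_divide_le_eq mult.commute)
    qed
    have n0: "n \<ge> 0" by (simp add: n_def)
    have "(1 - 1 / real (r - 1) + \<eta>) * n \<le> (1 - 1 / r - \<epsilon>) * n"
    proof (intro mult_right_mono)
      have "real (r - 1) = real r - 1" using r by simp
      then have "1 - 1 / real (r - 1) + \<eta> = 1 - 1 / r - \<eta>" by (simp add: \<eta>_def field_simps)
      then show "1 - 1 / real (r - 1) + \<eta> \<le> 1 - 1 / r - \<epsilon>" unfolding \<open>1 - 1 / real (r - 1) + \<eta> = _\<close> using \<epsilon>(2) by simp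
    qed (use n0 in auto)
    then have "\<forall>v\<in>V. real (card (nbs V E v)) \<ge> (1 - 1 / real (r - 1) + \<eta>) * card V"
      using deg unfolding n_def by fastforce
    then have "\<exists>A. (\<forall>i<Suc (r - 1). A i \<subseteq> V \<and> card (A i) = M) \<and> complete_parts E (Suc (r - 1)) A"
      by (intro N0[OF G]) (use nV in auto)
    moreover have "Suc (r - 1) = r" using r by simp
    ultimately obtain A where A: "\<And>i. i < r \<Longrightarrow> A i \<subseteq> V \<and> card (A i) = M" "complete_parts E r A" by auto
    have fA: "finite (A i)" if "i < r" for i using A(1)[OF that] fin by (auto intro: finite_subset)
    define AA where "AA = (\<Union>i<r. A i)"
    have cAA: "card AA = r * M" unfolding AA_def by (rule complete_parts_card_UN[OF G A])
    have AAV: "AA \<subseteq> V" using A by (auto simp: AA_def)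
    have fAA: "finite AA" using AAV fin by (rule finite_subset)
    define D where "D = {v\<in>V. \<forall>i<r. s \<le> card (nbs (A i) E v)}"
    have DV: "D \<subseteq> V" by (auto simp: D_def)
    have cD: "card D < dm"
    proof (rule ccontr)
      assume "\<not> card D < dm"
      then have "s * 2 ^ card AA \<le> card D" unfolding cAA dm_def by simp
      then obtain B where "\<forall>i<Suc r. B i \<subseteq> V \<and> card (B i) = s" "complete_parts E (Suc r) B"
        using extend_complete_parts[OF G _ A(2) DV, of s] A(1) unfolding D_def AA_def by auto
      then have "has_F s t (r - 1) V E"
        using r t by (intro has_F_of_complete_parts[OF G, of _ B]) auto
      then show False using nF by simp
    qed
    \<comment> \<open>With \<open>\<kappa> = 1 / (4 s)\<close>, the \<open>2 t \<le> s\<close> vertices of a matching together miss at most about a quarter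
      of each part.\<close>
    define b where "b = \<kappa> * M + s"
    define good where "good = (\<lambda>i v. card (nbs (A i) E v) < s \<and> (\<forall>j<r. j \<noteq> i \<longrightarrow> real (card (A j - nbs (A j) E v)) \<le> b))"
    define X where "X = (\<lambda>i. {v\<in>V. good i v})"
    define Bd where "Bd = V - D - (\<Union>i<r. X i)"
    have BdV: "Bd \<subseteq> V" "Bd \<inter> D = {}" by (auto simp: Bd_def)
    have le: "real (card (nbs AA E v)) \<le> (real r - 1) * M + s + (if v \<in> D then real M else 0) - (if v \<in> Bd then \<kappa> * M + s else 0)"
      if vV: "v \<in> V" for v
    proof (cases "v \<in> D")
      case True
      have "real (card (nbs AA E v)) \<le> r * M" using card_nbs_le[OF fAA, of E v] cAA by (metis of_nat_le_iff)
      then show ?thesis using True BdV(2) by (auto simp: algebra_simps)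
    next
      case False
      then obtain i where i: "i < r" "card (nbs (A i) E v) < s" using vV by (auto simp: D_def)
      have "card (nbs AA E v) \<le> (r - 1) * M + card (nbs (A i) E v)"
        unfolding AA_def by (rule card_nbs_UN_le_except[OF i(1)]) (use A fA in auto)
      then have "card (nbs AA E v) \<le> (r - 1) * M + s" using i(2) by linarith
      then have 1: "real (card (nbs AA E v)) \<le> (real r - 1) * M + s"
        using r by (metis (mono_tags, opaque_lifting) Suc_1 Suc_leD of_nat_1 of_nat_add of_nat_diff of_nat_le_iff of_nat_mult numeral_One One_nat_def)
      show ?thesis
      proof (cases "v \<in> Bd")
        case True
        then have "\<not> good i v" using i vV by (auto simp: Bd_def X_def)
        then obtain j where j: "j < r" "j \<noteq> i" "\<not> real (card (A j - nbs (A j) E v)) \<le> b" using i by (auto simp: good_def)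
        have j2: "real (card (nbs (A j) E v)) \<le> M - b" using j A(1)[OF j(1)] card_diff_nbs[OF fA[OF j(1)], of E v] by simp
        have "(\<Sum>k<r. real (card (nbs (A k) E v))) = real (card (nbs (A i) E v)) + (\<Sum>k\<in>{..<r} - {i}. real (card (nbs (A k) E v)))"
          using i(1) by (intro sum.remove) auto
        also have "(\<Sum>k\<in>{..<r} - {i}. real (card (nbs (A k) E v))) = real (card (nbs (A j) E v)) + (\<Sum>k\<in>{..<r} - {i} - {j}. real (card (nbs (A k) E v)))"
          using j by (intro sum.remove) auto
        also have "(\<Sum>k\<in>{..<r} - {i} - {j}. real (card (nbs (A k) E v))) \<le> (\<Sum>k\<in>{..<r} - {i} - {j}. real M)"
        proof (intro sum_mono)
          fix k assume "k \<in> {..<r} - {i} - {j}"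
          then have "k < r" by auto
          then show "real (card (nbs (A k) E v)) \<le> real M" using card_nbs_le[OF fA, of k E v] A(1) by simp
        qed
        also have "\<dots> = (real r - 2) * M"
        proof -
          have "card ({..<r} - {i} - {j}) = r - 2" using i(1) j by (simp add: card_Diff_subset)
          then show ?thesis using r by (simp add: of_nat_diff)
        qed
        finally have "(\<Sum>k<r. real (card (nbs (A k) E v))) \<le> s + (M - b) + (real r - 2) * M" using i(2) j2 by linarith
        moreover have "real (card (nbs AA E v)) \<le> (\<Sum>k<r. real (card (nbs (A k) E v)))"
          unfolding AA_def using card_nbs_UN_le[of A r E v] by (simp flip: of_nat_sum)
        ultimately show ?thesis using True False by (simp add: b_def algebra_simps)
      qed (use False 1 in auto)
    qed
    have "real (r * M) * ((1 - 1 / r - \<epsilon>) * n) = (\<Sum>a\<in>AA. (1 - 1 / r - \<epsilon>) * n)" using cAA by simp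
    also have "\<dots> \<le> (\<Sum>a\<in>AA. real (card (nbs V E a)))" using deg AAV by (intro sum_mono) (auto simp: n_def)
    also have "\<dots> = (\<Sum>v\<in>V. real (card (nbs AA E v)))"
      using double_count_nbs[OF fin fAA sgraphD(2)[OF G]] by (simp flip: of_nat_sum)
    also have "\<dots> \<le> (\<Sum>v\<in>V. (real r - 1) * M + s + (if v \<in> D then real M else 0) - (if v \<in> Bd then \<kappa> * M + s else 0))"
      by (intro sum_mono le)
    also have "\<dots> = n * ((real r - 1) * M + s) + card D * M - card Bd * (\<kappa> * M + s)"
      using fin DV BdV by (simp add: sum.distrib sum_subtractf n_def sum.If_cases Int_absorb1)
    finally have "r * M * ((1 - 1 / r - \<epsilon>) * n) \<le> n * ((real r - 1) * M + s) + card D * M - card Bd * (\<kappa> * M + s)" by simp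
    moreover have "r * M * ((1 - 1 / r - \<epsilon>) * n) = (real r - 1) * M * n - r * M * \<epsilon> * n" using r by (simp add: field_simps)
    moreover have "card Bd * (\<kappa> * M + s) \<ge> card Bd * (\<kappa> * M)" by (intro mult_left_mono) auto
    ultimately have "(real r - 1) * M * n - r * M * \<epsilon> * n \<le> n * ((real r - 1) * M + s) + card D * M - card Bd * (\<kappa> * M)" by linarith
    then have "card Bd * (\<kappa> * M) \<le> r * M * \<epsilon> * n + n * s + card D * M" by (simp add: algebra_simps)
    then have "(card Bd * (\<kappa> * M)) * (4 * s) \<le> (r * M * \<epsilon> * n + n * s + card D * M) * (4 * s)" by (intro mult_right_mono) auto
    moreover have "(card Bd * (\<kappa> * M)) * (4 * s) = card Bd * M" using \<kappa>(2) by (simp add: mult.assoc mult.left_commute)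
    moreover have "(r * M * \<epsilon> * n) * (4 * s) \<le> \<gamma> / 4 * (n * M)"
    proof -
      have "(r * M * \<epsilon> * n) * (4 * s) = (\<epsilon> * (16 * s * r)) / 4 * (n * M)" by simp
      also have "\<dots> \<le> \<gamma> / 4 * (n * M)" using \<epsilon>(3) n0 by (intro mult_right_mono divide_right_mono) auto
      finally show ?thesis .
    qed
    moreover have "(n * s) * (4 * s) \<le> \<gamma> / 4 * (n * M)"
    proof -
      have "(n * s) * (4 * s) = n * (16 * s * s) / 4" by simp
      also have "\<dots> \<le> n * (\<gamma> * M) / 4" using Mpos(3) n0 by (intro divide_right_mono mult_left_mono) auto
      finally show ?thesis by (simp add: mult_ac)
    qed
    moreover have "real (card D * M) * real (4 * s) \<le> real ((4 * s * dm) * M)"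
    proof -
      have "real (card D) * (M * (4 * s)) \<le> real dm * (M * (4 * s))" using cD by (intro mult_right_mono) auto
      then show ?thesis by (simp add: mult_ac)
    qed
    ultimately have "card Bd * M \<le> \<gamma> / 4 * (n * M) + \<gamma> / 4 * (n * M) + (4 * s * dm) * M"
      unfolding distrib_right by linarith
    also have "\<dots> = (\<gamma> / 2 * n + 4 * s * dm) * M" by (simp add: algebra_simps)
    finally have "real (card Bd) * real M \<le> (\<gamma> / 2 * n + 4 * s * dm) * real M" by simp
    then have cBd: "card Bd \<le> \<gamma> / 2 * n + 4 * s * dm" using Mpos(1) by (simp only: mult_le_cancel_right_pos)
    have M34: "2 * t * b + s \<le> M" "0 \<le> b" "b + s \<le> real M - 1"
    proof -
      have ks: "real s * \<kappa> = 1 / 4" using s0 by (simp add: \<kappa>_def)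
      have "real s * b = (real s * \<kappa>) * M + real s * s" by (simp add: b_def algebra_simps)
      then have 1: "real s * b = M / 4 + real s * s" by (simp add: ks)
      have "real (2 * t) * b \<le> real s * b" using t \<kappa>(1) by (intro mult_right_mono) (auto simp: b_def simp flip: of_nat_mult)
      then show "2 * t * b + s \<le> M" using 1 Mpos(2) by simp
      show "0 \<le> b" using \<kappa> by (simp add: b_def)
      have "\<kappa> * M \<le> 1/4 * M" using \<kappa>(3) by (intro mult_right_mono) auto
      moreover have "12 * real s \<le> M"
      proof -
        have "2 * s \<le> s * s" using s0 by (intro mult_right_mono) auto
        then have "4 * (2 * s + s) \<le> 4 * (s * s + s)" by (intro mult_left_mono add_right_mono) auto
        then have "12 * s \<le> 4 * (s * s + s)" by simp
        then have "12 * real s \<le> 4 * real (s * s + s)" by (metis of_nat_le_iff of_nat_mult of_nat_numeral)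
        then show ?thesis using Mpos(2) by simp
      qed
      moreover have "real s \<ge> 2" using s0 by simp
      ultimately show "b + s \<le> real M - 1" unfolding b_def by linarith
    qed
    have "\<exists>C\<subseteq>X i. card C \<le> 2 * (t - 1) \<and> (\<forall>u\<in>X i - C. \<forall>v\<in>X i - C. \<not> E u v)" if i: "i < r" for i
    proof (rule vertex_cover_of_no_matching)
      show "sgraph (X i) E" using G by (rule sgraph_mono) (auto simp: X_def)
      have "\<not> matching E (X i) t"
        by (rule few_neighbours_no_matching[OF G nF t(2) A i, of _ b]) (use M34 in \<open>auto simp: X_def good_def\<close>)
      then show "\<not> matching E (X i) (Suc (t - 1))" using t by simp
    qed
    then obtain C where C: "\<And>i. i < r \<Longrightarrow> C i \<subseteq> X i" "\<And>i. i < r \<Longrightarrow> card (C i) \<le> 2 * (t - 1)"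
      "\<And>i u v. i < r \<Longrightarrow> u \<in> X i - C i \<Longrightarrow> v \<in> X i - C i \<Longrightarrow> \<not> E u v" by metis
    define P where "P = (\<lambda>i. X i - C i)"
    have PV: "P i \<subseteq> V" for i by (auto simp: P_def X_def)
    have fP: "finite (P i)" for i using PV fin by (rule finite_subset)
    have PP: "P i \<inter> P j = {}" if ij: "i < r" "j < r" "i \<noteq> j" for i j
    proof -
      have False if v: "v \<in> P i" "v \<in> P j" for v
      proof -
        have "card (nbs (A i) E v) < s" "real (card (A i - nbs (A i) E v)) \<le> b"
          using v ij by (auto simp: P_def X_def good_def)
        then have "real M \<le> s + b" using card_diff_nbs[OF fA[OF ij(1)], of E v] A(1)[OF ij(1)] by simp
        then show False using M34 by linarith
      qed
      then show ?thesis by auto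
    qed
    have up: "card (P i) \<le> (1 / r + \<epsilon>) * n" if i: "i < r" for i
    proof (cases "P i = {}")
      case True
      then show ?thesis using n0 \<epsilon>(1) by simp
    next
      case False
      then obtain v where v: "v \<in> P i" by auto
      have "P i \<subseteq> V - nbs V E v" using v C(3)[OF i] PV by (auto simp: P_def nbs_def)
      then have "card (P i) \<le> card (V - nbs V E v)" using fin by (intro card_mono) auto
      then have "real (card (P i)) \<le> n - card (nbs V E v)" using card_diff_nbs[OF fin, of E v] by (simp add: n_def)
      also have "\<dots> \<le> n - (1 - 1 / r - \<epsilon>) * n" using deg v PV by (auto simp: n_def)
      finally show ?thesis by (simp add: algebra_simps)
    qed
    have rest: "card (V - (\<Union>i<r. P i)) \<le> 3/4 * \<gamma> * n"
    proof -
      have "V - (\<Union>i<r. P i) \<subseteq> Bd \<union> D \<union> (\<Union>i<r. C i)" by (auto simp: Bd_def P_def)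
      moreover have fC: "finite (C i)" if "i < r" for i
      proof -
        have "C i \<subseteq> V" using C(1)[OF that] by (auto simp: X_def)
        then show ?thesis using fin by (rule finite_subset)
      qed
      moreover have "finite Bd" "finite D" using BdV DV fin by (auto intro: finite_subset)
      ultimately have "card (V - (\<Union>i<r. P i)) \<le> card (Bd \<union> D \<union> (\<Union>i<r. C i))" by (intro card_mono) auto
      also have "\<dots> \<le> card Bd + card D + card (\<Union>i<r. C i)"
        by (intro order_trans[OF card_Un_le] add_right_mono card_Un_le)
      also have "card (\<Union>i<r. C i) \<le> (\<Sum>i<r. card (C i))" by (rule card_UN_le) simp
      also have "(\<Sum>i<r. card (C i)) \<le> (\<Sum>i<r. 2 * t)" using C(2) by (intro sum_mono) fastforce
      finally have "card (V - (\<Union>i<r. P i)) \<le> card Bd + dm + 2 * r * t" using cD by simp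
      then have "real (card (V - (\<Union>i<r. P i))) \<le> card Bd + dm + 2 * r * t" by linarith
      also have "\<dots> \<le> \<gamma> / 2 * n + (4 * s * dm + dm + 2 * r * t)" using cBd by simp
      also have "\<dots> \<le> 3/4 * \<gamma> * n" using nN1 by simp
      finally show ?thesis .
    qed
    have \<epsilon>g: "r * \<epsilon> \<le> \<gamma> / 4" "\<epsilon> \<le> \<gamma>"
    proof -
      have "4 * r * 1 \<le> 4 * r * (4 * s)" using s0 by (intro mult_left_mono) auto
      then have "real (4 * r) \<le> real (16 * s * r)" by (intro of_nat_mono) (simp add: mult_ac)
      then have "\<epsilon> * (4 * r) \<le> \<epsilon> * (16 * s * r)" using \<epsilon>(1) by (intro mult_left_mono) auto
      then show "r * \<epsilon> \<le> \<gamma> / 4" using \<epsilon>(3) by (simp add: mult.commute)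
      have "1 * \<epsilon> \<le> r * \<epsilon>" using \<epsilon>(1) r by (intro mult_right_mono) auto
      then show "\<epsilon> \<le> \<gamma>" using \<open>r * \<epsilon> \<le> \<gamma> / 4\<close> \<gamma> by linarith
    qed
    have low: "(1 / r - \<gamma>) * n \<le> card (P i)" if i: "i < r" for i
    proof -
      have UV: "(\<Union>j<r. P j) \<subseteq> V" using PV by auto
      have "card (\<Union>j<r. P j) = (\<Sum>j<r. card (P j))" using fP PP by (intro card_UN_disjoint) auto
      moreover have "card (V - (\<Union>j<r. P j)) = card V - card (\<Union>j<r. P j)"
        using fP by (intro card_Diff_subset UV) auto
      moreover have "card (\<Union>j<r. P j) \<le> card V" using fin UV by (rule card_mono)
      ultimately have "card V = card (V - (\<Union>j<r. P j)) + (\<Sum>j<r. card (P j))" by linarith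
      then have "n = card (V - (\<Union>j<r. P j)) + (\<Sum>j<r. real (card (P j)))"
        by (simp add: n_def flip: of_nat_sum)
      also have "(\<Sum>j<r. real (card (P j))) = card (P i) + (\<Sum>j\<in>{..<r} - {i}. real (card (P j)))"
        using i by (intro sum.remove) auto
      also have "(\<Sum>j\<in>{..<r} - {i}. real (card (P j))) \<le> (\<Sum>j\<in>{..<r} - {i}. (1 / r + \<epsilon>) * n)"
        by (intro sum_mono up) auto
      also have "\<dots> = (real r - 1) * ((1 / r + \<epsilon>) * n)" using i r by (simp add: of_nat_diff)
      also have "\<dots> = n - n / r + (r * \<epsilon> - \<epsilon>) * n" using r by (simp add: field_simps)
      also have "\<dots> \<le> n - n / r + \<gamma> / 4 * n" using \<epsilon>g \<epsilon>(1) n0 by (intro add_left_mono mult_right_mono) auto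
      finally show ?thesis using rest by (simp add: algebra_simps)
    qed
    show "\<exists>A. (\<forall>i<r. A i \<subseteq> V \<and> (1 / r - \<gamma>) * card V \<le> card (A i) \<and> card (A i) \<le> (1 / r + \<gamma>) * card V \<and>
          (\<forall>u\<in>A i. \<forall>v\<in>A i. \<not> E u v)) \<and>
      (\<forall>i<r. \<forall>j<r. i \<noteq> j \<longrightarrow> A i \<inter> A j = {}) \<and> card (V - (\<Union>i<r. A i)) \<le> \<gamma> * card V"
    proof (intro exI[of _ P] conjI allI impI ballI)
      fix i assume i: "i < r"
      show "P i \<subseteq> V" by fact
      show "(1 / r - \<gamma>) * card V \<le> card (P i)" using low[OF i] by (simp add: n_def)
      have "(1 / r + \<epsilon>) * n \<le> (1 / r + \<gamma>) * n" using \<epsilon>g n0 by (intro mult_right_mono) auto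
      then show "card (P i) \<le> (1 / r + \<gamma>) * card V" using up[OF i] by (simp add: n_def)
      show "\<not> E u v" if "u \<in> P i" "v \<in> P i" for u v using C(3)[OF i] that by (auto simp: P_def)
      show "P i \<inter> P j = {}" if "j < r" "i \<noteq> j" for j using PP[OF i] that by auto
    next
      have "\<gamma> * n \<ge> 0" using \<gamma> n0 by simp
      then show "card (V - (\<Union>i<r. P i)) \<le> \<gamma> * card V" using rest by (simp add: n_def)
    qed
  qed
qed

section \<open>Embeddings into nearly partite graphs\<close>

text \<open>
  The structure obtained from \<open>independent_parts_of_min_degree\<close>, together with the degree condition.
  The error \<open>\<gamma>\<close> is far smaller than \<open>1/r\<close>, so that \<open>r s\<close> exceptional sets of proportion \<open>\<gamma>\<close> can be
  discarded from a part.
\<close>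

locale near_partite =
  fixes V :: "'a set" and E :: "'a \<Rightarrow> 'a \<Rightarrow> bool" and s t r :: nat and \<gamma> :: real and A :: "nat \<Rightarrow> 'a set"
  assumes G: "sgraph V E" and nF: "\<not> has_F s t (r - 1) V E"
    and r: "r \<ge> 3" and t: "t \<ge> 1" and st: "2 * t \<le> s"
    and AV: "i < r \<Longrightarrow> A i \<subseteq> V"
    and Adisj: "i < r \<Longrightarrow> j < r \<Longrightarrow> i \<noteq> j \<Longrightarrow> A i \<inter> A j = {}"
    and Aind: "i < r \<Longrightarrow> u \<in> A i \<Longrightarrow> v \<in> A i \<Longrightarrow> \<not> E u v"
    and Alow: "i < r \<Longrightarrow> (1 / r - \<gamma>) * card V \<le> card (A i)"
    and Aup: "i < r \<Longrightarrow> card (A i) \<le> (1 / r + \<gamma>) * card V"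
    and rest: "card (V - (\<Union>i<r. A i)) \<le> \<gamma> * card V"
    and deg: "v \<in> V \<Longrightarrow> real (card (nbs V E v)) \<ge> (1 - 1 / r - \<gamma>) * card V"
    and \<gamma>: "\<gamma> > 0" "100 * r * r * s * \<gamma> \<le> 1"
    and sn: "s \<le> \<gamma> * card V"
begin

abbreviation n :: real where "n \<equiv> real (card V)"

lemma fin: "finite V" using G by (rule sgraphD)

lemma finA: "i < r \<Longrightarrow> finite (A i)" using AV fin by (meson finite_subset)

lemma s2: "s \<ge> 2" using t st by simp

lemma n0: "n > 0"
proof -
  have "0 < \<gamma> * n" using sn s2 by linarith
  then show ?thesis using \<gamma>(1) by (simp add: zero_less_mult_iff)
qed

lemma gamma_mult_le_1: "c \<le> 100 * r * r * s \<Longrightarrow> c * \<gamma> \<le> 1"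
  using \<gamma> by (smt (verit) mult_right_mono of_nat_le_iff)

text \<open>
  A vertex has at most \<open>(1/r + \<gamma>) n\<close> non-neighbours. If it has few neighbours in \<open>A i\<close>, then nearly all
  of these lie in \<open>A i\<close>, and few are left for \<open>A j\<close>.
\<close>

lemma miss:
  assumes v: "v \<in> V" and ij: "i < r" "j < r" "i \<noteq> j"
  shows "real (card (A j - nbs (A j) E v)) \<le> 2 * \<gamma> * n + card (nbs (A i) E v)"
proof -
  have "(A i - nbs (A i) E v) \<union> (A j - nbs (A j) E v) \<subseteq> V - nbs V E v"
    using AV[OF ij(1)] AV[OF ij(2)] by (auto simp: nbs_def)
  then have "card ((A i - nbs (A i) E v) \<union> (A j - nbs (A j) E v)) \<le> card (V - nbs V E v)"
    using fin by (intro card_mono) auto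
  moreover have "card ((A i - nbs (A i) E v) \<union> (A j - nbs (A j) E v)) = card (A i - nbs (A i) E v) + card (A j - nbs (A j) E v)"
    using finA ij Adisj[OF ij] by (intro card_Un_disjoint) auto
  ultimately have "real (card (A i - nbs (A i) E v)) + card (A j - nbs (A j) E v) \<le> n - card (nbs V E v)"
    using card_diff_nbs[OF fin, of E v] by linarith
  also have "\<dots> \<le> (1 / r + \<gamma>) * n" using deg[OF v] by (simp add: algebra_simps)
  finally have "real (card (A j - nbs (A j) E v)) \<le> (1 / r + \<gamma>) * n - (card (A i) - real (card (nbs (A i) E v)))"
    using card_diff_nbs[OF finA[OF ij(1)], of E v] by linarith
  also have "\<dots> \<le> 2 * \<gamma> * n + card (nbs (A i) E v)" using Alow[OF ij(1)] by (simp add: algebra_simps)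
  finally show ?thesis .
qed

lemma miss_own:
  assumes v: "v \<in> A i" and ij: "i < r" "j < r" "i \<noteq> j"
  shows "real (card (A j - nbs (A j) E v)) \<le> 2 * \<gamma> * n"
proof -
  have "nbs (A i) E v = {}" using Aind[OF ij(1) v] by (auto simp: nbs_def)
  then show ?thesis using miss[OF _ ij, of v] AV[OF ij(1)] v by auto
qed

lemma A_large: assumes "i < r" shows "2 * s \<le> card (A i)"
proof -
  have "0 < r * s" using r s2 by simp
  then have "3 * r * 1 \<le> 100 * r * (r * s)" by (intro mult_le_mono) auto
  then have "3 * r \<le> 100 * r * r * s" by (simp add: mult.assoc)
  from gamma_mult_le_1[OF this] have "r * (3 * \<gamma>) \<le> 1" by (simp add: mult_ac)
  then have "3 * \<gamma> \<le> 1 / r" using r by (simp add: field_simps)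
  then have "2 * \<gamma> * n \<le> (1 / r - \<gamma>) * n" using n0 by (intro mult_right_mono) auto
  then have "2 * real s \<le> card (A i)" using Alow[OF assms] sn by linarith
  then show ?thesis by linarith
qed

text \<open>
  Let \<open>Z\<close> carry a matching of \<open>t\<close> edges and have a substantial set \<open>C j\<close> of common neighbours in every
  part but \<open>A i\<close>. Fill \<open>Z\<close> up to order \<open>s\<close> by vertices of \<open>A i\<close> and choose \<open>s\<close> vertices in one \<open>C j\<close>
  after the other: each vertex chosen so far lies in a different part and misses at most \<open>2 \<gamma> n\<close>
  vertices of \<open>C j\<close>, so enough common neighbours remain. This gives a copy of the forbidden graph.
\<close>

lemma no_embedding:
  assumes i: "i < r" and Z: "Z \<subseteq> V" "finite Z" "card Z \<le> s" "matching E Z t"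
    and C: "\<And>j. j < r \<Longrightarrow> j \<noteq> i \<Longrightarrow> C j \<subseteq> A j \<and> (\<forall>z\<in>Z. \<forall>u\<in>C j. E z u) \<and> (2 * r * s + 1) * \<gamma> * n \<le> card (C j)"
  shows False
proof -
  have "card (A i) - card Z \<le> card (A i - Z)" using Z(2) by (rule diff_card_le_card_Diff)
  then have "s - card Z \<le> card (A i - Z)" using A_large[OF i] by linarith
  then obtain R where R: "R \<subseteq> A i - Z" "card R = s - card Z" "finite R"
    by (rule obtain_subset_with_card_n)
  have "\<exists>Q. (\<forall>c<k. Q c \<subseteq> C (skip i c) \<and> card (Q c) = s \<and> (\<forall>u\<in>R. \<forall>v\<in>Q c. E u v)) \<and> complete_parts E k Q"
    if "k \<le> r - 1" for k
    using that
  proof (induction k)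
    case 0
    then show ?case by (auto simp: complete_parts_def)
  next
    case (Suc k)
    then obtain Q where Q: "\<And>c. c < k \<Longrightarrow> Q c \<subseteq> C (skip i c) \<and> card (Q c) = s \<and> (\<forall>u\<in>R. \<forall>v\<in>Q c. E u v)"
      "complete_parts E k Q" by auto
    define j where "j = skip i k"
    have j: "j < r" "j \<noteq> i" using skip_props(1)[of k r i] skip_props(2)[of i k] Suc.prems i by (auto simp: j_def)
    \<comment> \<open>All vertices chosen so far outside \<open>Z\<close>; none of them lies in \<open>A j\<close>.\<close>
    define Y where "Y = R \<union> (\<Union>c<k. Q c)"
    have fQ: "finite (Q c)" if "c < k" for c using Q(1)[OF that] s2 by (intro card_ge_0_finite) auto
    then have fY: "finite Y" using R(3) by (auto simp: Y_def)
    have cY: "card Y \<le> r * s"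
    proof -
      have "card Y \<le> card R + card (\<Union>c<k. Q c)" unfolding Y_def by (rule card_Un_le)
      also have "card (\<Union>c<k. Q c) \<le> (\<Sum>c<k. card (Q c))" by (rule card_UN_le) simp
      also have "(\<Sum>c<k. card (Q c)) = (\<Sum>c<k. s)" using Q(1) by (intro sum.cong) auto
      also have "\<dots> = k * s" by simp
      also have "card R + k * s \<le> (k + 1) * s" using R(2) by simp
      also have "\<dots> \<le> r * s" using Suc.prems r by (intro mult_right_mono) auto
      finally show ?thesis by simp
    qed
    have Cj: "C j \<subseteq> A j" "(2 * r * s + 1) * \<gamma> * n \<le> card (C j)" using C[OF j] by auto
    have fC: "finite (C j)" using Cj(1) finA[OF j(1)] by (rule finite_subset)
    have mY: "real (card (C j - nbs (C j) E y)) \<le> 2 * \<gamma> * n" if "y \<in> Y" for y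
    proof -
      have "\<exists>i'<r. i' \<noteq> j \<and> y \<in> A i'"
      proof (cases "y \<in> R")
        case True
        then show ?thesis using R(1) i j by auto
      next
        case False
        then obtain c where c: "c < k" "y \<in> Q c" using \<open>y \<in> Y\<close> by (auto simp: Y_def)
        have "skip i c < r" "skip i c \<noteq> i" "skip i c \<noteq> j"
          using skip_props(1)[of c r i] skip_props(2)[of i c] skip_props(3)[of i c k] Suc.prems i c by (auto simp: j_def)
        moreover have "y \<in> A (skip i c)" using c Q(1)[OF c(1)] C[OF \<open>skip i c < r\<close> \<open>skip i c \<noteq> i\<close>] by auto
        ultimately show ?thesis by auto
      qed
      then obtain i' where i': "i' < r" "i' \<noteq> j" "y \<in> A i'" by auto
      have "C j - nbs (C j) E y \<subseteq> A j - nbs (A j) E y" using Cj(1) by (auto simp: nbs_def)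
      then have "card (C j - nbs (C j) E y) \<le> card (A j - nbs (A j) E y)" using finA[OF j(1)] by (intro card_mono) auto
      then show ?thesis using miss_own[OF i'(3,1) j(1) i'(2)] by linarith
    qed
    have "real (card (C j)) - card Y * (2 * \<gamma> * n) \<le> card {a\<in>C j. \<forall>y\<in>Y. E y a}"
      by (rule card_common_nbs[OF fC fY mY])
    moreover have "card Y * (2 * \<gamma> * n) \<le> (r * s) * (2 * \<gamma> * n)"
      using cY \<gamma>(1) n0 by (intro mult_right_mono) (auto simp flip: of_nat_mult)
    ultimately have "real s \<le> card {a\<in>C j. \<forall>y\<in>Y. E y a}" using Cj(2) sn by (simp add: algebra_simps)
    then have "s \<le> card {a\<in>C j. \<forall>y\<in>Y. E y a}" by simp
    then obtain S where S: "S \<subseteq> {a\<in>C j. \<forall>y\<in>Y. E y a}" "card S = s" by (rule obtain_subset_with_card_n)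
    define Q' where "Q' = Q(k := S)"
    have "Q' c \<subseteq> C (skip i c) \<and> card (Q' c) = s \<and> (\<forall>u\<in>R. \<forall>v\<in>Q' c. E u v)" if "c < Suc k" for c
    proof (cases "c = k")
      case True
      then show ?thesis using S by (auto simp: Q'_def j_def Y_def)
    next
      case False
      then show ?thesis using Q(1)[of c] that by (auto simp: Q'_def)
    qed
    moreover have "complete_parts E (Suc k) Q'"
      unfolding complete_parts_def
    proof (intro allI impI ballI)
      fix c d u v assume cd: "c < Suc k" "d < Suc k" "c \<noteq> d" and uv: "u \<in> Q' c" "v \<in> Q' d"
      consider "c < k" "d < k" | "c = k" "d < k" | "c < k" "d = k" using cd by linarith
      then show "E u v"
      proof cases
        case 1
        then show ?thesis using uv complete_partsD[OF Q(2) 1 cd(3)] by (auto simp: Q'_def)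
      next
        case 2
        then have "u \<in> S" "v \<in> Y" using uv by (auto simp: Q'_def Y_def)
        then have "E v u" using S(1) by auto
        then show ?thesis by (rule sgraphD(2)[OF G])
      next
        case 3
        then have "v \<in> S" "u \<in> Y" using uv by (auto simp: Q'_def Y_def)
        then show ?thesis using S(1) by auto
      qed
    qed
    ultimately show ?case by blast
  qed
  from this[of "r - 1"] obtain Q where Q: "\<And>c. c < r - 1 \<Longrightarrow> Q c \<subseteq> C (skip i c) \<and> card (Q c) = s \<and> (\<forall>u\<in>R. \<forall>v\<in>Q c. E u v)"
    "complete_parts E (r - 1) Q" by auto
  have Cs: "C (skip i c) \<subseteq> V" "\<forall>z\<in>Z. \<forall>u\<in>C (skip i c). E z u" if "c < r - 1" for c
    using C[OF skip_props(1)[OF that i] skip_props(2)] AV[OF skip_props(1)[OF that i]] by auto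
  have "has_F s t (r - 1) V E"
    unfolding has_F_def
  proof (intro exI[of _ "Z \<union> R"] exI[of _ Q] conjI allI impI ballI)
    show "Z \<union> R \<subseteq> V" using Z(1) R(1) AV[OF i] by auto
    show "card (Z \<union> R) = s" using Z(2,3) R by (subst card_Un_disjoint) auto
    show "matching E (Z \<union> R) t" using Z(4) by (rule matching_mono) auto
    show "complete_parts E (r - 1) Q" by fact
    fix c assume c: "c < r - 1"
    show "Q c \<subseteq> V" "card (Q c) = s" using Q(1)[OF c] Cs[OF c] by auto
    fix u v assume uv: "u \<in> Z \<union> R" "v \<in> Q c"
    then show "E u v" using Q(1)[OF c] Cs[OF c] by auto
  qed
  then show False using nF by simp
qed

end

text \<open>
  The vertices of \<open>S\<close> are matched greedily into \<open>B\<close>, avoiding \<open>X\<close> and the vertices already used.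
\<close>

lemma extend_matching:
  assumes "finite S" "finite B" "matching E Y k" "Y \<inter> S = {}" "finite X" "Y \<subseteq> X" "S \<subseteq> X"
    "\<And>w. w \<in> S \<Longrightarrow> m \<le> card (nbs B E w)" "card X + card S \<le> m"
  shows "\<exists>B'\<subseteq>B. finite B' \<and> card B' = card S \<and> B' \<inter> X = {} \<and> matching E (Y \<union> S \<union> B') (k + card S)"
  using assms(1) assms(2-)
proof (induction S rule: finite_induct)
  case empty
  then show ?case by (intro exI[of _ "{}"]) auto
next
  case (insert w S)
  then obtain B' where B': "B' \<subseteq> B" "finite B'" "card B' = card S" "B' \<inter> X = {}" "matching E (Y \<union> S \<union> B') (k + card S)"
    by auto
  have "card (X \<union> B') \<le> card X + card S" using B'(3) by (metis card_Un_le)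
  also have "\<dots> < card (nbs B E w)" using insert.prems(7)[of w] insert.prems(8) insert.hyps by simp
  finally have "\<not> nbs B E w \<subseteq> X \<union> B'" using insert.prems(4) B'(2) card_mono[of "X \<union> B'" "nbs B E w"] by auto
  then obtain b where b: "b \<in> B" "E w b" "b \<notin> X" "b \<notin> B'" by (auto simp: nbs_def)
  have w: "w \<in> X" "w \<notin> Y" using insert.prems(3,6) by auto
  have "matching E (insert w (insert b (Y \<union> S \<union> B'))) (Suc (k + card S))"
    by (rule matching_insert[OF B'(5)]) (use b w B'(4) insert.hyps insert.prems(5,6) in auto)
  moreover have "insert w (insert b (Y \<union> S \<union> B')) = Y \<union> insert w S \<union> insert b B'" by auto
  ultimately have "matching E (Y \<union> insert w S \<union> insert b B') (k + card (insert w S))" using insert.hyps by simp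
  then show ?case using B' b insert.hyps by (intro exI[of _ "insert b B'"]) auto
qed

context near_partite
begin

text \<open>
  The matching of \<open>no_embedding\<close> is built from two sources: each vertex of \<open>S\<close> is joined to a private
  vertex of \<open>A i\<close>, and \<open>Y\<close> supplies the remaining \<open>t - card S\<close> edges. This is the only way in which
  the absence of the forbidden graph enters the exchange argument.
\<close>

lemma no_dominating_embedding:
  assumes i: "i < r" and S: "S \<subseteq> V" "card S \<le> t" and Y: "Y \<subseteq> V" "Y \<inter> S = {}" "card Y = 2 * (t - card S)" "matching E Y (t - card S)"
    and nb: "\<And>w. w \<in> S \<Longrightarrow> 2 * s \<le> card (nbs (A i) E w)"
    and C: "\<And>j. j < r \<Longrightarrow> j \<noteq> i \<Longrightarrow> C j \<subseteq> A j \<and> (\<forall>z\<in>S \<union> Y. \<forall>u\<in>C j. E z u) \<and> 4 * r * s * \<gamma> * n \<le> card (C j)"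
  shows False
proof -
  have fS: "finite S" and fY: "finite Y" using S Y fin by (auto intro: finite_subset)
  have cSY: "card (S \<union> Y) + card S \<le> 2 * s"
    using card_Un_le[of S Y] S(2) Y(3) st by linarith
  obtain B where B: "B \<subseteq> A i" "finite B" "card B = card S" "B \<inter> (S \<union> Y) = {}" "matching E (Y \<union> S \<union> B) (t - card S + card S)"
    using extend_matching[OF fS finA[OF i] Y(4) Y(2), of "S \<union> Y" "2 * s"] nb fS fY cSY by auto
  define Z where "Z = Y \<union> S \<union> B"
  define D where "D = (\<lambda>j. {a\<in>C j. \<forall>y\<in>B. E y a})"
  show False
  proof (rule no_embedding[OF i, of Z D])
    show "Z \<subseteq> V" using S Y B AV[OF i] by (auto simp: Z_def)
    show "finite Z" using fS fY B by (auto simp: Z_def)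
    have "card Z \<le> card Y + card S + card B" unfolding Z_def by (intro order_trans[OF card_Un_le] add_right_mono card_Un_le)
    then show "card Z \<le> s" using B(3) S(2) Y(3) st by linarith
    show "matching E Z t" using B(5) S(2) by (simp add: Z_def)
    fix j assume j: "j < r" "j \<noteq> i"
    note Cj = C[OF j]
    have fC: "finite (C j)" using Cj finA[OF j(1)] by (auto intro: finite_subset)
    have mB: "real (card (C j - nbs (C j) E y)) \<le> 2 * \<gamma> * n" if "y \<in> B" for y
    proof -
      have "C j - nbs (C j) E y \<subseteq> A j - nbs (A j) E y" using Cj by (auto simp: nbs_def)
      then have "card (C j - nbs (C j) E y) \<le> card (A j - nbs (A j) E y)" using finA[OF j(1)] by (intro card_mono) auto
      then show ?thesis using miss_own[of y i j] that B(1) i j by fastforce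
    qed
    have "real (card (C j)) - card B * (2 * \<gamma> * n) \<le> card (D j)"
      unfolding D_def by (rule card_common_nbs[OF fC B(2) mB])
    moreover have "card B * (2 * \<gamma> * n) \<le> t * (2 * \<gamma> * n)"
      using S(2) B(3) \<gamma>(1) n0 by (intro mult_right_mono) auto
    ultimately have "4 * r * s * \<gamma> * n - 2 * t * \<gamma> * n \<le> card (D j)" using Cj by linarith
    moreover have "(2 * real r * s + 1) * (\<gamma> * n) \<le> (4 * real r * s - 2 * real t) * (\<gamma> * n)"
    proof (intro mult_right_mono)
      have "3 * s \<le> r * s" using r by (intro mult_right_mono) auto
      then have "2 * r * s + 1 + 2 * t \<le> 4 * r * s" using st s2 by linarith
      then have "real (2 * r * s + 1 + 2 * t) \<le> real (4 * r * s)" by (rule of_nat_mono)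
      then show "2 * real r * s + 1 \<le> 4 * real r * s - 2 * real t" by simp
    qed (use \<gamma> n0 in auto)
    ultimately have "(2 * r * s + 1) * \<gamma> * n \<le> card (D j)" by (simp add: algebra_simps)
    moreover have "E z u" if "z \<in> Z" "u \<in> D j" for z u
      using that Cj by (auto simp: Z_def D_def)
    ultimately show "D j \<subseteq> A j \<and> (\<forall>z\<in>Z. \<forall>u\<in>D j. E z u) \<and> (2 * r * s + 1) * \<gamma> * n \<le> card (D j)"
      using Cj by (auto simp: D_def)
  qed
qed

end

section \<open>Dominators\<close>

lemma sum_card_nbs_split:
  fixes b :: real
  assumes "finite P" and that: "finite W" "b \<ge> 0"
  shows "(\<Sum>p\<in>P. real (card (nbs W E p))) \<le> card {p\<in>P. b < card (nbs W E p)} * real (card W) + card P * b"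
proof -
  have "(\<Sum>p\<in>P. real (card (nbs W E p))) \<le> (\<Sum>p\<in>P. (if b < card (nbs W E p) then real (card W) else 0) + b)"
  proof (intro sum_mono)
    fix p
    have "real (card (nbs W E p)) \<le> card W" using card_nbs_le[OF that(1), of E p] by simp
    then show "real (card (nbs W E p)) \<le> (if b < card (nbs W E p) then real (card W) else 0) + b" using that(2) by auto
  qed
  also have "\<dots> = card {p\<in>P. b < card (nbs W E p)} * real (card W) + card P * b"
    using assms(1) by (simp add: sum.distrib sum.If_cases Int_def)
  finally show ?thesis .
qed

lemma sum_UN_le:
  fixes a :: "'b \<Rightarrow> real"
  assumes "finite I" "\<And>i. i \<in> I \<Longrightarrow> finite (B i)" "\<And>x. a x \<ge> 0"
  shows "(\<Sum>x\<in>(\<Union>i\<in>I. B i). a x) \<le> (\<Sum>i\<in>I. \<Sum>x\<in>B i. a x)"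
  using assms
proof (induction I rule: finite_induct)
  case (insert i I)
  define X where "X = (\<Union>i\<in>I. B i)"
  have fX: "finite X" "finite (B i)" using insert by (auto simp: X_def)
  have "(\<Sum>x\<in>B i \<union> X. a x) + (\<Sum>x\<in>B i \<inter> X. a x) = (\<Sum>x\<in>B i. a x) + (\<Sum>x\<in>X. a x)"
    using fX by (intro sum.union_inter) auto
  moreover have "(\<Sum>x\<in>B i \<inter> X. a x) \<ge> 0" using insert.prems by (intro sum_nonneg) auto
  moreover have "(\<Sum>x\<in>X. a x) \<le> (\<Sum>i\<in>I. \<Sum>x\<in>B i. a x)" using insert by (auto simp: X_def)
  ultimately show ?case using insert.hyps by (simp add: X_def)
qed simp

context near_partite
begin

definition dominators :: "real \<Rightarrow> 'a set" where
  "dominators \<beta> = {w\<in>V. \<forall>i<r. \<beta> * n \<le> card (nbs (A i) E w)}"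

text \<open>
  Suppose there are \<open>K\<close> dominators. Going through the parts one by one, a positive proportion of the
  vertices of \<open>A k\<close> is adjacent to at least the fraction \<open>\<beta> / 2\<close> of the surviving dominators; by the
  pigeonhole principle linearly many of them have the same neighbourhood there, and this neighbourhood
  is the set of dominators surviving the step. After \<open>r\<close> steps at least \<open>(\<beta> / 2) ^ r K \<ge> t\<close> dominators
  remain, with linearly many common neighbours in each part.
\<close>

lemma dominators_bounded:
  assumes \<beta>: "0 < \<beta>" and \<beta>s: "2 * s \<le> \<beta> * n" and K: "t \<le> (\<beta> / 2) ^ r * K"
    and c: "4 * r * s * \<gamma> \<le> \<beta> / 2 ^ (K + 2)"
  shows "card (dominators \<beta>) < K"
proof (rule ccontr)
  assume "\<not> card (dominators \<beta>) < K"
  then have "K \<le> card (dominators \<beta>)" by simp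
  then obtain W where W: "W \<subseteq> dominators \<beta>" "card W = K" "finite W" by (rule obtain_subset_with_card_n)
  define c where "c = \<beta> / 2 ^ (K + 2)"
  have cn1: "1 \<le> c * n"
  proof -
    have "0 < 4 * r * s * s" using r s2 by simp
    then have "1 \<le> 4 * r * s * s" by linarith
    then have "1 \<le> real (4 * r * s * s)" by (metis of_nat_1 of_nat_le_iff)
    also have "\<dots> = (4 * r * s) * real s" by simp
    also have "\<dots> \<le> (4 * r * s) * (\<gamma> * n)" using sn by (simp add: mult_left_mono)
    also have "\<dots> = (4 * r * s * \<gamma>) * n" by simp
    also have "\<dots> \<le> c * n" using c n0 unfolding c_def by (intro mult_right_mono) auto
    finally show ?thesis .
  qed
  have Kpos: "K > 0" using K t by (cases "K = 0") auto
  have step: "\<exists>W' C. W' \<subseteq> W \<and> (\<beta> / 2) ^ k * K \<le> card W' \<and>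
      (\<forall>j<k. C j \<subseteq> A j \<and> c * n \<le> card (C j) \<and> (\<forall>w\<in>W'. \<forall>u\<in>C j. E w u))" if "k \<le> r" for k
    using that
  proof (induction k)
    case 0
    then show ?case using W(2) by (intro exI[of _ W]) auto
  next
    case (Suc k)
    then obtain W' C where W': "W' \<subseteq> W" "(\<beta> / 2) ^ k * K \<le> card W'"
      and C: "\<And>j. j < k \<Longrightarrow> C j \<subseteq> A j \<and> c * n \<le> card (C j) \<and> (\<forall>w\<in>W'. \<forall>u\<in>C j. E w u)" by auto
    have k: "k < r" using Suc.prems by simp
    have fW': "finite W'" using W'(1) W(3) by (rule finite_subset)
    have "(\<beta> / 2) ^ k * K > 0" using \<beta> Kpos by simp
    then have W'pos: "real (card W') > 0" using W'(2) by linarith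
    define b where "b = \<beta> / 2 * card W'"
    define P where "P = {p\<in>A k. b < card (nbs W' E p)}"
    have fP: "finite P" using finA[OF k] by (simp add: P_def)
    have "card W' * (\<beta> * n) = (\<Sum>w\<in>W'. \<beta> * n)" by simp
    also have "\<dots> \<le> (\<Sum>w\<in>W'. real (card (nbs (A k) E w)))"
      using W'(1) W(1) k by (intro sum_mono) (auto simp: dominators_def)
    also have "\<dots> = (\<Sum>p\<in>A k. real (card (nbs W' E p)))"
      using double_count_nbs[OF fW' finA[OF k] sgraphD(2)[OF G]] by (simp flip: of_nat_sum)
    also have "\<dots> \<le> card P * real (card W') + card (A k) * b"
      unfolding P_def by (rule sum_card_nbs_split[OF finA[OF k] fW']) (use \<beta> in \<open>auto simp: b_def\<close>)
    also have "card (A k) * b \<le> n * b"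
      using card_mono[OF fin AV[OF k]] \<beta> by (intro mult_right_mono) (auto simp: b_def)
    finally have "card W' * (\<beta> * n / 2) \<le> card W' * real (card P)" by (simp add: b_def algebra_simps)
    then have cP: "\<beta> * n / 2 \<le> card P" using W'pos by simp
    \<comment> \<open>The factor \<open>2 ^ (K + 2)\<close> in \<open>c\<close> pays for the pigeonhole over at most \<open>2 ^ K\<close> neighbourhoods, the
      fraction \<open>\<beta> / 2\<close> and the rounding.\<close>
    define m where "m = nat \<lceil>c * n\<rceil>"
    have m: "c * n \<le> m" "m \<le> 2 * (c * n)" "m > 0" using cn1 unfolding m_def by linarith+
    have "m * 2 ^ card W' \<le> card P"
    proof -
      have "real (m * 2 ^ card W') \<le> 2 * (c * n) * 2 ^ K"
        using m(2) card_mono[OF W(3) W'(1)] W(2) by (simp add: mult_mono power_increasing)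
      also have "\<dots> = \<beta> * n / 2" by (simp add: c_def power_add)
      finally show ?thesis using cP by (metis of_nat_le_iff order_trans)
    qed
    then obtain I where I: "I \<subseteq> W'" "m \<le> card {v\<in>P. nbs W' E v = I}"
      using nbhd_pigeonhole[OF fP fW'] by blast
    define C' where "C' = C(k := {v\<in>P. nbs W' E v = I})"
    have "{v\<in>P. nbs W' E v = I} \<noteq> {}" using I(2) m(3) by (metis card.empty not_less_eq_eq Suc_le_eq le_zero_eq less_irrefl)
    then obtain p where "p \<in> P" "nbs W' E p = I" by auto
    then have cI: "b \<le> card I" by (auto simp: P_def)
    have "(\<beta> / 2) ^ Suc k * K = \<beta> / 2 * ((\<beta> / 2) ^ k * K)" by simp
    also have "\<dots> \<le> \<beta> / 2 * card W'" using W'(2) \<beta> by (intro mult_left_mono) auto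
    finally have "(\<beta> / 2) ^ Suc k * K \<le> card I" using cI by (simp add: b_def)
    moreover have "C' j \<subseteq> A j \<and> c * n \<le> card (C' j) \<and> (\<forall>w\<in>I. \<forall>u\<in>C' j. E w u)" if "j < Suc k" for j
    proof (cases "j = k")
      case True
      have "E w u" if "w \<in> I" "u \<in> P" "nbs W' E u = I" for w u
      proof -
        have "E u w" using that by (auto simp: nbs_def)
        then show ?thesis by (rule sgraphD(2)[OF G])
      qed
      moreover have "c * n \<le> card {v\<in>P. nbs W' E v = I}" using I(2) m(1) by linarith
      ultimately show ?thesis using True by (auto simp: C'_def P_def)
    next
      case False
      then show ?thesis using C[of j] that I(1) by (auto simp: C'_def)
    qed
    ultimately show ?case using I(1) W'(1) by (intro exI[of _ I] exI[of _ C']) auto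
  qed
  from step[of r] obtain W' C where W': "W' \<subseteq> W" "(\<beta> / 2) ^ r * K \<le> card W'"
    and C: "\<And>j. j < r \<Longrightarrow> C j \<subseteq> A j \<and> c * n \<le> card (C j) \<and> (\<forall>w\<in>W'. \<forall>u\<in>C j. E w u)" by auto
  have "real t \<le> card W'" using W'(2) K by linarith
  then have "t \<le> card W'" by simp
  then obtain S where S: "S \<subseteq> W'" "card S = t" "finite S" by (rule obtain_subset_with_card_n)
  have SD: "S \<subseteq> dominators \<beta>" using S(1) W'(1) W(1) by auto
  show False
  proof (rule no_dominating_embedding[of 0 S "{}" C])
    show "0 < r" using r by simp
    show "S \<subseteq> V" using SD by (auto simp: dominators_def)
    show "2 * s \<le> card (nbs (A 0) E w)" if "w \<in> S" for w
    proof -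
      have "\<beta> * n \<le> card (nbs (A 0) E w)" using that SD r by (auto simp: dominators_def)
      then have "real (2 * s) \<le> card (nbs (A 0) E w)" using \<beta>s by simp
      then show ?thesis by (simp only: of_nat_le_iff)
    qed
    show "C j \<subseteq> A j \<and> (\<forall>z\<in>S \<union> {}. \<forall>u\<in>C j. E z u) \<and> 4 * r * s * \<gamma> * n \<le> card (C j)" if "j < r" "j \<noteq> 0" for j
    proof -
      have "(4 * r * s * \<gamma>) * n \<le> c * n" using c n0 unfolding c_def by (intro mult_right_mono) auto
      then show ?thesis using C[OF that(1)] S(1) by auto
    qed
  qed (use S in auto)
qed

text \<open>
  Classify the vertices of each part by their neighbourhood among the dominators and ignore the rare
  types. In each part let \<open>p j\<close> be a vertex of non-rare type for which the total weight \<open>\<zeta> (p j)\<close> of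
  the dominators missed by it is smallest, and let \<open>Z\<close> be the sum of these \<open>r\<close> minima; minimality
  bounds the weight of all missing pairs from below by about \<open>(1/r) n Z\<close>. Let \<open>i\<close> be the part with
  the largest minimum. The dominators outside the set \<open>U\<close> of those missing some \<open>p j\<close> with \<open>j \<noteq> i\<close>
  are adjacent to \<open>r - 1\<close> large types in different parts, so there are fewer than \<open>t\<close> of them, while
  \<open>U\<close> weighs at most \<open>Z - \<zeta> (p i) \<le> (1 - 1/r) Z\<close>. The factor \<open>1 - 1/r\<close> decides the third case of the
  exchange argument.
\<close>

lemma dominators_weight:
  fixes a :: "'a \<Rightarrow> real"
  assumes \<beta>s: "2 * s \<le> \<beta> * n" and K: "card (dominators \<beta>) \<le> K"
    and c: "4 * r * s * \<gamma> \<le> c" and \<omega>: "2 ^ K * c < 1 / r - \<gamma>"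
    and a: "\<And>w. a w \<ge> 0"
  shows "\<exists>U Z. U \<subseteq> dominators \<beta> \<and> card (dominators \<beta> - U) < t \<and> r * (\<Sum>w\<in>U. a w) \<le> (real r - 1) * Z \<and>
    (1 / r - \<gamma> - 2 ^ K * c) * n * Z \<le> (\<Sum>w\<in>dominators \<beta>. a w * (\<Sum>j<r. real (card (A j - nbs (A j) E w))))"
proof -
  define W where "W = dominators \<beta>"
  have fW: "finite W" using fin by (simp add: W_def dominators_def)
  define \<zeta> where "\<zeta> = (\<lambda>p. \<Sum>w\<in>W - nbs W E p. a w)"
  define cls where "cls = (\<lambda>j p. {p'\<in>A j. nbs W E p' = nbs W E p})"
  define B where "B = (\<lambda>j. {p\<in>A j. real (card (cls j p)) < c * n})"
  have \<zeta>0: "\<zeta> p \<ge> 0" for p unfolding \<zeta>_def by (intro sum_nonneg a)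
  have cn: "c * n > 0"
  proof -
    have "real (4 * r * s) * \<gamma> > 0" using r s2 \<gamma> by simp
    then have "c > 0" using c by linarith
    then show ?thesis using n0 by simp
  qed
  \<comment> \<open>\<open>B j\<close> collects the vertices of rare type; there are at most \<open>2 ^ K\<close> types.\<close>
  have B_small: "real (card (B j)) \<le> 2 ^ K * c * n" if j: "j < r" for j
  proof -
    define T where "T = {I\<in>Pow W. real (card {p\<in>A j. nbs W E p = I}) < c * n}"
    have "finite T" using fW by (simp add: T_def)
    have "B j \<subseteq> (\<Union>I\<in>T. {p\<in>A j. nbs W E p = I})"
      by (auto simp: B_def T_def cls_def nbs_def)
    then have "card (B j) \<le> card (\<Union>I\<in>T. {p\<in>A j. nbs W E p = I})"
      using \<open>finite T\<close> finA[OF j] by (intro card_mono) auto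
    also have "\<dots> \<le> (\<Sum>I\<in>T. card {p\<in>A j. nbs W E p = I})" using \<open>finite T\<close> by (rule card_UN_le)
    finally have "real (card (B j)) \<le> (\<Sum>I\<in>T. real (card {p\<in>A j. nbs W E p = I}))" by (simp flip: of_nat_sum)
    also have "\<dots> \<le> (\<Sum>I\<in>T. c * n)" by (intro sum_mono) (auto simp: T_def)
    also have "\<dots> \<le> 2 ^ card W * (c * n)"
    proof -
      have "card T \<le> card (Pow W)" using fW by (intro card_mono) (auto simp: T_def)
      then have "real (card T) \<le> 2 ^ card W" using fW by (simp add: card_Pow flip: of_nat_le_iff)
      then show ?thesis using cn by (simp add: mult_right_mono)
    qed
    also have "\<dots> \<le> 2 ^ K * (c * n)" using K cn by (intro mult_right_mono power_increasing) (auto simp: W_def)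
    finally show ?thesis by simp
  qed
  have "\<exists>p. p \<in> A j - B j \<and> (\<forall>p'\<in>A j - B j. \<zeta> p \<le> \<zeta> p')" if j: "j < r" for j
  proof -
    have "2 ^ K * c * n < (1 / r - \<gamma>) * n" using \<omega> n0 by (intro mult_strict_right_mono) auto
    then have "card (B j) < card (A j)" using B_small[OF j] Alow[OF j] by linarith
    then have "A j - B j \<noteq> {}" using card_mono[of "B j" "A j"] finA[OF j] by (auto simp: B_def)
    moreover have "finite (A j - B j)" using finA[OF j] by simp
    ultimately show ?thesis using ex_min_entry[of "A j - B j" \<zeta>] by metis
  qed
  then obtain p where p: "\<And>j. j < r \<Longrightarrow> p j \<in> A j - B j" "\<And>j p'. j < r \<Longrightarrow> p' \<in> A j - B j \<Longrightarrow> \<zeta> (p j) \<le> \<zeta> p'"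
    by metis
  define Z where "Z = (\<Sum>j<r. \<zeta> (p j))"
  have part: "(1 / r - \<gamma> - 2 ^ K * c) * n * \<zeta> (p j) \<le> (\<Sum>w\<in>W. a w * real (card (A j - nbs (A j) E w)))" if j: "j < r" for j
  proof -
    have "card (A j) - card (B j) \<le> card (A j - B j)" using finA[OF j] by (intro diff_card_le_card_Diff) (auto simp: B_def)
    then have "real (card (A j)) - card (B j) \<le> card (A j - B j)" by linarith
    then have "(1 / r - \<gamma> - 2 ^ K * c) * n \<le> card (A j - B j)" using B_small[OF j] Alow[OF j] by (simp add: algebra_simps)
    then have "(1 / r - \<gamma> - 2 ^ K * c) * n * \<zeta> (p j) \<le> card (A j - B j) * \<zeta> (p j)" using \<zeta>0 by (intro mult_right_mono) auto
    also have "\<dots> \<le> (\<Sum>p'\<in>A j - B j. \<zeta> p')" using p(2)[OF j] sum_mono[of "A j - B j" "\<lambda>_. \<zeta> (p j)" \<zeta>] by simp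
    also have "\<dots> \<le> (\<Sum>p'\<in>A j. \<zeta> p')" using finA[OF j] \<zeta>0 by (intro sum_mono2) auto
    also have "\<dots> = (\<Sum>p'\<in>A j. \<Sum>w\<in>W. if E w p' then 0 else a w)"
    proof (intro sum.cong refl)
      fix p'
      have "W - nbs W E p' = {w\<in>W. \<not> E w p'}" using sgraphD(2)[OF G] by (auto simp: nbs_def)
      then have "\<zeta> p' = (\<Sum>w\<in>{w\<in>W. \<not> E w p'}. a w)" by (simp add: \<zeta>_def)
      also have "\<dots> = (\<Sum>w\<in>W. if \<not> E w p' then a w else 0)" using fW by (rule sum.inter_filter)
      also have "\<dots> = (\<Sum>w\<in>W. if E w p' then 0 else a w)" by (intro sum.cong) auto
      finally show "\<zeta> p' = (\<Sum>w\<in>W. if E w p' then 0 else a w)" .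
    qed
    also have "\<dots> = (\<Sum>w\<in>W. \<Sum>p'\<in>A j. if E w p' then 0 else a w)" by (rule sum.swap)
    also have "\<dots> = (\<Sum>w\<in>W. a w * real (card (A j - nbs (A j) E w)))"
    proof (intro sum.cong refl)
      fix w
      have "(\<Sum>p'\<in>A j. if E w p' then 0 else a w) = (\<Sum>p'\<in>A j. if \<not> E w p' then a w else 0)" by (intro sum.cong) auto
      also have "\<dots> = (\<Sum>p'\<in>{p'\<in>A j. \<not> E w p'}. a w)" using finA[OF j] by (intro sum.inter_filter[symmetric])
      also have "{p'\<in>A j. \<not> E w p'} = A j - nbs (A j) E w" by (auto simp: nbs_def)
      finally show "(\<Sum>p'\<in>A j. if E w p' then 0 else a w) = a w * real (card (A j - nbs (A j) E w))" by simp
    qed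
    finally show ?thesis .
  qed
  have "(1 / r - \<gamma> - 2 ^ K * c) * n * Z = (\<Sum>j<r. (1 / r - \<gamma> - 2 ^ K * c) * n * \<zeta> (p j))"
    by (simp add: Z_def sum_distrib_left)
  also have "\<dots> \<le> (\<Sum>j<r. \<Sum>w\<in>W. a w * real (card (A j - nbs (A j) E w)))" by (intro sum_mono part) auto
  also have "\<dots> = (\<Sum>w\<in>W. \<Sum>j<r. a w * real (card (A j - nbs (A j) E w)))" by (rule sum.swap)
  finally have Zle: "(1 / r - \<gamma> - 2 ^ K * c) * n * Z \<le> (\<Sum>w\<in>W. a w * (\<Sum>j<r. real (card (A j - nbs (A j) E w))))"
    by (simp add: sum_distrib_left)
  obtain i where i: "i < r" "\<And>j. j < r \<Longrightarrow> \<zeta> (p j) \<le> \<zeta> (p i)"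
  proof -
    have "0 \<in> {..<r}" using r by simp
    then have ne: "{..<r} \<noteq> {}" by blast
    obtain i where "i \<in> {..<r}" "\<And>j. j \<in> {..<r} \<Longrightarrow> - \<zeta> (p i) \<le> - \<zeta> (p j)"
      by (rule ex_min_entry[of "{..<r}" "\<lambda>j. - \<zeta> (p j)", OF finite_lessThan ne]) blast
    then show ?thesis using that by auto
  qed
  \<comment> \<open>Omitting the part with the largest minimum is what saves the factor \<open>1 - 1/r\<close>.\<close>
  define U where "U = (\<Union>j\<in>{..<r} - {i}. W - nbs W E (p j))"
  have UW: "U \<subseteq> W" by (auto simp: U_def)
  have Zi: "Z \<le> r * \<zeta> (p i)" using i(2) sum_mono[of "{..<r}" "\<lambda>j. \<zeta> (p j)" "\<lambda>_. \<zeta> (p i)"] by (simp add: Z_def)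
  have "(\<Sum>w\<in>U. a w) \<le> (\<Sum>j\<in>{..<r} - {i}. \<zeta> (p j))"
    unfolding U_def \<zeta>_def by (rule sum_UN_le) (use fW a in auto)
  also have "\<dots> = Z - \<zeta> (p i)" using i(1) by (simp add: Z_def sum.remove[of "{..<r}" i])
  finally have "r * (\<Sum>w\<in>U. a w) \<le> r * (Z - \<zeta> (p i))" by (intro mult_left_mono) auto
  also have "\<dots> \<le> (real r - 1) * Z" using Zi by (simp add: algebra_simps)
  finally have Ua: "r * (\<Sum>w\<in>U. a w) \<le> (real r - 1) * Z" .
  have "card (W - U) < t"
  proof (rule ccontr)
    assume "\<not> card (W - U) < t"
    then have "t \<le> card (W - U)" by simp
    then obtain S where S: "S \<subseteq> W - U" "card S = t" "finite S" by (rule obtain_subset_with_card_n)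
    show False
    proof (rule no_dominating_embedding[OF i(1), of S "{}" "\<lambda>j. cls j (p j)"])
      show "S \<subseteq> V" using S(1) by (auto simp: W_def dominators_def)
      show "2 * s \<le> card (nbs (A i) E w)" if "w \<in> S" for w
      proof -
        have "\<beta> * n \<le> card (nbs (A i) E w)" using that S(1) i(1) by (auto simp: W_def dominators_def)
        then have "real (2 * s) \<le> card (nbs (A i) E w)" using \<beta>s by simp
        then show ?thesis by (simp only: of_nat_le_iff)
      qed
      show "cls j (p j) \<subseteq> A j \<and> (\<forall>z\<in>S \<union> {}. \<forall>u\<in>cls j (p j). E z u) \<and> 4 * r * s * \<gamma> * n \<le> card (cls j (p j))"
        if j: "j < r" "j \<noteq> i" for j
      proof -
        have "(4 * r * s * \<gamma>) * n \<le> c * n" using c n0 by (intro mult_right_mono) auto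
        moreover have "c * n \<le> card (cls j (p j))" using p(1)[OF j(1)] by (auto simp: B_def)
        moreover have "E z u" if zu: "z \<in> S" "u \<in> cls j (p j)" for z u
        proof -
          have "z \<in> nbs W E (p j)" using zu S(1) j by (auto simp: U_def)
          then have "z \<in> nbs W E u" using zu(2) by (auto simp: cls_def)
          then have "E u z" by (auto simp: nbs_def)
          then show ?thesis by (rule sgraphD(2)[OF G])
        qed
        moreover have "cls j (p j) \<subseteq> A j" by (auto simp: cls_def)
        ultimately show ?thesis by auto
      qed
    qed (use S in auto)
  qed
  then show ?thesis using UW Ua Zle unfolding W_def by blast
qed

section \<open>Home classes and internal edges\<close>

lemma gamma_bounds: "r * s * \<gamma> \<le> 1 / (100 * r)" "\<gamma> \<le> 1 / (200 * r * r)"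
proof -
  have r0: "real r > 0" using r by simp
  have "(r * s * \<gamma>) * (100 * r) \<le> 1" using \<gamma>(2) by (simp add: mult_ac)
  then show "r * s * \<gamma> \<le> 1 / (100 * r)" using r0 by (simp add: field_simps)
  have "2 * (100 * r * r * \<gamma>) \<le> s * (100 * r * r * \<gamma>)" using s2 \<gamma>(1) by (intro mult_right_mono) auto
  then have "\<gamma> * (200 * r * r) \<le> 1" using \<gamma>(2) by (simp add: mult_ac)
  moreover have "real (200 * r * r) > 0" using r by simp
  ultimately show "\<gamma> \<le> 1 / (200 * r * r)" using pos_le_divide_eq[of "real (200 * r * r)" \<gamma> 1] by blast
qed

lemma A_not_dominators: "i < r \<Longrightarrow> v \<in> A i \<Longrightarrow> \<beta> > 0 \<Longrightarrow> v \<notin> dominators \<beta>"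
proof
  assume i: "i < r" "v \<in> A i" "\<beta> > 0" "v \<in> dominators \<beta>"
  have "nbs (A i) E v = {}" using Aind[OF i(1,2)] by (auto simp: nbs_def)
  then have "\<beta> * n \<le> 0" using i by (auto simp: dominators_def)
  then show False using i(3) n0 by (simp add: mult_le_0_iff)
qed

text \<open>
  \<open>h v\<close> is the index of a part in which \<open>v\<close> has few neighbours; for a vertex of \<open>A i\<close> it has to be \<open>i\<close>.
\<close>

definition home :: "real \<Rightarrow> ('a \<Rightarrow> nat) \<Rightarrow> bool" where
  "home \<beta> h \<longleftrightarrow> (\<forall>v\<in>V - dominators \<beta>. h v < r \<and> card (nbs (A (h v)) E v) < \<beta> * n) \<and> (\<forall>i<r. \<forall>v\<in>A i. h v = i)"

lemma home_exists:
  assumes "\<beta> > 0"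
  shows "\<exists>h. home \<beta> h"
proof -
  define h where "h = (\<lambda>v. if \<exists>i<r. v \<in> A i then (SOME i. i < r \<and> v \<in> A i) else (SOME i. i < r \<and> card (nbs (A i) E v) < \<beta> * n))"
  have h1: "h v = i" if "i < r" "v \<in> A i" for i v
  proof -
    have "h v < r \<and> v \<in> A (h v)" using someI_ex[of "\<lambda>i. i < r \<and> v \<in> A i"] that by (auto simp: h_def)
    then show ?thesis using Adisj[of "h v" i] that by auto
  qed
  have "h v < r \<and> card (nbs (A (h v)) E v) < \<beta> * n" if v: "v \<in> V - dominators \<beta>" for v
  proof (cases "\<exists>i<r. v \<in> A i")
    case True
    then obtain i where i: "i < r" "v \<in> A i" by auto
    have "nbs (A i) E v = {}" using Aind[OF i] by (auto simp: nbs_def)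
    then show ?thesis using h1[OF i] i assms n0 by simp
  next
    case False
    have "\<exists>i. i < r \<and> card (nbs (A i) E v) < \<beta> * n" using v by (auto simp: dominators_def not_le)
    from someI_ex[OF this] show ?thesis unfolding h_def if_not_P[OF False] by simp
  qed
  then show ?thesis using h1 unfolding home_def by blast
qed

text \<open>
  The edges, as ordered pairs, that violate the partition into home classes.
\<close>

definition internal :: "real \<Rightarrow> ('a \<Rightarrow> nat) \<Rightarrow> ('a \<times> 'a) set" where
  "internal \<beta> h = {(u, v). u \<in> V - dominators \<beta> \<and> v \<in> V - dominators \<beta> \<and> h u = h v \<and> E u v}"

lemma home_miss:
  assumes h: "home \<beta> h" and v: "v \<in> V - dominators \<beta>" and j: "j < r" "j \<noteq> h v"
  shows "real (card (A j - nbs (A j) E v)) \<le> (2 * \<gamma> + \<beta>) * n"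
proof -
  have "h v < r" "card (nbs (A (h v)) E v) < \<beta> * n" using h v by (auto simp: home_def)
  then show ?thesis using miss[of v "h v" j] v j by (simp add: algebra_simps)
qed

text \<open>
  A matching of \<open>t\<close> edges within one home class would satisfy the hypotheses of
  \<open>no_dominating_embedding\<close> with \<open>S = {}\<close>.
\<close>

lemma home_class_no_matching:
  fixes \<beta> :: real
  assumes h: "home \<beta> h" and \<beta>: "\<beta> > 0" "16 * t * r * \<beta> \<le> 1" and i: "i < r"
  shows "\<not> matching E {v\<in>V - dominators \<beta>. h v = i} t"
proof
  assume "matching E {v\<in>V - dominators \<beta>. h v = i} t"
  then obtain Y where Y: "Y \<subseteq> {v\<in>V - dominators \<beta>. h v = i}" "finite Y" "card Y = 2 * t" "matching E Y t" by (rule matching_span)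
  show False
  proof (rule no_dominating_embedding[OF i, of "{}" Y "\<lambda>j. {a\<in>A j. \<forall>y\<in>Y. E y a}"])
    fix j assume j: "j < r" "j \<noteq> i"
    have "real (card (A j)) - card Y * ((2 * \<gamma> + \<beta>) * n) \<le> card {a\<in>A j. \<forall>y\<in>Y. E y a}"
      by (rule card_common_nbs[OF finA[OF j(1)] Y(2)]) (use home_miss[OF h] Y(1) j in auto)
    then have "(1 / r - \<gamma>) * n - 2 * t * ((2 * \<gamma> + \<beta>) * n) \<le> card {a\<in>A j. \<forall>y\<in>Y. E y a}"
      using Alow[OF j(1)] Y(3) by simp
    moreover have "4 * r * s * \<gamma> * n \<le> (1 / r - \<gamma>) * n - 2 * t * ((2 * \<gamma> + \<beta>) * n)"
    proof -
      have "t * \<gamma> * 4 \<le> r * s * \<gamma>"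
      proof -
        have "3 * s \<le> r * s" using r by (intro mult_right_mono) auto
        then have "4 * t \<le> r * s" using st by linarith
        then have "real (4 * t) * \<gamma> \<le> real (r * s) * \<gamma>" using \<gamma>(1) by (intro mult_right_mono of_nat_mono) auto
        then show ?thesis by simp
      qed
      moreover have "1 * \<gamma> \<le> real (r * s) * \<gamma>"
      proof -
        have "0 < r * s" using r s2 by simp
        then have "1 \<le> r * s" by linarith
        then show ?thesis using \<gamma>(1) by (intro mult_right_mono) (metis of_nat_1 of_nat_le_iff, simp)
      qed
      moreover have "2 * t * \<beta> \<le> 1 / (8 * r)"
      proof -
        have "(2 * t * \<beta>) * (8 * r) \<le> 1" using \<beta>(2) by (simp add: mult_ac)
        moreover have "real (8 * r) > 0" using r by simp
        ultimately show ?thesis by (simp add: pos_le_divide_eq)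
      qed
      moreover define \<rho> where "\<rho> = 1 / real r"
      moreover have "1 / real (8 * r) = \<rho> / 8" "1 / (8 * real r) = \<rho> / 8" by (simp_all add: \<rho>_def)
      moreover have "r * s * \<gamma> \<le> \<rho> / 100" using gamma_bounds(1) by (simp add: \<rho>_def)
      moreover have "\<rho> > 0" using r by (simp add: \<rho>_def)
      ultimately have "4 * (r * s * \<gamma>) + \<gamma> + (t * \<gamma> * 4 + 2 * t * \<beta>) \<le> \<rho>" by linarith
      then have "4 * (r * s * \<gamma>) + \<gamma> + (t * \<gamma> * 4 + 2 * t * \<beta>) \<le> 1 / r" by (simp add: \<rho>_def)
      then have "(4 * (r * s * \<gamma>) + \<gamma> + (t * \<gamma> * 4 + 2 * t * \<beta>)) * n \<le> 1 / r * n" using n0 by (intro mult_right_mono) auto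
      then show ?thesis by (simp add: algebra_simps)
    qed
    ultimately show "{a\<in>A j. \<forall>y\<in>Y. E y a} \<subseteq> A j \<and> (\<forall>z\<in>{} \<union> Y. \<forall>u\<in>{a\<in>A j. \<forall>y\<in>Y. E y a}. E z u) \<and>
        4 * r * s * \<gamma> * n \<le> card {a\<in>A j. \<forall>y\<in>Y. E y a}" by auto
  qed (use Y in auto)
qed

text \<open>
  In each home class fewer than \<open>2 t\<close> vertices cover all edges, and each of them has at most
  \<open>2 \<beta> n\<close> neighbours there.
\<close>

lemma card_internal:
  fixes \<beta> :: real
  assumes h: "home \<beta> h" and \<beta>: "\<gamma> \<le> \<beta>" "16 * t * r * \<beta> \<le> 1"
  shows "card (internal \<beta> h) \<le> 8 * t * r * \<beta> * n"
proof -
  have \<beta>0: "\<beta> > 0" using \<beta> \<gamma> by simp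
  define X where "X = (\<lambda>i. {v\<in>V - dominators \<beta>. h v = i})"
  define I where "I = (\<lambda>i. {(u, v). u \<in> X i \<and> v \<in> X i \<and> E u v})"
  have one: "real (card (I i)) \<le> 8 * t * \<beta> * n" if i: "i < r" for i
  proof -
    have fX: "finite (X i)" using fin by (simp add: X_def)
    have GX: "sgraph (X i) E" using G by (rule sgraph_mono) (auto simp: X_def)
    have "\<not> matching E (X i) (Suc (t - 1))" using home_class_no_matching[OF h \<beta>0 \<beta>(2) i] t by (simp add: X_def)
    then obtain C where C: "C \<subseteq> X i" "card C \<le> 2 * (t - 1)" "\<forall>u\<in>X i - C. \<forall>v\<in>X i - C. \<not> E u v"
      using vertex_cover_of_no_matching[OF GX] by blast
    have fC: "finite C" using C(1) fX by (rule finite_subset)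
    have nb: "real (card (nbs (X i) E c)) \<le> 2 * \<beta> * n" if c: "c \<in> C" for c
    proof -
      have cX: "c \<in> V - dominators \<beta>" "h c = i" using c C(1) by (auto simp: X_def)
      have "nbs (X i) E c \<subseteq> nbs (A i) E c \<union> (V - (\<Union>i<r. A i))"
        using h by (auto simp: nbs_def X_def home_def)
      then have "card (nbs (X i) E c) \<le> card (nbs (A i) E c \<union> (V - (\<Union>i<r. A i)))"
        using finA[OF i] fin by (intro card_mono) auto
      also have "\<dots> \<le> card (nbs (A i) E c) + card (V - (\<Union>i<r. A i))" by (rule card_Un_le)
      finally have "real (card (nbs (X i) E c)) \<le> card (nbs (A i) E c) + card (V - (\<Union>i<r. A i))" by linarith
      also have "\<dots> \<le> \<beta> * n + \<gamma> * n"
      proof -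
        have "card (nbs (A (h c)) E c) < \<beta> * n" using h cX(1) by (auto simp: home_def)
        then show ?thesis using rest cX(2) by simp
      qed
      also have "\<dots> \<le> 2 * \<beta> * n" using \<beta>(1) n0 by (simp add: mult_right_mono flip: distrib_right)
      finally show ?thesis .
    qed
    have "I i \<subseteq> (\<Union>c\<in>C. {c} \<times> nbs (X i) E c) \<union> (\<Union>c\<in>C. nbs (X i) E c \<times> {c})"
    proof
      fix p assume "p \<in> I i"
      then obtain u v where p: "p = (u, v)" "u \<in> X i" "v \<in> X i" "E u v" by (auto simp: I_def)
      have "E v u" using p(4) by (rule sgraphD(2)[OF G])
      have "u \<in> C \<or> v \<in> C" using C(3) p by auto
      then show "p \<in> (\<Union>c\<in>C. {c} \<times> nbs (X i) E c) \<union> (\<Union>c\<in>C. nbs (X i) E c \<times> {c})"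
        using p \<open>E v u\<close> by (auto simp: nbs_def)
    qed
    then have "card (I i) \<le> card ((\<Union>c\<in>C. {c} \<times> nbs (X i) E c) \<union> (\<Union>c\<in>C. nbs (X i) E c \<times> {c}))"
      using fC fX by (intro card_mono) auto
    also have "\<dots> \<le> card (\<Union>c\<in>C. {c} \<times> nbs (X i) E c) + card (\<Union>c\<in>C. nbs (X i) E c \<times> {c})" by (rule card_Un_le)
    also have "\<dots> \<le> (\<Sum>c\<in>C. card ({c} \<times> nbs (X i) E c)) + (\<Sum>c\<in>C. card (nbs (X i) E c \<times> {c}))"
      by (intro add_mono card_UN_le fC)
    also have "\<dots> = 2 * (\<Sum>c\<in>C. card (nbs (X i) E c))" by (simp add: card_cartesian_product)
    finally have "real (card (I i)) \<le> 2 * (\<Sum>c\<in>C. real (card (nbs (X i) E c)))" by (simp flip: of_nat_sum)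
    also have "\<dots> \<le> 2 * (\<Sum>c\<in>C. 2 * \<beta> * n)" by (intro mult_left_mono sum_mono nb) auto
    also have "\<dots> = card C * (4 * \<beta> * n)" by simp
    also have "\<dots> \<le> (2 * t) * (4 * \<beta> * n)" using C(2) \<beta>0 n0 by (intro mult_right_mono) auto
    finally show ?thesis by simp
  qed
  have "internal \<beta> h \<subseteq> (\<Union>i<r. I i)" using h by (auto simp: internal_def I_def X_def home_def)
  moreover have "finite (I i)" for i by (rule finite_subset[of _ "V \<times> V"]) (use fin in \<open>auto simp: I_def X_def\<close>)
  ultimately have "card (internal \<beta> h) \<le> card (\<Union>i<r. I i)" by (intro card_mono) auto
  also have "\<dots> \<le> (\<Sum>i<r. card (I i))" by (rule card_UN_le) simp
  finally have "real (card (internal \<beta> h)) \<le> (\<Sum>i<r. real (card (I i)))" by (simp flip: of_nat_sum)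
  also have "\<dots> \<le> (\<Sum>i<r. 8 * t * \<beta> * n)" by (intro sum_mono one) auto
  finally show ?thesis by (simp add: mult_ac)
qed

text \<open>
  One internal edge together with \<open>t - 1\<close> dominators would give the \<open>t\<close> edges of
  \<open>no_dominating_embedding\<close>, unless the dominators fail to have enough common neighbours. Hence they
  miss linearly many vertices of the parts.
\<close>

lemma internal_edge_forces_missing:
  fixes \<beta> :: real
  assumes h: "home \<beta> h" and \<beta>: "2 * s \<le> \<beta> * n" "\<beta> > 0" "16 * t * r * \<beta> \<le> 1"
    and W: "card (dominators \<beta>) = t - 1" and uv: "(u, v) \<in> internal \<beta> h"
  shows "n / (2 * r) \<le> (\<Sum>w\<in>dominators \<beta>. \<Sum>j<r. real (card (A j - nbs (A j) E w)))"
proof (rule ccontr)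
  assume neg: "\<not> ?thesis"
  define W where "W = dominators \<beta>"
  have fW: "finite W" using fin by (simp add: W_def dominators_def)
  define i where "i = h u"
  have uv': "u \<in> V - W" "v \<in> V - W" "h v = i" "E u v" using uv by (auto simp: internal_def i_def W_def)
  have i: "i < r" using h uv' by (auto simp: home_def i_def W_def)
  have ne: "u \<noteq> v" using uv'(4) sgraphD(3)[OF G] by auto
  have "matching E (insert u (insert v {})) (Suc 0)" using uv'(4) ne by (intro matching_insert) auto
  then have mY: "matching E {u, v} (t - card W)" using W t by (simp add: W_def)
  show False
  proof (rule no_dominating_embedding[OF i, of W "{u, v}" "\<lambda>j. {a\<in>A j. \<forall>y\<in>W \<union> {u, v}. E y a}"])
    show "W \<subseteq> V" by (auto simp: W_def dominators_def)
    show "card W \<le> t" using W by (simp add: W_def)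
    show "{u, v} \<subseteq> V" "{u, v} \<inter> W = {}" using uv' by auto
    show "card {u, v} = 2 * (t - card W)" using ne W t by (simp add: W_def)
    show "matching E {u, v} (t - card W)" by (rule mY)
    show "2 * s \<le> card (nbs (A i) E w)" if "w \<in> W" for w
    proof -
      have "\<beta> * n \<le> card (nbs (A i) E w)" using that i by (auto simp: W_def dominators_def)
      then have "real (2 * s) \<le> card (nbs (A i) E w)" using \<beta>(1) by simp
      then show ?thesis by (simp only: of_nat_le_iff)
    qed
    fix j assume j: "j < r" "j \<noteq> i"
    have "real (card (A j)) - (\<Sum>y\<in>W \<union> {u, v}. real (card (A j - nbs (A j) E y))) \<le> card {a\<in>A j. \<forall>y\<in>W \<union> {u, v}. E y a}"
      by (rule card_common_nbs_sum) (use finA[OF j(1)] fW in auto)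
    moreover have "(\<Sum>y\<in>W \<union> {u, v}. real (card (A j - nbs (A j) E y))) =
        (\<Sum>w\<in>W. real (card (A j - nbs (A j) E w))) + (\<Sum>y\<in>{u, v}. real (card (A j - nbs (A j) E y)))"
      using fW uv' by (intro sum.union_disjoint) auto
    moreover have "(\<Sum>y\<in>{u, v}. real (card (A j - nbs (A j) E y))) \<le> 2 * ((2 * \<gamma> + \<beta>) * n)"
      using home_miss[OF h, of u j] home_miss[OF h, of v j] uv' j ne by (simp add: i_def W_def)
    moreover have "(\<Sum>w\<in>W. real (card (A j - nbs (A j) E w))) \<le> (\<Sum>w\<in>W. \<Sum>j<r. real (card (A j - nbs (A j) E w)))"
      by (intro sum_mono member_le_sum) (use j in auto)
    moreover have "(\<Sum>w\<in>W. \<Sum>j<r. real (card (A j - nbs (A j) E w))) \<le> n / (2 * r)" using neg by (simp add: W_def)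
    ultimately have "(1 / r - \<gamma>) * n - n / (2 * r) - 2 * ((2 * \<gamma> + \<beta>) * n) \<le> card {a\<in>A j. \<forall>y\<in>W \<union> {u, v}. E y a}"
      using Alow[OF j(1)] by linarith
    moreover have "4 * r * s * \<gamma> * n \<le> (1 / r - \<gamma>) * n - n / (2 * r) - 2 * ((2 * \<gamma> + \<beta>) * n)"
    proof -
      have "5 * \<gamma> \<le> r * s * \<gamma>"
      proof -
        have "3 * 2 \<le> r * s" using r s2 by (intro mult_le_mono) auto
        then have "5 \<le> r * s" by linarith
        then have "real 5 * \<gamma> \<le> real (r * s) * \<gamma>" using \<gamma>(1) by (intro mult_right_mono of_nat_mono) auto
        then show ?thesis by simp
      qed
      moreover have "2 * \<beta> \<le> 1 / (8 * r)"
      proof -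
        have "1 * ((2 * \<beta>) * (8 * r)) \<le> t * ((2 * \<beta>) * (8 * r))" using t \<beta>(2) by (intro mult_right_mono) auto
        then have "(2 * \<beta>) * (8 * r) \<le> 1" using \<beta>(3) by (simp add: mult_ac)
        moreover have "real (8 * r) > 0" using r by simp
        ultimately show ?thesis by (simp add: pos_le_divide_eq)
      qed
      moreover define \<rho> where "\<rho> = 1 / real r"
      moreover have "1 / real (8 * r) = \<rho> / 8" "1 / (8 * real r) = \<rho> / 8" by (simp_all add: \<rho>_def)
      moreover have "r * s * \<gamma> \<le> \<rho> / 100" using gamma_bounds(1) by (simp add: \<rho>_def)
      moreover have "\<rho> > 0" using r by (simp add: \<rho>_def)
      ultimately have "4 * (r * s * \<gamma>) + \<gamma> + (4 * \<gamma> + 2 * \<beta>) \<le> \<rho> - \<rho> / 2" by linarith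
      then have "4 * (r * s * \<gamma>) + \<gamma> + (4 * \<gamma> + 2 * \<beta>) \<le> 1 / r - 1 / (2 * r)" by (simp add: \<rho>_def)
      then have "(4 * (r * s * \<gamma>) + \<gamma> + (4 * \<gamma> + 2 * \<beta>)) * n \<le> (1 / r - 1 / (2 * r)) * n" using n0 by (intro mult_right_mono) auto
      then show ?thesis by (simp add: algebra_simps)
    qed
    ultimately show "{a\<in>A j. \<forall>y\<in>W \<union> {u, v}. E y a} \<subseteq> A j \<and> (\<forall>z\<in>W \<union> {u, v}. \<forall>b\<in>{a\<in>A j. \<forall>y\<in>W \<union> {u, v}. E y a}. E z b) \<and>
        4 * r * s * \<gamma> * n \<le> card {a\<in>A j. \<forall>y\<in>W \<union> {u, v}. E y a}" by auto
  qed
qed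

end

section \<open>Edge exchange\<close>

definition pairs :: "'a set \<Rightarrow> ('a \<Rightarrow> 'a \<Rightarrow> bool) \<Rightarrow> ('a \<times> 'a) set" where
  "pairs V E = {(u, v). u \<in> V \<and> v \<in> V \<and> E u v}"

text \<open>
  The contribution of a set of ordered pairs to twice the quadratic form.
\<close>

definition weight :: "('a \<Rightarrow> real) \<Rightarrow> ('a \<times> 'a) set \<Rightarrow> real" where
  "weight y R = (\<Sum>(u, v)\<in>R. (y u + y v)\<^sup>2)"

text \<open>
  A clique on \<open>T\<close>, joined to the complete multipartite graph whose parts are the colour classes of \<open>h\<close>
  outside \<open>T\<close>.
\<close>

definition coloured_join :: "'a set \<Rightarrow> ('a \<Rightarrow> nat) \<Rightarrow> 'a \<Rightarrow> 'a \<Rightarrow> bool" where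
  "coloured_join T h u v \<longleftrightarrow> u \<noteq> v \<and> (u \<in> T \<or> v \<in> T \<or> h u \<noteq> h v)"

lemma sgraph_coloured_join: "finite V \<Longrightarrow> sgraph V (coloured_join T h)"
  by (auto simp: sgraph_def coloured_join_def)

lemma finite_pairs: "finite V \<Longrightarrow> finite (pairs V E)"
  by (rule finite_subset[of _ "V \<times> V"]) (auto simp: pairs_def)

lemma qform_weight:
  assumes "finite V"
  shows "qform V E y = weight y (pairs V E) / 2"
proof -
  have "pairs V E = Sigma V (nbs V E)" by (auto simp: pairs_def nbs_def)
  then show ?thesis using assms by (simp add: qform_def weight_def sum.Sigma)
qed

lemma weight_nonneg: "0 \<le> weight y R"
  unfolding weight_def by (intro sum_nonneg) auto

lemma weight_mono: "finite R \<Longrightarrow> S \<subseteq> R \<Longrightarrow> weight y S \<le> weight y R"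
  unfolding weight_def by (intro sum_mono2) auto

lemma weight_Un: "finite R \<Longrightarrow> finite S \<Longrightarrow> weight y (R \<union> S) \<le> weight y R + weight y S"
  using weight_nonneg[of y "R \<inter> S"] sum.union_inter[of R S "\<lambda>(u, v). (y u + y v)\<^sup>2"] by (simp add: weight_def)

lemma weight_Un_disjoint: "finite R \<Longrightarrow> finite S \<Longrightarrow> R \<inter> S = {} \<Longrightarrow> weight y (R \<union> S) = weight y R + weight y S"
  unfolding weight_def by (rule sum.union_disjoint)

lemma weight_converse: "weight y (R\<inverse>) = weight y R"
proof -
  have "weight y (R\<inverse>) = (\<Sum>p\<in>prod.swap ` R. case p of (u, v) \<Rightarrow> (y u + y v)\<^sup>2)"
    unfolding weight_def by (intro sum.cong) auto
  also have "\<dots> = weight y R"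
    unfolding weight_def by (subst sum.reindex) (auto intro!: sum.cong simp: add.commute)
  finally show ?thesis .
qed

lemma weight_le_card:
  assumes "\<And>u v. (u, v) \<in> R \<Longrightarrow> y u \<le> b \<and> y v \<le> b \<and> 0 \<le> y u \<and> 0 \<le> y v"
  shows "weight y R \<le> (2 * b)\<^sup>2 * card R"
proof -
  have "weight y R \<le> (\<Sum>p\<in>R. (2 * b)\<^sup>2)"
    unfolding weight_def
  proof (intro sum_mono)
    fix p assume p: "p \<in> R"
    obtain u v where uv: "p = (u, v)" by (cases p)
    have "(y u + y v)\<^sup>2 \<le> (2 * b)\<^sup>2" by (rule power_mono) (use assms[of u v] p uv in auto)
    then show "(case p of (u, v) \<Rightarrow> (y u + y v)\<^sup>2) \<le> (2 * b)\<^sup>2" using uv by simp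
  qed
  then show ?thesis by (simp add: mult.commute)
qed

lemma weight_ge_card:
  fixes c :: real
  assumes "\<And>u v. (u, v) \<in> R \<Longrightarrow> c \<le> (y u + y v)\<^sup>2"
  shows "c * card R \<le> weight y R"
proof -
  have "(\<Sum>p\<in>R. c) \<le> weight y R"
    unfolding weight_def by (intro sum_mono) (use assms in auto)
  then show ?thesis by (simp add: mult.commute)
qed

text \<open>
  The common edges cancel in the comparison of the two forms at the same vector.
\<close>

lemma qform_less_by_exchange:
  assumes "finite V" "weight y (pairs V E - pairs V E') < weight y (pairs V E' - pairs V E)"
  shows "qform V E y < qform V E' y"
proof -
  have split: "weight y (pairs V F) = weight y (pairs V F \<inter> pairs V F') + weight y (pairs V F - pairs V F')" for F F'
  proof -
    have "weight y ((pairs V F \<inter> pairs V F') \<union> (pairs V F - pairs V F')) = weight y (pairs V F \<inter> pairs V F') + weight y (pairs V F - pairs V F')"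
      using finite_pairs[OF assms(1), of F] by (intro weight_Un_disjoint) auto
    then show ?thesis by (simp only: Int_Diff_Un)
  qed
  show ?thesis
    using split[of E E'] split[of E' E] assms(2)
    by (simp add: qform_weight[OF assms(1)] Int_commute)
qed

context near_partite
begin

lemma card_missing: "card (\<Union>j<r. A j - nbs (A j) E w) = (\<Sum>j<r. card (A j - nbs (A j) E w))"
proof (rule card_UN_disjoint)
  show "\<forall>i\<in>{..<r}. \<forall>j\<in>{..<r}. i \<noteq> j \<longrightarrow> (A i - nbs (A i) E w) \<inter> (A j - nbs (A j) E w) = {}"
    using Adisj by (meson Diff_subset Int_mono disjoint_iff lessThan_iff subset_iff)
qed (use finA in auto)

text \<open>
  Let \<open>W\<close> be the set of dominators. Internal edges are the only edges lost when the home classes are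
  made independent, and their total weight is a small multiple of \<open>n\<close>.

  If \<open>card W < t - 1\<close>, vertices of \<open>A 0\<close> are added to the clique; one of them alone gains nearly
  \<open>n / r\<close> new edges.

  If \<open>card W = t - 1\<close>, take \<open>T = W\<close>. Either there is an internal edge, and then linearly many edges at
  \<open>W\<close> are gained by \<open>internal_edge_forces_missing\<close>; or nothing is lost, and the form grows unless the
  graphs agree.

  If \<open>card W \<ge> t\<close>, keep \<open>t - 1\<close> dominators in \<open>T\<close>, among them all those outside the set \<open>U\<close> of
  \<open>dominators_weight\<close>, and move the other ones, \<open>D\<close>, into colour class \<open>0\<close>. With \<open>a w = (1 + y w)\<^sup>2\<close> and
  \<open>S\<close> the total of \<open>a\<close> over \<open>D\<close>, the loss is at most about \<open>n S / r \<le> (1/r) (1 - 1/r) n Z\<close> and the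
  gain about \<open>(1/r) n Z\<close>. The difference \<open>n Z / r\<^sup>2\<close> exceeds all error terms.
\<close>

lemma exchange:
  fixes \<beta> \<delta> :: real and K :: nat and y :: "'a \<Rightarrow> real"
  assumes \<beta>: "\<gamma> \<le> \<beta>" "1000 * t * r * r * r * \<beta> \<le> 1" "2 * s \<le> \<beta> * n"
    and K: "t \<le> (\<beta> / 2) ^ r * K" "4 * r * s * \<gamma> \<le> \<beta> / 2 ^ (K + 2)"
    and \<delta>: "0 \<le> \<delta>" "\<delta> \<le> \<gamma>"
    and y: "\<And>v. v \<in> V \<Longrightarrow> 0 \<le> y v" "\<And>v. v \<in> V \<Longrightarrow> y v \<le> 4" "sqnorm V y = n" "\<And>v. v \<in> V \<Longrightarrow> 1 - \<delta> \<le> (y v)\<^sup>2"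
  shows "\<exists>T h. T \<subseteq> V \<and> card T = t - 1 \<and> (\<forall>v\<in>V - T. h v < r) \<and>
    (qform V E y < qform V (coloured_join T h) y \<or> (\<forall>u\<in>V. \<forall>v\<in>V. E u v \<longleftrightarrow> coloured_join T h u v))"
proof -
  \<comment> \<open>All error terms are compared with \<open>\<rho>\<^sup>2\<close>, the order of the final gain.\<close>
  define \<rho> where "\<rho> = 1 / real r"
  have \<rho>: "0 < \<rho>" "\<rho> \<le> 1 / 3" using r by (auto simp: \<rho>_def field_simps)
  have \<beta>0: "\<beta> > 0" using \<beta>(1) \<gamma>(1) by linarith
  have t\<beta>: "1000 * (t * r * \<beta>) \<le> \<rho>\<^sup>2"
  proof -
    have "(1000 * (t * r * \<beta>)) * (real r * r) \<le> 1" using \<beta>(2) by (simp add: mult_ac)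
    then show ?thesis using r by (simp add: \<rho>_def power2_eq_square field_simps)
  qed
  have \<rho>2: "\<rho>\<^sup>2 \<le> \<rho> / 3" using \<rho> mult_left_mono[of \<rho> "1/3" \<rho>] by (simp add: power2_eq_square)
  have \<gamma>\<rho>: "200 * \<gamma> \<le> \<rho>\<^sup>2"
    using gamma_bounds(2) r by (simp add: \<rho>_def power2_eq_square field_simps)
  have \<beta>\<rho>: "1000 * \<beta> \<le> \<rho>\<^sup>2"
  proof -
    have "0 < t * r" using t r by simp
    then have "1 \<le> t * r" by linarith
    then have "real 1 \<le> real (t * r)" by (rule of_nat_mono)
    then have "1 * \<beta> \<le> real (t * r) * \<beta>" using \<beta>0 by (intro mult_right_mono) auto
    then show ?thesis using t\<beta> by simp
  qed
  have "16 * (t * r * \<beta>) \<le> 1" using t\<beta> \<rho>2 \<rho> by linarith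
  then have \<beta>16: "16 * t * r * \<beta> \<le> 1" by simp
  define W where "W = dominators \<beta>"
  have WV: "W \<subseteq> V" by (auto simp: W_def dominators_def)
  have fW: "finite W" using WV fin by (rule finite_subset)
  have WK: "card W < K" unfolding W_def by (rule dominators_bounded[OF \<beta>0 \<beta>(3) K])
  obtain h where h: "home \<beta> h" using home_exists[OF \<beta>0] by auto
  define I where "I = internal \<beta> h"
  have IV: "I \<subseteq> V \<times> V" by (auto simp: I_def internal_def)
  have fI: "finite I" by (rule finite_subset[OF IV]) (use fin in auto)
  have wle: "weight y R \<le> 64 * real (card R)" if "R \<subseteq> V \<times> V" for R
    using weight_le_card[of R y 4] y(1,2) that by (auto simp: power2_eq_square)
  have y34: "7 / 8 \<le> y v" if "v \<in> V" for v
  proof -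
    have "\<delta> \<le> 1 / 100" using \<delta> \<gamma>\<rho> \<rho>2 \<rho> by linarith
    then have "(7/8)\<^sup>2 \<le> (y v)\<^sup>2" using y(4)[OF that] by (simp add: power_divide)
    then show ?thesis using y(1)[OF that] by (rule power2_le_imp_le)
  qed
  have wge: "3 * real (card R) \<le> weight y R" if "R \<subseteq> V \<times> V" for R
  proof (rule weight_ge_card)
    fix u v assume "(u, v) \<in> R"
    then have "7/4 \<le> y u + y v" using that y34[of u] y34[of v] by auto
    then have "(7/4)\<^sup>2 \<le> (y u + y v)\<^sup>2" by (intro power_mono) auto
    then show "3 \<le> (y u + y v)\<^sup>2" by (simp add: power2_eq_square)
  qed
  have wI: "weight y I < 4/5 * \<rho>\<^sup>2 * n"
  proof -
    have "real (card I) \<le> 8 * (t * r * \<beta>) * n" using card_internal[OF h \<beta>(1) \<beta>16] by (simp add: I_def)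
    also have "\<dots> \<le> 8 * (\<rho>\<^sup>2 / 1000) * n" using t\<beta> n0 by (intro mult_right_mono) auto
    finally have "64 * real (card I) \<le> 64 * (8 * (\<rho>\<^sup>2 / 1000)) * n" by (simp add: mult_ac)
    moreover have "64 * (8 * (\<rho>\<^sup>2 / 1000)) * n < 4/5 * \<rho>\<^sup>2 * n" using \<rho> n0 by simp
    ultimately show ?thesis using wle[OF IV] by linarith
  qed
  have hV: "h v < r" if "v \<in> V - W" for v using h that by (auto simp: home_def W_def)
  have hA: "h v = i" if "i < r" "v \<in> A i" for v i using h that by (auto simp: home_def)
  have AW: "v \<notin> W" if "i < r" "v \<in> A i" for v i using A_not_dominators[OF that \<beta>0] by (simp add: W_def)
  have Esym: "E u v \<Longrightarrow> E v u" for u v by (rule sgraphD(2)[OF G])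
  have Eirr: "\<not> E u u" for u by (rule sgraphD(3)[OF G])
  have sub_I: "pairs V E - pairs V (coloured_join T h) \<subseteq> I" if "W \<subseteq> T" for T
    using that Eirr by (auto simp: pairs_def coloured_join_def I_def internal_def W_def)
  have r0: "0 < r" using r by simp
  have s\<gamma>: "1 \<le> \<gamma> * n" using sn s2 by linarith
  consider "card W < t - 1" | "card W = t - 1" | "t \<le> card W" using t by linarith
  then show ?thesis
  proof cases
    case 1
    have "t \<le> card (A 0)" using A_large[OF r0] st by linarith
    then have "t - 1 - card W \<le> card (A 0)" by linarith
    then obtain X where X: "X \<subseteq> A 0" "card X = t - 1 - card W" "finite X" by (rule obtain_subset_with_card_n)
    define T where "T = W \<union> X"
    have "W \<inter> X = {}" using AW[OF r0] X(1) by auto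
    then have cT: "card T = t - 1" using fW X 1 by (simp add: T_def card_Un_disjoint)
    have TV: "T \<subseteq> V" using WV X(1) AV[OF r0] by (auto simp: T_def)
    have "X \<noteq> {}" using X(2) 1 by auto
    then obtain x where x: "x \<in> X" by auto
    \<comment> \<open>The pairs between the new clique vertex and its independent part, in one direction only.\<close>
    define Gn where "Gn = {x} \<times> (A 0 - {x})"
    have GV: "Gn \<subseteq> V \<times> V" using x X(1) AV[OF r0] by (auto simp: Gn_def)
    have "Gn \<subseteq> pairs V (coloured_join T h) - pairs V E"
      using GV x X(1) Aind[OF r0] by (auto simp: Gn_def pairs_def coloured_join_def T_def)
    then have "weight y Gn \<le> weight y (pairs V (coloured_join T h) - pairs V E)"
      using finite_pairs[OF fin] by (intro weight_mono) auto
    moreover have "\<rho> * n \<le> weight y Gn"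
    proof -
      have "card Gn = card (A 0) - 1" using x X(1) by (auto simp: Gn_def card_cartesian_product)
      then have "real (card (A 0)) - 1 \<le> card Gn" by linarith
      moreover have "(\<rho> - \<gamma>) * n \<le> card (A 0)" using Alow[OF r0] by (simp add: \<rho>_def)
      ultimately have "\<rho> * n - 2 * (\<gamma> * n) \<le> card Gn" using s\<gamma> by (simp add: algebra_simps)
      moreover have "\<gamma> * n \<le> \<rho> / 600 * n" using \<gamma>\<rho> \<rho>2 n0 by (intro mult_right_mono) auto
      moreover have "\<rho> * n > 0" using \<rho> n0 by simp
      ultimately have "\<rho> * n \<le> 3 * real (card Gn)" by (simp add: field_simps)
      then show ?thesis using wge[OF GV] by linarith
    qed
    moreover have "weight y (pairs V E - pairs V (coloured_join T h)) \<le> weight y I"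
      by (intro weight_mono fI sub_I) (auto simp: T_def)
    moreover have "4/5 * \<rho>\<^sup>2 * n \<le> \<rho> * n" using \<rho>2 \<rho> n0 by (intro mult_right_mono) auto
    ultimately have "qform V E y < qform V (coloured_join T h) y"
      using wI by (intro qform_less_by_exchange[OF fin]) linarith
    moreover have "\<forall>v\<in>V - T. h v < r" using hV by (auto simp: T_def)
    ultimately show ?thesis using TV cT by blast
  next
    case 2
    define Gn where "Gn = Sigma W (\<lambda>w. \<Union>j<r. A j - nbs (A j) E w)"
    have GV: "Gn \<subseteq> V \<times> V" using WV AV by (auto simp: Gn_def)
    have sub: "Gn \<subseteq> pairs V (coloured_join W h) - pairs V E"
      using GV AW by (auto simp: Gn_def pairs_def coloured_join_def nbs_def)
    have cG: "real (card Gn) = (\<Sum>w\<in>W. \<Sum>j<r. real (card (A j - nbs (A j) E w)))"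
    proof -
      show ?thesis unfolding Gn_def using fW finA by (simp add: card_missing)
    qed
    have less: ?thesis if "weight y (pairs V E - pairs V (coloured_join W h)) < weight y (pairs V (coloured_join W h) - pairs V E)"
      using qform_less_by_exchange[OF fin that] WV 2 hV by blast
    show ?thesis
    proof (cases "I = {}")
      case False
      then obtain u v where "(u, v) \<in> internal \<beta> h" by (auto simp: I_def)
      from internal_edge_forces_missing[OF h \<beta>(3) \<beta>0 \<beta>16 2[unfolded W_def] this]
      have "\<rho> / 2 * n \<le> card Gn" unfolding cG by (simp add: W_def \<rho>_def)
      moreover have "weight y Gn \<le> weight y (pairs V (coloured_join W h) - pairs V E)"
        using finite_pairs[OF fin] sub by (intro weight_mono) auto
      moreover have "weight y (pairs V E - pairs V (coloured_join W h)) \<le> weight y I"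
        by (intro weight_mono fI sub_I) auto
      moreover have "4/5 * \<rho>\<^sup>2 * n \<le> \<rho> / 2 * n" using \<rho>2 \<rho> n0 by (intro mult_right_mono) auto
      moreover have "0 < \<rho> / 2 * n" using \<rho> n0 by simp
      ultimately show ?thesis using wI wge[OF GV] by (intro less) linarith
    next
      case True
      then have sub1: "pairs V E \<subseteq> pairs V (coloured_join W h)" using sub_I[of W] by auto
      show ?thesis
      proof (cases "pairs V (coloured_join W h) - pairs V E = {}")
        case True
        then have "pairs V E = pairs V (coloured_join W h)" using sub1 by auto
        then have "\<forall>u\<in>V. \<forall>v\<in>V. E u v \<longleftrightarrow> coloured_join W h u v" by (auto simp: pairs_def)
        then show ?thesis using WV 2 hV by blast
      next
        case False
        define R where "R = pairs V (coloured_join W h) - pairs V E"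
        have "finite R" "R \<noteq> {}" "R \<subseteq> V \<times> V" using False finite_pairs[OF fin] by (auto simp: R_def pairs_def)
        then have "0 < card R" by (simp add: card_gt_0_iff)
        moreover have "3 * real (card R) \<le> weight y R" using \<open>R \<subseteq> V \<times> V\<close> by (rule wge)
        ultimately have "0 < weight y R" by linarith
        moreover have "weight y (pairs V E - pairs V (coloured_join W h)) = 0"
          unfolding Diff_eq_empty_iff[THEN iffD2, OF sub1] by (simp add: weight_def)
        ultimately show ?thesis by (intro less) (simp add: R_def)
      qed
    qed
  next
    case 3
    define a where "a = (\<lambda>w. (1 + y w)\<^sup>2)"
    have a0: "a w \<ge> 0" for w by (simp add: a_def)
    have a1: "a w \<ge> 1" if "w \<in> V" for w using power_mono[of 1 "1 + y w" 2] y(1)[OF that] by (simp add: a_def)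
    define c where "c = \<beta> / 2 ^ (K + 2)"
    have Kc: "2 ^ K * c = \<beta> / 4" by (simp add: c_def power_add)
    have \<omega>: "2 ^ K * c < 1 / r - \<gamma>"
    proof -
      have "\<beta> / 4 < \<rho> - \<gamma>" using \<beta>\<rho> \<gamma>\<rho> \<rho>2 \<rho> by linarith
      then show ?thesis by (simp add: Kc \<rho>_def)
    qed
    obtain U Z where U: "U \<subseteq> W" "card (W - U) < t" "r * (\<Sum>w\<in>U. a w) \<le> (real r - 1) * Z"
      "(1 / r - \<gamma> - 2 ^ K * c) * n * Z \<le> (\<Sum>w\<in>W. a w * (\<Sum>j<r. real (card (A j - nbs (A j) E w))))"
      using dominators_weight[OF \<beta>(3) less_imp_le[OF WK[unfolded W_def]] K(2)[folded c_def] \<omega>, of a] a0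
      unfolding W_def by blast
    have "\<exists>T. W - U \<subseteq> T \<and> T \<subseteq> W \<and> card T = t - 1"
      by (rule exists_subset_between) (use U(2) 3 fW in auto)
    then obtain T where T: "W - U \<subseteq> T" "T \<subseteq> W" "card T = t - 1" by auto
    define D where "D = W - T"
    have DU: "D \<subseteq> U" "D \<subseteq> W" "finite D" using T fW by (auto simp: D_def)
    have "D \<noteq> {}" using T 3 t by (auto simp: D_def)
    define S where "S = (\<Sum>w\<in>D. a w)"
    have S1: "S \<ge> card D" using sum_mono[of D "\<lambda>_. 1" a] a1 DU WV by (auto simp: S_def)
    moreover have "0 < card D" using \<open>D \<noteq> {}\<close> DU(3) by (simp add: card_gt_0_iff)
    ultimately have S1': "S \<ge> 1" by linarith
    have SZ: "S \<le> (1 - \<rho>) * Z"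
    proof -
      have "S \<le> (\<Sum>w\<in>U. a w)" unfolding S_def using DU(1) U(1) fW a0 by (intro sum_mono2) (auto intro: finite_subset)
      then have "r * S \<le> r * (\<Sum>w\<in>U. a w)" by (intro mult_left_mono) auto
      then have "r * S \<le> (real r - 1) * Z" using U(3) by linarith
      then show ?thesis using r by (simp add: \<rho>_def field_simps)
    qed
    have Z0: "Z \<ge> 1"
    proof -
      have "1 \<le> (1 - \<rho>) * Z" using SZ S1' by linarith
      moreover have "(1 - \<rho>) > 0" "1 - \<rho> \<le> 1" using \<rho> by auto
      moreover have "Z > 0"
      proof (rule ccontr)
        assume "\<not> Z > 0"
        then have "(1 - \<rho>) * Z \<le> 0" using \<rho> by (intro mult_nonneg_nonpos) auto
        then show False using \<open>1 \<le> (1 - \<rho>) * Z\<close> by linarith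
      qed
      ultimately have "(1 - \<rho>) * Z \<le> 1 * Z" using \<rho> by (intro mult_right_mono) auto
      then show ?thesis using \<open>1 \<le> (1 - \<rho>) * Z\<close> by linarith
    qed
    \<comment> \<open>All dominators receive colour \<open>0\<close>; this matters only for those in \<open>D\<close>.\<close>
    define h' where "h' = (\<lambda>v. if v \<in> W then 0 else h v)"
    define R where "R = V - (\<Union>i<r. A i)"
    define MS where "MS = Sigma W (\<lambda>w. \<Union>j<r. A j - nbs (A j) E w)"
    define M0 where "M0 = Sigma D (\<lambda>w. A 0 - nbs (A 0) E w)"
    define L0 where "L0 = Sigma D (\<lambda>w. nbs (A 0) E w)"
    define G1 where "G1 = MS - M0"
    have M0MS: "M0 \<subseteq> MS" using DU(2) r0 by (auto simp: M0_def MS_def)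
    have MSV: "MS \<subseteq> V \<times> V" using WV AV by (auto simp: MS_def)
    have DV: "D \<subseteq> V" using DU WV by auto
    have finVV: "finite (V \<times> V)" using fin by simp
    have LV: "L0 \<subseteq> V \<times> V" "D \<times> R \<subseteq> V \<times> V" "M0 \<subseteq> V \<times> V" "G1 \<subseteq> V \<times> V" "D \<times> A 0 \<subseteq> V \<times> V"
      using DV AV[OF r0] MSV by (auto simp: L0_def R_def M0_def G1_def nbs_def)
    note fs = finite_subset[OF LV(1) finVV] finite_subset[OF LV(2) finVV] finite_subset[OF LV(3) finVV] finite_subset[OF LV(4) finVV]
      finite_subset[OF MSV finVV] finite_subset[OF LV(5) finVV]
    \<comment> \<open>\<open>MS\<close> are the pairs missing between \<open>W\<close> and the parts, \<open>M0\<close> those of them that stay missing, \<open>L0\<close> the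
      edges lost between \<open>D\<close> and \<open>A 0\<close>. Since \<open>L0\<close> and \<open>M0\<close> together make up \<open>D \<times> A 0\<close>, moving \<open>M0\<close> to
      the other side of the comparison leaves all of \<open>D \<times> A 0\<close> against all of \<open>MS\<close>.\<close>
    have lost: "pairs V E - pairs V (coloured_join T h') \<subseteq> (I \<union> (L0 \<union> L0\<inverse>)) \<union> (D \<times> R \<union> (D \<times> R)\<inverse>)"
    proof
      fix p assume p: "p \<in> pairs V E - pairs V (coloured_join T h')"
      obtain u v where uv: "p = (u, v)" by (cases p)
      have e: "u \<in> V" "v \<in> V" "E u v" "u \<notin> T" "v \<notin> T" "h' u = h' v" "E v u"
        using p uv Eirr Esym by (auto simp: pairs_def coloured_join_def)
      have key: "b \<in> nbs (A 0) E a \<or> b \<in> R" if "a \<in> D" "b \<in> V" "E a b" "h' b = 0" for a b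
      proof (cases "b \<in> R")
        case False
        then obtain j where j: "j < r" "b \<in> A j" using \<open>b \<in> V\<close> by (auto simp: R_def)
        then have "h' b = j" using hA AW by (auto simp: h'_def)
        then show ?thesis using j that by (auto simp: nbs_def)
      qed simp
      show "p \<in> (I \<union> (L0 \<union> L0\<inverse>)) \<union> (D \<times> R \<union> (D \<times> R)\<inverse>)"
      proof (cases "u \<in> W")
        case True
        then have "u \<in> D" "h' v = 0" using e by (auto simp: D_def h'_def)
        from key[OF this(1) e(2,3) this(2)] show ?thesis using \<open>u \<in> D\<close> uv by (auto simp: L0_def)
      next
        case uW: False
        show ?thesis
        proof (cases "v \<in> W")
          case True
          then have "v \<in> D" "h' u = 0" using e by (auto simp: D_def h'_def)
          from key[OF this(1) e(1,7) this(2)] show ?thesis using \<open>v \<in> D\<close> uv by (auto simp: L0_def)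
        next
          case False
          then show ?thesis using e uW uv by (auto simp: I_def internal_def h'_def W_def)
        qed
      qed
    qed
    have won: "G1 \<union> G1\<inverse> \<subseteq> pairs V (coloured_join T h') - pairs V E"
    proof -
      have "(w, p) \<in> pairs V (coloured_join T h') - pairs V E \<and> (p, w) \<in> pairs V (coloured_join T h') - pairs V E"
        if wp: "(w, p) \<in> G1" for w p
      proof -
        obtain j where j: "j < r" "p \<in> A j" "\<not> E w p" "w \<in> W" using wp by (auto simp: G1_def MS_def nbs_def)
        have "w \<in> V" "p \<in> V" using j WV AV by auto
        moreover have "w \<noteq> p" using AW j by auto
        moreover have "w \<in> T \<or> h' w \<noteq> h' p"
        proof (cases "w \<in> T")
          case False
          then have "w \<in> D" using j by (simp add: D_def)
          have "j \<noteq> 0"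
          proof
            assume "j = 0"
            then have "(w, p) \<in> M0" using \<open>w \<in> D\<close> j by (auto simp: M0_def nbs_def)
            then show False using wp by (simp add: G1_def)
          qed
          moreover have "h' p = j" using hA[OF j(1,2)] AW[OF j(1,2)] by (simp add: h'_def)
          ultimately show ?thesis using j by (simp add: h'_def)
        qed simp
        ultimately show ?thesis using j(3) Esym by (auto simp: pairs_def coloured_join_def)
      qed
      then show ?thesis by auto
    qed
    have disj: "G1 \<inter> G1\<inverse> = {}" using AW by (auto simp: G1_def MS_def)
    have "weight y G1 + weight y G1 = weight y (G1 \<union> G1\<inverse>)"
      using weight_Un_disjoint[OF fs(4) _ disj, of y] fs(4) by (simp add: weight_converse)
    also have "\<dots> \<le> weight y (pairs V (coloured_join T h') - pairs V E)"
      using won finite_pairs[OF fin] by (intro weight_mono) auto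
    finally have W1: "2 * weight y G1 \<le> weight y (pairs V (coloured_join T h') - pairs V E)" by simp
    have W2: "weight y MS = weight y G1 + weight y M0"
    proof -
      have "weight y (G1 \<union> M0) = weight y G1 + weight y M0"
        by (rule weight_Un_disjoint) (use fs in \<open>auto simp: G1_def\<close>)
      moreover have "G1 \<union> M0 = MS" using M0MS by (auto simp: G1_def)
      ultimately show ?thesis by simp
    qed
    have W3: "weight y L0 + weight y M0 = weight y (D \<times> A 0)"
    proof -
      have "L0 \<union> M0 = D \<times> A 0" "L0 \<inter> M0 = {}" by (auto simp: L0_def M0_def nbs_def)
      then show ?thesis using weight_Un_disjoint[of L0 M0 y] fs by simp
    qed
    have W4: "weight y (pairs V E - pairs V (coloured_join T h')) \<le> weight y I + 2 * weight y L0 + 2 * weight y (D \<times> R)"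
    proof -
      have "weight y (pairs V E - pairs V (coloured_join T h')) \<le> weight y ((I \<union> (L0 \<union> L0\<inverse>)) \<union> (D \<times> R \<union> (D \<times> R)\<inverse>))"
        using lost fI fs by (intro weight_mono) auto
      moreover have "weight y ((I \<union> (L0 \<union> L0\<inverse>)) \<union> (D \<times> R \<union> (D \<times> R)\<inverse>))
          \<le> weight y (I \<union> (L0 \<union> L0\<inverse>)) + weight y (D \<times> R \<union> (D \<times> R)\<inverse>)"
        using fI fs by (intro weight_Un) auto
      moreover have "weight y (I \<union> (L0 \<union> L0\<inverse>)) \<le> weight y I + weight y (L0 \<union> L0\<inverse>)"
        using fI fs by (intro weight_Un) auto
      moreover have "weight y (L0 \<union> L0\<inverse>) \<le> weight y L0 + weight y (L0\<inverse>)" using fs by (intro weight_Un) auto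
      moreover have "weight y (D \<times> R \<union> (D \<times> R)\<inverse>) \<le> weight y (D \<times> R) + weight y ((D \<times> R)\<inverse>)" using fs by (intro weight_Un) auto
      ultimately show ?thesis unfolding weight_converse by linarith
    qed
    have W5: "weight y (D \<times> R) \<le> 64 * \<gamma> * n * S"
    proof -
      have "weight y (D \<times> R) \<le> 64 * real (card (D \<times> R))" using LV by (intro wle) auto
      also have "\<dots> = 64 * (real (card D) * card R)" by (simp add: card_cartesian_product)
      also have "\<dots> \<le> 64 * (S * (\<gamma> * n))" using S1 S1' rest by (intro mult_left_mono mult_mono) (auto simp: R_def)
      finally show ?thesis by (simp add: mult_ac)
    qed
    have W6: "weight y (D \<times> A 0) \<le> (\<rho> + \<gamma> + \<delta>) * n * S"
    proof -
      have sqA: "(\<Sum>p\<in>A 0. (y p)\<^sup>2) \<le> card (A 0) + \<delta> * n"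
      proof -
        have "(\<Sum>p\<in>V - A 0. 1 - \<delta>) \<le> (\<Sum>p\<in>V - A 0. (y p)\<^sup>2)" by (intro sum_mono) (use y(4) in auto)
        also have "\<dots> = n - (\<Sum>p\<in>A 0. (y p)\<^sup>2)" using y(3) AV[OF r0] fin by (simp add: sqnorm_def sum_diff)
        finally have "(\<Sum>p\<in>A 0. (y p)\<^sup>2) \<le> n - (n - card (A 0)) * (1 - \<delta>)"
          using AV[OF r0] fin card_mono[OF fin AV[OF r0]] by (simp add: card_Diff_subset finite_subset of_nat_diff)
        also have "\<dots> = card (A 0) + \<delta> * n - \<delta> * card (A 0)" by (simp add: algebra_simps)
        also have "\<dots> \<le> card (A 0) + \<delta> * n" using \<delta>(1) by simp
        finally show ?thesis .
      qed
      have "weight y (D \<times> A 0) = (\<Sum>u\<in>D. \<Sum>p\<in>A 0. (y u + y p)\<^sup>2)"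
        unfolding weight_def using DU(3) finA[OF r0] by (simp add: sum.cartesian_product)
      also have "\<dots> \<le> (\<Sum>u\<in>D. a u * ((\<rho> + \<gamma> + \<delta>) * n))"
      proof (intro sum_mono)
        fix u assume "u \<in> D"
        then have yu: "0 \<le> y u" using y(1) DV by auto
        \<comment> \<open>Linear in \<open>(y p)\<^sup>2\<close> and exact at \<open>y p = 1\<close>, so that summation over \<open>A 0\<close> produces
          \<open>(1 + y u)\<^sup>2 = a u\<close> times the order of \<open>A 0\<close>.\<close>
        have pt: "(y u + y p)\<^sup>2 \<le> ((y u)\<^sup>2 + y u) + (y u + 1) * (y p)\<^sup>2" for p
        proof -
          have "0 \<le> y u * (y p - 1)\<^sup>2" using yu by simp
          then show ?thesis by (simp add: power2_eq_square algebra_simps)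
        qed
        have "(\<Sum>p\<in>A 0. (y u + y p)\<^sup>2) \<le> (\<Sum>p\<in>A 0. ((y u)\<^sup>2 + y u) + (y u + 1) * (y p)\<^sup>2)" by (intro sum_mono pt)
        also have "\<dots> = card (A 0) * ((y u)\<^sup>2 + y u) + (y u + 1) * (\<Sum>p\<in>A 0. (y p)\<^sup>2)"
          by (simp add: sum.distrib sum_distrib_left)
        also have "\<dots> \<le> card (A 0) * ((y u)\<^sup>2 + y u) + (y u + 1) * (card (A 0) + \<delta> * n)"
          using sqA yu by (intro add_left_mono mult_left_mono) auto
        also have "\<dots> = a u * card (A 0) + (y u + 1) * (\<delta> * n)" by (simp add: a_def power2_eq_square algebra_simps)
        also have "\<dots> \<le> a u * card (A 0) + a u * (\<delta> * n)"
          using yu \<delta>(1) n0 by (intro add_left_mono mult_right_mono) (auto simp: a_def power2_eq_square algebra_simps)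
        also have "\<dots> \<le> a u * ((\<rho> + \<gamma>) * n) + a u * (\<delta> * n)"
          using Aup[OF r0] a0 by (intro add_right_mono mult_left_mono) (auto simp: \<rho>_def)
        finally show "(\<Sum>p\<in>A 0. (y u + y p)\<^sup>2) \<le> a u * ((\<rho> + \<gamma> + \<delta>) * n)" by (simp add: algebra_simps)
      qed
      also have "\<dots> = (\<rho> + \<gamma> + \<delta>) * n * S" by (simp add: S_def mult_ac flip: sum_distrib_left sum_distrib_right)
      finally show ?thesis .
    qed
    have W7: "(1 - \<delta>) * ((\<rho> - \<gamma> - \<beta> / 4) * n * Z) \<le> weight y MS"
    proof -
      have fu: "finite (\<Union>j<r. A j - nbs (A j) E w)" for w using finA by auto
      have "(1 - \<delta>) * ((\<rho> - \<gamma> - \<beta> / 4) * n * Z) \<le> (1 - \<delta>) * (\<Sum>w\<in>W. a w * (\<Sum>j<r. real (card (A j - nbs (A j) E w))))"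
      proof (rule mult_left_mono)
        show "(\<rho> - \<gamma> - \<beta> / 4) * n * Z \<le> (\<Sum>w\<in>W. a w * (\<Sum>j<r. real (card (A j - nbs (A j) E w))))"
          using U(4) unfolding Kc by (simp add: \<rho>_def)
        show "0 \<le> 1 - \<delta>" using \<delta> \<gamma>\<rho> \<rho>2 \<rho> by linarith
      qed
      also have "\<dots> = (\<Sum>w\<in>W. \<Sum>p\<in>(\<Union>j<r. A j - nbs (A j) E w). (1 - \<delta>) * a w)"
        by (simp add: card_missing sum_distrib_left mult_ac flip: of_nat_sum)
      also have "\<dots> \<le> (\<Sum>w\<in>W. \<Sum>p\<in>(\<Union>j<r. A j - nbs (A j) E w). (y w + y p)\<^sup>2)"
      proof (intro sum_mono)
        fix w p assume wp: "w \<in> W" "p \<in> (\<Union>j<r. A j - nbs (A j) E w)"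
        have yw: "0 \<le> y w" using wp WV y(1) by auto
        have pV: "p \<in> V" using wp AV by auto
        define \<sigma> where "\<sigma> = sqrt (1 - \<delta>)"
        have d1: "\<delta> \<le> 1" using \<delta> \<gamma>\<rho> \<rho>2 \<rho> by linarith
        have \<sigma>: "0 \<le> \<sigma>" "\<sigma> \<le> 1" "\<sigma>\<^sup>2 = 1 - \<delta>" using \<delta>(1) d1 by (auto simp: \<sigma>_def)
        have "\<sigma>\<^sup>2 \<le> (y p)\<^sup>2" using y(4)[OF pV] \<sigma>(3) by simp
        then have "\<sigma> \<le> y p" using y(1)[OF pV] by (rule power2_le_imp_le)
        moreover have "\<sigma> * y w \<le> 1 * y w" using \<sigma> yw by (intro mult_right_mono) auto
        ultimately have "\<sigma> * (1 + y w) \<le> y w + y p" by (simp add: algebra_simps)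
        then have "(\<sigma> * (1 + y w))\<^sup>2 \<le> (y w + y p)\<^sup>2" using \<sigma> yw by (intro power_mono) auto
        then show "(1 - \<delta>) * a w \<le> (y w + y p)\<^sup>2" by (simp add: power_mult_distrib \<sigma>(3) a_def)
      qed
      also have "\<dots> = weight y MS" unfolding weight_def MS_def using fW fu by (simp add: sum.Sigma)
      finally show ?thesis .
    qed
    have "weight y I + 2 * weight y (D \<times> A 0) + 2 * weight y (D \<times> R) < 2 * weight y MS"
    proof -
      define g where "g = \<rho>\<^sup>2 / 200"
      have g: "0 < g" "\<gamma> \<le> g" "\<delta> \<le> g" "\<beta> \<le> g" using \<gamma>\<rho> \<delta> \<beta>\<rho> \<rho> \<beta>0 by (auto simp: g_def)
      have "(\<rho> + \<gamma> + \<delta>) * n * S + 64 * \<gamma> * n * S = (\<rho> + 65 * \<gamma> + \<delta>) * (n * S)" by (simp add: algebra_simps)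
      also have "\<dots> \<le> (\<rho> + 66 * g) * (n * ((1 - \<rho>) * Z))"
        using g SZ S1' n0 \<rho> \<gamma>(1) \<delta>(1) by (intro mult_mono mult_left_mono) auto
      also have "\<dots> = ((\<rho> + 66 * g) * (1 - \<rho>)) * (n * Z)" by simp
      also have "\<dots> \<le> (\<rho> - \<rho>\<^sup>2 + 66 * g) * (n * Z)"
        using n0 Z0 g(1) \<rho> by (intro mult_right_mono) (auto simp: power2_eq_square algebra_simps)
      finally have 1: "(\<rho> + \<gamma> + \<delta>) * n * S + 64 * \<gamma> * n * S \<le> (\<rho> - \<rho>\<^sup>2 + 66 * g) * (n * Z)" .
      have "(\<rho> - 3 * g) * (n * Z) \<le> ((1 - \<delta>) * (\<rho> - \<gamma> - \<beta> / 4)) * (n * Z)"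
      proof (intro mult_right_mono)
        define x where "x = \<rho> - \<gamma> - \<beta> / 4"
        have "\<delta> * x \<le> \<delta> * 1" using \<delta>(1) \<rho> \<gamma>(1) \<beta>0 by (intro mult_left_mono) (auto simp: x_def)
        then have "x - \<delta> \<le> (1 - \<delta>) * x" by (simp add: left_diff_distrib)
        then have "\<rho> - \<gamma> - \<beta> / 4 - \<delta> \<le> (1 - \<delta>) * (\<rho> - \<gamma> - \<beta> / 4)" by (simp only: x_def)
        then show "\<rho> - 3 * g \<le> (1 - \<delta>) * (\<rho> - \<gamma> - \<beta> / 4)" using g by linarith
      qed (use n0 Z0 in auto)
      then have 2: "(\<rho> - 3 * g) * (n * Z) \<le> weight y MS" using W7 by (simp add: mult_ac)
      have 3: "weight y I < 4/5 * \<rho>\<^sup>2 * (n * Z)"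
      proof -
        have "4/5 * \<rho>\<^sup>2 * n * 1 \<le> 4/5 * \<rho>\<^sup>2 * n * Z" using Z0 n0 by (intro mult_left_mono) auto
        then show ?thesis using wI by (simp add: mult_ac)
      qed
      have "2 * ((\<rho> - 3 * g) * (n * Z)) - 2 * ((\<rho> - \<rho>\<^sup>2 + 66 * g) * (n * Z)) = (2 * \<rho>\<^sup>2 - 138 * g) * (n * Z)"
        by (simp add: algebra_simps)
      also have "\<dots> \<ge> 4/5 * \<rho>\<^sup>2 * (n * Z)" using n0 Z0 \<rho> by (intro mult_right_mono) (auto simp: g_def)
      finally show ?thesis using 1 2 3 W5 W6 by linarith
    qed
    then have "qform V E y < qform V (coloured_join T h') y"
      using W1 W2 W3 W4 by (intro qform_less_by_exchange[OF fin]) linarith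
    moreover have "\<forall>v\<in>V - T. h' v < r" using hV r0 by (auto simp: h'_def)
    moreover have "T \<subseteq> V" using T WV by auto
    ultimately show ?thesis using T(3) by blast
  qed
qed

end

section \<open>Joins of a clique with a complete multipartite graph\<close>

definition colour_class :: "'a set \<Rightarrow> 'a set \<Rightarrow> ('a \<Rightarrow> nat) \<Rightarrow> nat \<Rightarrow> 'a set" where
  "colour_class V T h i = {v \<in> V - T. h v = i}"

text \<open>
  The secular function of the join of \<open>K\<^sub>k\<close> with the complete \<open>r\<close>-partite graph with parts of orders
  \<open>b i\<close>: on \<open>n\<close> vertices, \<open>n + c\<close> with \<open>c > 0\<close> is the largest eigenvalue if and only if the value at \<open>c\<close>
  is \<open>1\<close>.
\<close>

definition char_sum :: "nat \<Rightarrow> nat \<Rightarrow> (nat \<Rightarrow> nat) \<Rightarrow> real \<Rightarrow> real" where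
  "char_sum r k b c = k / (c + 2) + (\<Sum>i<r. b i / (c + 2 * b i))"

locale coloured =
  fixes V T :: "'a set" and h :: "'a \<Rightarrow> nat" and r :: nat
  assumes finV: "finite V" and TV: "T \<subseteq> V" and hr: "v \<in> V - T \<Longrightarrow> h v < r"
begin

abbreviation "E \<equiv> coloured_join T h"
abbreviation "B \<equiv> colour_class V T h"

lemma finT: "finite T" using TV finV by (rule finite_subset)

lemma finB: "finite (B i)" using finV by (simp add: colour_class_def)

lemma nbs_T: "v \<in> T \<Longrightarrow> nbs V E v = V - {v}"
  by (auto simp: nbs_def coloured_join_def)

lemma nbs_class: "v \<in> V - T \<Longrightarrow> nbs V E v = V - B (h v)"
  by (auto simp: nbs_def coloured_join_def colour_class_def)

lemma sum_classes: "(\<Sum>v\<in>V. f v) = (\<Sum>v\<in>T. f v) + (\<Sum>i<r. \<Sum>v\<in>B i. (f v :: real))"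
proof -
  have "(\<Sum>v\<in>V. f v) = (\<Sum>v\<in>T. f v) + (\<Sum>v\<in>V - T. f v)"
    using finV TV by (simp add: sum.subset_diff add.commute)
  moreover have "V - T = (\<Union>i\<in>{..<r}. B i)" using hr by (auto simp: colour_class_def)
  moreover have "(\<Sum>v\<in>(\<Union>i\<in>{..<r}. B i). f v) = (\<Sum>i<r. \<Sum>v\<in>B i. f v)"
    using finB by (intro sum.UNION_disjoint) (auto simp: colour_class_def)
  ultimately show ?thesis by simp
qed

lemma card_classes: "card V = card T + (\<Sum>i<r. card (B i))"
proof -
  have "real (card V) = real (card T + (\<Sum>i<r. card (B i)))" using sum_classes[of "\<lambda>_. 1"] by simp
  then show ?thesis by (simp only: of_nat_eq_iff)
qed

text \<open>
  The eigenvalue equation at \<open>v\<close> involves the entries of all vertices except those in the class of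
  \<open>v\<close>, on which the vector is constant. All entries are therefore determined by the total sum.
\<close>

lemma eigenvector_entries:
  fixes q :: real and x :: "'a \<Rightarrow> real"
  assumes q: "q > card V"
    and eq: "\<And>v. v \<in> V \<Longrightarrow> q * x v = (\<Sum>u\<in>nbs V E v. x v + x u)"
  shows "v \<in> T \<Longrightarrow> x v * (q - card V + 2) = (\<Sum>u\<in>V. x u)"
    "v \<in> V - T \<Longrightarrow> x v * (q - card V + 2 * card (B (h v))) = (\<Sum>u\<in>V. x u)"
    "u \<in> V - T \<Longrightarrow> v \<in> V - T \<Longrightarrow> h u = h v \<Longrightarrow> x u = x v"
proof -
  define S where "S = (\<Sum>u\<in>V. x u)"
  show "x v * (q - card V + 2) = (\<Sum>u\<in>V. x u)" if v: "v \<in> T"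
  proof -
    have vV: "v \<in> V" using v TV by auto
    have c1: "card V \<ge> 1" using vV finV by (metis One_nat_def Suc_leI card_gt_0_iff empty_iff)
    have "q * x v = (\<Sum>u\<in>V - {v}. x v + x u)" using eq[OF vV] nbs_T[OF v] by simp
    also have "\<dots> = (real (card V) - 1) * x v + (S - x v)"
      using finV vV c1 by (simp add: sum.distrib sum_diff1 S_def of_nat_diff)
    finally show ?thesis by (simp add: S_def algebra_simps)
  qed
  have raw: "x v * (q - card V + card (B (h v))) = S - (\<Sum>u\<in>B (h v). x u)" if v: "v \<in> V - T" for v
  proof -
    have sub: "B (h v) \<subseteq> V" by (auto simp: colour_class_def)
    have "q * x v = (\<Sum>u\<in>V - B (h v). x v + x u)" using eq[of v] nbs_class[OF v] v by simp
    also have "\<dots> = (real (card V) - card (B (h v))) * x v + (S - (\<Sum>u\<in>B (h v). x u))"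
      using finV finB sub card_mono[OF finV sub] by (simp add: sum.distrib sum_diff S_def card_Diff_subset of_nat_diff)
    finally show ?thesis by (simp add: algebra_simps)
  qed
  have same: "x u = x v" if uv: "u \<in> V - T" "v \<in> V - T" "h u = h v" for u v
  proof -
    have "x u * (q - card V + card (B (h v))) = x v * (q - card V + card (B (h v)))"
      using raw[OF uv(1)] raw[OF uv(2)] uv(3) by simp
    moreover have "q - card V + card (B (h v)) > 0" using q by simp
    ultimately show ?thesis by simp
  qed
  show "u \<in> V - T \<Longrightarrow> v \<in> V - T \<Longrightarrow> h u = h v \<Longrightarrow> x u = x v" by (rule same)
  show "x v * (q - card V + 2 * card (B (h v))) = (\<Sum>u\<in>V. x u)" if v: "v \<in> V - T"
  proof -
    have "(\<Sum>u\<in>B (h v). x u) = (\<Sum>u\<in>B (h v). x v)"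
      by (intro sum.cong refl same v) (auto simp: colour_class_def)
    then show ?thesis using raw[OF v] by (simp add: S_def algebra_simps)
  qed
qed

text \<open>
  Sum the formulas of \<open>eigenvector_entries\<close> over all vertices and cancel the total.
\<close>

lemma char_sum_qrad:
  assumes q: "qrad V E > card V" and ne: "V \<noteq> {}"
  shows "char_sum r (card T) (\<lambda>i. card (B i)) (qrad V E - card V) = 1"
proof -
  define q where "q = qrad V E"
  define c where "c = q - card V"
  have c0: "c > 0" using q by (simp add: c_def q_def)
  obtain x where x: "\<And>v. x v \<ge> 0" "sqnorm V x = 1" "\<And>v. v \<in> V \<Longrightarrow> q * x v = (\<Sum>u\<in>nbs V E v. x v + x u)"
    using qrad_eigenvector[OF sgraph_coloured_join[OF finV] ne] unfolding q_def by metis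
  define S where "S = (\<Sum>u\<in>V. x u)"
  have q': "q > card V" using q by (simp add: q_def)
  note ent = eigenvector_entries[OF q' x(3), folded S_def c_def]
  have T: "x v = S / (c + 2)" if "v \<in> T" for v using ent(1)[OF _ that] c0 by (simp add: field_simps)
  have Bi: "x v = S / (c + 2 * card (B i))" if "v \<in> B i" for v i
  proof -
    have v: "v \<in> V - T" "h v = i" using that by (auto simp: colour_class_def)
    have "c + 2 * card (B i) > 0" using c0 by simp
    then show ?thesis using ent(2)[OF _ v(1)] v(2) by (simp add: field_simps)
  qed
  have "S = (\<Sum>v\<in>T. x v) + (\<Sum>i<r. \<Sum>v\<in>B i. x v)" unfolding S_def by (rule sum_classes)
  also have "(\<Sum>v\<in>T. x v) = card T * (S / (c + 2))" using T by simp
  also have "(\<Sum>i<r. \<Sum>v\<in>B i. x v) = (\<Sum>i<r. S * (card (B i) / (c + 2 * card (B i))))"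
    by (intro sum.cong refl) (simp add: Bi)
  also have "card T * (S / (c + 2)) + \<dots> = S * char_sum r (card T) (\<lambda>i. card (B i)) c"
    by (simp add: char_sum_def sum_distrib_left algebra_simps)
  finally have eq: "S * char_sum r (card T) (\<lambda>i. card (B i)) c = S * 1" by simp
  have "S \<noteq> 0"
  proof
    assume "S = 0"
    then have "\<forall>v\<in>V. x v = 0" using x(1) finV by (simp add: S_def sum_nonneg_eq_0_iff)
    then show False using x(2) by (simp add: sqnorm_def)
  qed
  then have "char_sum r (card T) (\<lambda>i. card (B i)) c = 1" using eq by simp
  then show ?thesis by (simp add: c_def q_def)
qed

text \<open>
  The vector with entries \<open>1 / (c + 2)\<close> on \<open>T\<close> and \<open>1 / (c + 2 b)\<close> on a class of order \<open>b\<close> has sum \<open>S\<close>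
  equal to the value of \<open>char_sum\<close>, and it satisfies the eigenvalue equation for \<open>n + c\<close> up to the
  additive term \<open>S - 1\<close>. Its Rayleigh quotient is thus at least \<open>n + c\<close>.
\<close>

lemma qrad_ge_of_char_sum:
  fixes c :: real
  assumes c: "c > 0" and ne: "V \<noteq> {}"
  shows "char_sum r (card T) (\<lambda>i. card (B i)) c \<ge> 1 \<Longrightarrow> qrad V E \<ge> card V + c"
    "char_sum r (card T) (\<lambda>i. card (B i)) c > 1 \<Longrightarrow> qrad V E > card V + c"
proof -
  define z where "z = (\<lambda>v. if v \<in> T then 1 / (c + 2) else 1 / (c + 2 * card (B (h v))))"
  define S where "S = (\<Sum>v\<in>V. z v)"
  have z0: "z v > 0" for v using c by (auto simp: z_def add_pos_nonneg)
  have S0: "S > 0" unfolding S_def using z0 ne finV by (intro sum_pos) auto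
  have ST: "S = char_sum r (card T) (\<lambda>i. card (B i)) c"
  proof -
    have "S = (\<Sum>v\<in>T. z v) + (\<Sum>i<r. \<Sum>v\<in>B i. z v)" unfolding S_def by (rule sum_classes)
    moreover have "(\<Sum>v\<in>T. z v) = card T / (c + 2)" by (simp add: z_def)
    moreover have "(\<Sum>v\<in>B i. z v) = card (B i) / (c + 2 * card (B i))" for i
    proof -
      have "(\<Sum>v\<in>B i. z v) = (\<Sum>v\<in>B i. 1 / (c + 2 * card (B i)))"
        by (intro sum.cong refl) (auto simp: z_def colour_class_def)
      then show ?thesis by simp
    qed
    ultimately show ?thesis by (simp add: char_sum_def)
  qed
  have row: "(\<Sum>u\<in>nbs V E v. z v + z u) = (card V + c) * z v + (S - 1)" if v: "v \<in> V" for v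
  proof (cases "v \<in> T")
    case True
    have c1: "card V \<ge> 1" using v finV by (metis One_nat_def Suc_leI card_gt_0_iff empty_iff)
    have "(\<Sum>u\<in>nbs V E v. z v + z u) = (real (card V) - 1) * z v + (S - z v)"
      unfolding nbs_T[OF True] using finV v c1 by (simp add: sum.distrib sum_diff1 S_def of_nat_diff)
    also have "\<dots> = (card V + c) * z v + S - (c + 2) * z v" by (simp add: algebra_simps)
    also have "(c + 2) * z v = 1" using True c by (simp add: z_def)
    finally show ?thesis by simp
  next
    case False
    then have v': "v \<in> V - T" using v by simp
    have sub: "B (h v) \<subseteq> V" by (auto simp: colour_class_def)
    have "(\<Sum>u\<in>B (h v). z u) = (\<Sum>u\<in>B (h v). z v)"
      by (intro sum.cong refl) (use False in \<open>auto simp: z_def colour_class_def\<close>)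
    then have sB: "(\<Sum>u\<in>B (h v). z u) = card (B (h v)) * z v" by simp
    have "(\<Sum>u\<in>nbs V E v. z v + z u) = (real (card V) - card (B (h v))) * z v + (S - card (B (h v)) * z v)"
      unfolding nbs_class[OF v'] using finV finB sub card_mono[OF finV sub] sB
      by (simp add: sum.distrib sum_diff S_def card_Diff_subset of_nat_diff)
    also have "\<dots> = (card V + c) * z v + S - (c + 2 * card (B (h v))) * z v" by (simp add: algebra_simps)
    also have "(c + 2 * card (B (h v))) * z v = 1"
    proof -
      have "c + 2 * real (card (B (h v))) > 0" using c by simp
      then show ?thesis using False by (simp add: z_def)
    qed
    finally show ?thesis by simp
  qed
  have "qform V E z = (\<Sum>v\<in>V. z v * ((card V + c) * z v + (S - 1)))"
    unfolding qform_self[OF sgraph_coloured_join[OF finV]] by (intro sum.cong refl) (simp only: row)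
  also have "\<dots> = (\<Sum>v\<in>V. (card V + c) * (z v)\<^sup>2 + (S - 1) * z v)"
    by (intro sum.cong refl) (simp add: power2_eq_square algebra_simps)
  also have "\<dots> = (card V + c) * sqnorm V z + (S - 1) * (\<Sum>v\<in>V. z v)"
    unfolding sqnorm_def sum.distrib sum_distrib_left[symmetric] ..
  also have "(\<Sum>v\<in>V. z v) = S" by (simp add: S_def)
  finally have qf: "(card V + c) * sqnorm V z + (S - 1) * S \<le> qrad V E * sqnorm V z"
    using qform_le_qrad[OF finV, of E z] by simp
  have "(z v)\<^sup>2 > 0" for v using z0[of v] by simp
  then have N0: "sqnorm V z > 0" unfolding sqnorm_def using ne finV by (intro sum_pos) blast+
  show "qrad V E \<ge> card V + c" if "char_sum r (card T) (\<lambda>i. card (B i)) c \<ge> 1"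
  proof -
    have "(S - 1) * S \<ge> 0" using that S0 ST by simp
    then have "(card V + c) * sqnorm V z \<le> qrad V E * sqnorm V z" using qf by linarith
    then show ?thesis using N0 by simp
  qed
  show "qrad V E > card V + c" if "char_sum r (card T) (\<lambda>i. card (B i)) c > 1"
  proof -
    have "(S - 1) * S > 0" using that S0 ST by simp
    then have "(card V + c) * sqnorm V z < qrad V E * sqnorm V z" using qf by linarith
    then show ?thesis using N0 by simp
  qed
qed

end

text \<open>
  The difference between chord and graph in closed form. The relevant function is written as
  \<open>1/2 - c / (2 A)\<close> with \<open>A = c + 2 m\<close>; \<open>B\<close> and \<open>C\<close> are the denominators at \<open>k\<close> and \<open>k + 1\<close>, and \<open>d = m - k\<close>.
\<close>

lemma secant_identity:
  fixes A B C c d :: real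
  assumes "A = B + 2 * d" "C = B + 2" "A > 0" "B > 0"
  shows "1 / 2 - c / (2 * B) + ((1 / 2 - c / (2 * C)) - (1 / 2 - c / (2 * B))) * d - (1 / 2 - c / (2 * A)) =
    2 * c * (d * (d - 1)) / (A * (B * C))"
proof -
  have "C > 0" using assms by simp
  have 1: "1 / B - 1 / C = 2 / (B * C)" "1 / A - 1 / B = - 2 * d / (A * B)"
    using assms \<open>C > 0\<close> by (simp_all add: field_simps)
  have "1 / 2 - c / (2 * B) + ((1 / 2 - c / (2 * C)) - (1 / 2 - c / (2 * B))) * d - (1 / 2 - c / (2 * A)) =
      c / 2 * ((1 / A - 1 / B) + (1 / B - 1 / C) * d)"
    by (simp add: field_simps)
  also have "\<dots> = c / 2 * (2 * d * (A - C) / (A * (B * C)))"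
    unfolding 1 using assms(3,4) \<open>C > 0\<close> by (simp add: divide_simps) (simp add: algebra_simps)
  also have "A - C = 2 * (d - 1)" using assms by simp
  finally show ?thesis by simp
qed

text \<open>
  The function \<open>m / (c + 2 m)\<close> is strictly concave, so at integers it lies below its chord through two
  consecutive integers, and strictly below away from these.
\<close>

lemma concave_tangent:
  fixes c :: real and m k :: nat
  assumes c: "c > 0"
  defines "f \<equiv> \<lambda>m :: nat. m / (c + 2 * m)"
  shows "f m \<le> f k + (f (Suc k) - f k) * (real m - k)"
    "m \<noteq> k \<Longrightarrow> m \<noteq> Suc k \<Longrightarrow> f m < f k + (f (Suc k) - f k) * (real m - k)"
proof -
  define P where "P = (c + 2 * real m) * ((c + 2 * real k) * (c + 2 * real (Suc k)))"
  have pos: "c + 2 * real m > 0" "c + 2 * real k > 0" "c + 2 * real (Suc k) > 0" using c by auto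
  then have P: "P > 0" by (simp add: P_def)
  have key: "f k + (f (Suc k) - f k) * (real m - k) - f m = 2 * c * ((real m - k) * (real m - k - 1)) / P"
  proof -
    have fx: "f x = 1 / 2 - c / (2 * (c + 2 * real x))" for x
    proof -
      have "c + 2 * real x > 0" using c by simp
      then show ?thesis by (simp add: f_def field_simps)
    qed
    show ?thesis unfolding fx P_def by (rule secant_identity) (use pos in auto)
  qed
  have nn: "(real m - k) * (real m - k - 1) \<ge> 0"
  proof (cases "m \<le> k")
    case True
    then show ?thesis by (intro mult_nonpos_nonpos) auto
  next
    case False
    then show ?thesis by (intro mult_nonneg_nonneg) auto
  qed
  then have "2 * c * ((real m - k) * (real m - k - 1)) / P \<ge> 0" using c P by simp
  then show "f m \<le> f k + (f (Suc k) - f k) * (real m - k)" using key by linarith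
  assume "m \<noteq> k" "m \<noteq> Suc k"
  then have "(real m - k) * (real m - k - 1) \<noteq> 0" by auto
  then have "(real m - k) * (real m - k - 1) > 0" using nn by linarith
  then have "2 * c * ((real m - k) * (real m - k - 1)) / P > 0" using c P by simp
  then show "f m < f k + (f (Suc k) - f k) * (real m - k)" using key by linarith
qed

text \<open>
  Replace each summand by the chord of \<open>concave_tangent\<close> at \<open>k\<close>; the sum of an affine function depends
  only on the sum of the \<open>b i\<close>, and the chord is exact for the balanced sequence.
\<close>

lemma char_sum_balanced:
  fixes b b' :: "nat \<Rightarrow> nat"
  assumes c: "c > 0" and bal: "\<And>i. i < r \<Longrightarrow> b' i = k \<or> b' i = Suc k" and sum: "(\<Sum>i<r. b i) = (\<Sum>i<r. b' i)"
  shows "char_sum r d b c \<le> char_sum r d b' c"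
    "i < r \<Longrightarrow> b i \<noteq> k \<Longrightarrow> b i \<noteq> Suc k \<Longrightarrow> char_sum r d b c < char_sum r d b' c"
proof -
  define f where "f = (\<lambda>m :: nat. m / (c + 2 * m))"
  define l where "l = (\<lambda>m :: nat. f k + (f (Suc k) - f k) * (real m - k))"
  have fl: "f m \<le> l m" "m \<noteq> k \<Longrightarrow> m \<noteq> Suc k \<Longrightarrow> f m < l m" for m
    using concave_tangent[OF c, of m k] by (auto simp: f_def l_def)
  have "f (b' i) = l (b' i)" if "i < r" for i using bal[OF that] by (auto simp: l_def)
  then have "(\<Sum>i<r. f (b' i)) = (\<Sum>i<r. l (b' i))" by simp
  also have "\<dots> = r * f k + (f (Suc k) - f k) * (real (\<Sum>i<r. b' i) - r * k)"
    by (simp add: l_def sum.distrib sum_subtractf flip: sum_distrib_left)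
  also have "\<dots> = r * f k + (f (Suc k) - f k) * (real (\<Sum>i<r. b i) - r * k)" by (simp only: sum)
  also have "\<dots> = (\<Sum>i<r. l (b i))"
    by (simp add: l_def sum.distrib sum_subtractf flip: sum_distrib_left)
  finally have eq: "(\<Sum>i<r. f (b' i)) = (\<Sum>i<r. l (b i))" .
  have "(\<Sum>i<r. f (b i)) \<le> (\<Sum>i<r. l (b i))" by (intro sum_mono fl)
  then show "char_sum r d b c \<le> char_sum r d b' c" using eq by (simp add: char_sum_def f_def)
  assume "i < r" "b i \<noteq> k" "b i \<noteq> Suc k"
  then have "(\<Sum>i<r. f (b i)) < (\<Sum>i<r. l (b i))" by (intro sum_strict_mono_ex1) (auto intro: fl)
  then show "char_sum r d b c < char_sum r d b' c" using eq by (simp add: char_sum_def f_def)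
qed

section \<open>The Turan join\<close>

text \<open>
  Vertices below \<open>k\<close> form the clique; the others are distributed over residue classes, exactly as in
  the join of the complete graph with \<open>turan_graph\<close>. The definition does not mention the order:
  each of these graphs is an induced subgraph of the next one.
\<close>

definition turan_join :: "nat \<Rightarrow> nat \<Rightarrow> nat \<Rightarrow> nat \<Rightarrow> bool" where
  "turan_join k r = coloured_join {..<k} (\<lambda>v. (v - k) mod r)"

definition turan_q :: "nat \<Rightarrow> nat \<Rightarrow> nat \<Rightarrow> real" where
  "turan_q k r n = qrad {..<n} (turan_join k r)"

lemma coloured_turan: "r > 0 \<Longrightarrow> k \<le> n \<Longrightarrow> coloured {..<n} {..<k} (\<lambda>v. (v - k) mod r) r"
  by unfold_locales auto

lemma card_residue_class:
  fixes r :: nat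
  assumes "i < r"
  shows "card {l. l < N \<and> l mod r = i} = N div r + (if i < N mod r then 1 else 0)"
proof (induction N)
  case (Suc N)
  have "{l. l < Suc N \<and> l mod r = i} = (if N mod r = i then insert N {l. l < N \<and> l mod r = i} else {l. l < N \<and> l mod r = i})"
    by (auto simp: less_Suc_eq)
  then have "card {l. l < Suc N \<and> l mod r = i} = card {l. l < N \<and> l mod r = i} + (if N mod r = i then 1 else 0)" by simp
  also have "\<dots> = N div r + (if i < N mod r then 1 else 0) + (if N mod r = i then 1 else 0)" using Suc by simp
  also have "\<dots> = Suc N div r + (if i < Suc N mod r then 1 else 0)"
    using assms by (auto simp: div_Suc mod_Suc)
  finally show ?case .
qed simp

lemma card_turan_class:
  assumes "i < r" "k \<le> n"
  shows "card (colour_class {..<n} {..<k} (\<lambda>v. (v - k) mod r) i) = (n - k) div r + (if i < (n - k) mod r then 1 else 0)"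
proof -
  have "colour_class {..<n} {..<k} (\<lambda>v. (v - k) mod r) i = (\<lambda>l. l + k) ` {l. l < n - k \<and> l mod r = i}"
  proof (intro equalityI subsetI)
    fix v assume "v \<in> colour_class {..<n} {..<k} (\<lambda>v. (v - k) mod r) i"
    then show "v \<in> (\<lambda>l. l + k) ` {l. l < n - k \<and> l mod r = i}"
      by (intro image_eqI[of _ _ "v - k"]) (auto simp: colour_class_def)
  qed (auto simp: colour_class_def)
  then show ?thesis by (simp add: card_image card_residue_class[OF assms(1)])
qed

text \<open>
  With \<open>c = qrad - n\<close> the secular sum of the given join is \<open>1\<close>. By \<open>char_sum_balanced\<close> that of the
  Turan join at the same \<open>c\<close> is at least \<open>1\<close>, and larger if the classes are unbalanced.
\<close>

lemma qrad_coloured_le_turan: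
  assumes "coloured V T h r" and r: "r > 0" and n: "card V = n" "n > 0" and k: "card T = k" and q: "qrad V (coloured_join T h) > n"
  shows "qrad V (coloured_join T h) \<le> turan_q k r n"
    "qrad V (coloured_join T h) = turan_q k r n \<Longrightarrow> i < r \<Longrightarrow>
      card (colour_class V T h i) = (n - k) div r \<or> card (colour_class V T h i) = Suc ((n - k) div r)"
proof -
  interpret coloured V T h r by fact
  have kn: "k \<le> n" using card_mono[OF finV TV] n k by simp
  interpret H: coloured "{..<n}" "{..<k}" "\<lambda>v. (v - k) mod r" r by (rule coloured_turan[OF r kn])
  define c where "c = qrad V E - n"
  have c: "c > 0" using q by (simp add: c_def)
  have ne: "V \<noteq> {}" "{..<n} \<noteq> {}" using n by auto
  have one: "char_sum r k (\<lambda>i. card (B i)) c = 1"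
    using char_sum_qrad[OF _ ne(1)] q n k by (simp add: c_def)
  define b' where "b' = (\<lambda>i. card (H.B i))"
  have b': "b' i = (n - k) div r \<or> b' i = Suc ((n - k) div r)" if "i < r" for i
    using card_turan_class[OF that kn] by (simp add: b'_def)
  have "card V = card {..<n}" using n by simp
  then have sum: "(\<Sum>i<r. card (B i)) = (\<Sum>i<r. b' i)"
    using card_classes H.card_classes k unfolding b'_def by simp
  have "char_sum r k b' c \<ge> 1" using char_sum_balanced(1)[OF c b' sum, of k] one by simp
  then have "qrad {..<n} H.E \<ge> n + c" using H.qrad_ge_of_char_sum(1)[OF c ne(2)] by (simp add: b'_def)
  then show "qrad V (coloured_join T h) \<le> turan_q k r n" by (simp add: turan_q_def turan_join_def c_def)
  assume eq: "qrad V (coloured_join T h) = turan_q k r n" and i: "i < r"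
  show "card (B i) = (n - k) div r \<or> card (B i) = Suc ((n - k) div r)"
  proof (rule ccontr)
    assume "\<not> ?thesis"
    then have "char_sum r k b' c > 1" using char_sum_balanced(2)[OF c b' sum i, of k] one by simp
    then have "qrad {..<n} H.E > n + c" using H.qrad_ge_of_char_sum(2)[OF c ne(2)] by (simp add: b'_def)
    then show False using eq by (simp add: turan_q_def turan_join_def c_def)
  qed
qed

text \<open>
  The constant vector as test vector: every degree is at least \<open>n - n / r - 1\<close>.
\<close>

lemma turan_q_lower:
  assumes r: "r \<ge> 1" and kn: "k \<le> n" and n: "n > 0"
  shows "turan_q k r n \<ge> (2 - 2 / r) * n - 2"
proof -
  interpret H: coloured "{..<n}" "{..<k}" "\<lambda>v. (v - k) mod r" r by (rule coloured_turan) (use assms in auto)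
  have deg: "real (card (nbs {..<n} H.E v)) \<ge> n - n / r - 1" if v: "v < n" for v
  proof (cases "v < k")
    case True
    then have "card (nbs {..<n} H.E v) = n - 1" using H.nbs_T[of v] v by simp
    moreover have "real n / r \<ge> 0" by simp
    ultimately show ?thesis using n by (simp add: of_nat_diff)
  next
    case False
    define i where "i = (v - k) mod r"
    have i: "i < r" using r by (simp add: i_def)
    have sub: "H.B i \<subseteq> {..<n}" by (auto simp: colour_class_def)
    have "nbs {..<n} H.E v = {..<n} - H.B i" using H.nbs_class[of v] v False by (simp add: i_def)
    then have 1: "real (card (nbs {..<n} H.E v)) = n - card (H.B i)"
      using H.finB sub card_mono[OF _ sub] by (simp add: card_Diff_subset of_nat_diff)
    have "card (H.B i) \<le> (n - k) div r + 1" using card_turan_class[OF i kn] by simp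
    also have "\<dots> \<le> n div r + 1" by (simp add: div_le_mono)
    finally have "real (card (H.B i)) \<le> real (n div r) + 1" by linarith
    also have "real (n div r) \<le> n / r" by (rule of_nat_div_le_of_nat)
    finally show ?thesis using 1 by linarith
  qed
  have "qform {..<n} H.E (\<lambda>_. 1) = 2 * (\<Sum>v<n. real (card (nbs {..<n} H.E v)))"
    by (simp add: qform_def sum_distrib_left flip: sum_divide_distrib sum_distrib_right)
  also have "\<dots> \<ge> 2 * (\<Sum>v<n. n - n / r - 1)" by (intro mult_left_mono sum_mono deg) auto
  finally have "2 * (n * (n - n / r - 1)) \<le> qform {..<n} H.E (\<lambda>_. 1)" by simp
  also have "\<dots> \<le> qrad {..<n} H.E * n" using qform_le_qrad[of "{..<n}" H.E "\<lambda>_. 1"] by (simp add: sqnorm_def)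
  finally have "(2 * (n - n / r - 1)) * n \<le> qrad {..<n} H.E * n" by (simp add: algebra_simps)
  then have "2 * (n - n / r - 1) \<le> qrad {..<n} H.E" using n by simp
  then show ?thesis by (simp add: turan_q_def turan_join_def algebra_simps)
qed

text \<open>
  The test vector gives the new vertex the entry of its twin \<open>u\<close>.
\<close>

lemma qrad_clone:
  fixes x :: "'a \<Rightarrow> real"
  assumes G: "sgraph (insert v V) E" and v: "v \<notin> V" and u: "u \<in> V" and twin: "nbs V E v = nbs V E u"
    and x: "sqnorm V x = 1" "qform V E x = q" "q * x u = (\<Sum>w\<in>nbs V E u. x u + x w)"
  shows "q + (2 * q - card (nbs V E u)) * (x u)\<^sup>2 + (\<Sum>w\<in>nbs V E u. (x w)\<^sup>2) \<le> qrad (insert v V) E * (1 + (x u)\<^sup>2)"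
proof -
  have fin: "finite V" using G by (auto dest: sgraphD)
  define y where "y = x(v := x u)"
  have yV: "y w = x w" if "w \<in> V" for w using that v by (auto simp: y_def)
  have N: "nbs (insert v V) E v = nbs V E u" using twin sgraphD(3)[OF G] by (auto simp: nbs_def)
  have NV: "nbs V E u \<subseteq> V" by (auto simp: nbs_def)
  have rem: "insert v V - {v} = V" using v by auto
  have "qform (insert v V) E y = qform V E y + (\<Sum>w\<in>nbs V E u. (y v + y w)\<^sup>2)"
    using qform_remove[OF G, of v y] N rem by simp
  also have "qform V E y = q" unfolding x(2)[symmetric] qform_def
    by (intro arg_cong[of _ _ "\<lambda>z. z / 2"] sum.cong refl) (auto simp: yV nbs_def)
  also have "(\<Sum>w\<in>nbs V E u. (y v + y w)\<^sup>2) = (\<Sum>w\<in>nbs V E u. (x u + x w)\<^sup>2)"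
  proof (intro sum.cong refl)
    fix w assume "w \<in> nbs V E u"
    then have "y w = x w" using NV yV by auto
    moreover have "y v = x u" by (simp add: y_def)
    ultimately show "(y v + y w)\<^sup>2 = (x u + x w)\<^sup>2" by simp
  qed
  also have "\<dots> = (\<Sum>w\<in>nbs V E u. 2 * x u * (x u + x w) + (x w)\<^sup>2 - (x u)\<^sup>2)"
    by (intro sum.cong refl) (simp add: power2_eq_square algebra_simps)
  also have "\<dots> = 2 * x u * (\<Sum>w\<in>nbs V E u. x u + x w) + (\<Sum>w\<in>nbs V E u. (x w)\<^sup>2) - card (nbs V E u) * (x u)\<^sup>2"
    by (simp add: sum_subtractf sum.distrib algebra_simps power2_eq_square sum_distrib_left sum_distrib_right)
  also have "(\<Sum>w\<in>nbs V E u. x u + x w) = q * x u" using x(3) by simp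
  finally have "qform (insert v V) E y = q + (2 * q - card (nbs V E u)) * (x u)\<^sup>2 + (\<Sum>w\<in>nbs V E u. (x w)\<^sup>2)"
    by (simp add: power2_eq_square algebra_simps)
  moreover have "sqnorm (insert v V) y = 1 + (x u)\<^sup>2"
  proof -
    have "sqnorm (insert v V) y = (y v)\<^sup>2 + sqnorm V y" using v fin by (simp add: sqnorm_def)
    also have "sqnorm V y = sqnorm V x" unfolding sqnorm_def by (intro sum.cong refl) (simp add: yV)
    also have "y v = x u" by (simp add: y_def)
    finally show ?thesis using x(1) by simp
  qed
  ultimately show ?thesis using qform_le_qrad[of "insert v V" E y] fin by simp
qed

text \<open>
  The Turan join of order \<open>m + 1\<close> arises from that of order \<open>m\<close> by cloning a vertex of a smallest
  class, and \<open>qrad_clone\<close> bounds the growth from below by nearly \<open>1 + (q - m) (x u)\<^sup>2\<close>. Vertices of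
  the smallest class have the largest entry outside the clique, and the entries of the \<open>k\<close> clique vertices
  are at most four times as large, so \<open>(x u)\<^sup>2\<close> is at least \<open>1 / (m + 16 k)\<close>.
\<close>

lemma turan_q_increment:
  assumes r: "r \<ge> 3" and \<epsilon>: "\<epsilon> > 0" and m: "m \<ge> k + r" "m \<ge> 18" "\<epsilon> * m \<ge> 4 + 16 * k"
  shows "turan_q k r (Suc m) \<ge> turan_q k r m + (2 - 2 / r) - \<epsilon>"
proof -
  define \<theta> where "\<theta> = 2 - 2 / real r"
  have \<theta>: "4/3 \<le> \<theta>" "\<theta> \<le> 2" using r by (auto simp: \<theta>_def field_simps)
  interpret H: coloured "{..<m}" "{..<k}" "\<lambda>v. (v - k) mod r" r by (rule coloured_turan) (use assms in auto)
  define q where "q = turan_q k r m"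
  have q_alt: "q = qrad {..<m} H.E" by (simp add: q_def turan_q_def turan_join_def)
  have "0 \<in> {..<m}" using m by simp
  then have ne: "{..<m} \<noteq> {}" by blast
  obtain x where x: "\<And>v. x v \<ge> 0" "sqnorm {..<m} x = 1" "qform {..<m} H.E x = q"
    "\<And>v. v \<in> {..<m} \<Longrightarrow> q * x v = (\<Sum>u\<in>nbs {..<m} H.E v. x v + x u)"
    using qrad_eigenvector[OF sgraph_coloured_join[of "{..<m}"] ne] unfolding q_alt by (metis finite_lessThan)
  define c where "c = q - m"
  have qlow: "q \<ge> \<theta> * m - 2" unfolding q_def \<theta>_def by (rule turan_q_lower) (use r m in auto)
  have "4/3 * real m \<le> \<theta> * m" using \<theta> by (intro mult_right_mono) auto
  moreover have "real m \<ge> 18" using m(2) by simp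
  ultimately have c: "c \<ge> 2/9 * m" "c > 0" using qlow unfolding c_def by linarith+
  then have qm: "q > card {..<m}" by (simp add: c_def)
  define S where "S = (\<Sum>u\<in>{..<m}. x u)"
  note ent = H.eigenvector_entries[OF qm x(4)]
  define i where "i = (m - k) mod r"
  have i: "i < r" using r by (simp add: i_def)
  define bi where "bi = (m - k) div r"
  have cBi: "card (H.B i) = bi" using card_turan_class[OF i, of k m] m by (simp add: i_def bi_def)
  have bmin: "bi \<le> card (H.B j)" if "j < r" for j using card_turan_class[OF that, of k m] m by (simp add: bi_def)
  \<comment> \<open>The new vertex \<open>m\<close> and the vertex \<open>m - r\<close> lie in the same residue class, which is a smallest one.\<close>
  define u where "u = m - r"
  have u: "u \<in> {..<m} - {..<k}" "(u - k) mod r = i"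
  proof -
    show "u \<in> {..<m} - {..<k}" using m r by (auto simp: u_def)
    have "m - k = (u - k) + r" using m by (simp add: u_def)
    then show "(u - k) mod r = i" by (simp add: i_def)
  qed
  have xu: "x u * (c + 2 * bi) = S" using ent(2)[OF _ u(1)] u(2) cBi by (simp add: c_def S_def)
  have cb: "c + 2 * real bi > 0" using c by simp
  have x_le: "x v \<le> x u" if v: "v \<in> {..<m} - {..<k}" for v
  proof -
    define j where "j = (v - k) mod r"
    have j: "j < r" using r by (simp add: j_def)
    have "x v * (c + 2 * bi) \<le> x v * (c + 2 * card (H.B j))" using bmin[OF j] x(1) by (intro mult_left_mono) auto
    also have "\<dots> = x u * (c + 2 * bi)" using ent(2)[OF _ v] xu by (simp add: c_def S_def j_def)
    finally show ?thesis using cb by simp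
  qed
  have x_T: "x v \<le> 4 * x u" if v: "v < k" for v
  proof -
    have "bi \<le> m div r" by (simp add: bi_def div_le_mono)
    also have "\<dots> \<le> m div 3" using r by (simp add: div_le_mono2)
    finally have "3 * bi \<le> m" by linarith
    then have "3 * real bi \<le> m" by linarith
    moreover have "2 * real m \<le> 9 * c" using c(1) by simp
    ultimately have "c + 2 * real bi \<le> 4 * (c + 2)" by simp
    then have "x u * (c + 2 * bi) \<le> x u * (4 * (c + 2))" using x(1) by (intro mult_left_mono) auto
    moreover have "x v * (c + 2) = x u * (c + 2 * bi)" using ent(1)[of v] v xu by (simp add: c_def S_def)
    ultimately have "x v * (c + 2) \<le> (4 * x u) * (c + 2)" by (simp add: mult_ac)
    then show ?thesis using c(2) by simp
  qed
  define z where "z = (x u)\<^sup>2"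
  have z0: "z \<ge> 0" by (simp add: z_def)
  have zlow: "1 \<le> (m + 16 * k) * z"
  proof -
    have "1 = (\<Sum>v\<in>{..<m}. (x v)\<^sup>2)" using x(2) by (simp add: sqnorm_def)
    also have "\<dots> \<le> (\<Sum>v\<in>{..<m}. z + (if v < k then 16 * z else 0))"
    proof (intro sum_mono)
      fix v assume v: "v \<in> {..<m}"
      show "(x v)\<^sup>2 \<le> z + (if v < k then 16 * z else 0)"
      proof (cases "v < k")
        case True
        have "(x v)\<^sup>2 \<le> (4 * x u)\<^sup>2" using x_T[OF True] x(1) by (intro power_mono) auto
        then have "(x v)\<^sup>2 \<le> 16 * z" by (simp add: z_def power_mult_distrib)
        then show ?thesis using True z0 by simp
      next
        case False
        have "(x v)\<^sup>2 \<le> (x u)\<^sup>2" using x_le[of v] v False x(1) by (intro power_mono) auto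
        then show ?thesis using False by (simp add: z_def)
      qed
    qed
    also have "\<dots> = m * z + k * (16 * z)"
    proof -
      have "{..<m} \<inter> {v. v < k} = {..<k}" using m by auto
      then show ?thesis by (simp add: sum.distrib sum.If_cases)
    qed
    finally show ?thesis by (simp add: algebra_simps)
  qed
  have twin: "nbs {..<m} H.E m = nbs {..<m} H.E u"
  proof -
    have "(m - k) mod r = (u - k) mod r" "\<not> m < k" "\<not> u < k" using u m by (auto simp: i_def)
    then show ?thesis by (auto simp: nbs_def coloured_join_def)
  qed
  have sub: "H.B i \<subseteq> {..<m}" by (auto simp: colour_class_def)
  have Nu: "nbs {..<m} H.E u = {..<m} - H.B i" using H.nbs_class[OF u(1)] u(2) by simp
  have cN: "real (card (nbs {..<m} H.E u)) = real m - bi"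
    unfolding Nu using H.finB sub card_mono[OF _ sub] cBi by (simp add: card_Diff_subset of_nat_diff)
  have sN: "(\<Sum>w\<in>nbs {..<m} H.E u. (x w)\<^sup>2) = 1 - bi * z"
  proof -
    have "(\<Sum>w\<in>H.B i. (x w)\<^sup>2) = (\<Sum>w\<in>H.B i. z)"
    proof (intro sum.cong refl)
      fix w assume "w \<in> H.B i"
      then have "x w = x u" using u(2) by (intro ent(3)[OF _ _ u(1)]) (auto simp: colour_class_def)
      then show "(x w)\<^sup>2 = z" by (simp add: z_def)
    qed
    then have "(\<Sum>w\<in>H.B i. (x w)\<^sup>2) = bi * z" using cBi by simp
    then show ?thesis unfolding Nu using sub x(2) H.finB by (simp add: sum_diff sqnorm_def)
  qed
  define q' where "q' = turan_q k r (Suc m)"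
  have ins: "insert m {..<m} = {..<Suc m}" by auto
  have "q + (2 * q - card (nbs {..<m} H.E u)) * (x u)\<^sup>2 + (\<Sum>w\<in>nbs {..<m} H.E u. (x w)\<^sup>2) \<le> qrad (insert m {..<m}) H.E * (1 + (x u)\<^sup>2)"
    by (rule qrad_clone) (use u twin x in \<open>auto intro!: sgraph_coloured_join\<close>)
  then have 1: "q + 1 + (2 * q - m) * z \<le> q' * (1 + z)"
    unfolding cN sN ins q'_def turan_q_def turan_join_def z_def[symmetric] by (simp add: algebra_simps)
  have "\<theta> - 1 - \<epsilon> \<le> (q - m - \<theta> + \<epsilon>) * z"
  proof -
    define L where "L = real (m + 16 * k)"
    have L: "L > 0" using m by (simp add: L_def)
    have a: "(\<theta> - 1) * m - 4 \<le> q - m - \<theta> + \<epsilon>" using qlow \<theta> \<epsilon> by (simp add: algebra_simps)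
    have "(\<theta> - 1 - \<epsilon>) * L \<le> (\<theta> - 1) * m - 4"
    proof -
      have "(\<theta> - 1) * (16 * real k) \<le> 1 * (16 * real k)" using \<theta> by (intro mult_right_mono) auto
      moreover have "\<epsilon> * (16 * real k) \<ge> 0" using \<epsilon> by simp
      ultimately show ?thesis using m(3) by (simp add: L_def algebra_simps)
    qed
    with a have b: "(\<theta> - 1 - \<epsilon>) * L \<le> q - m - \<theta> + \<epsilon>" by linarith
    show ?thesis
    proof (cases "\<theta> - 1 - \<epsilon> \<le> 0")
      case True
      have "(\<theta> - 1) * m \<ge> 1/3 * 18" using \<theta> m(2) by (intro mult_mono) auto
      then have "0 \<le> q - m - \<theta> + \<epsilon>" using a by linarith
      then have "0 \<le> (q - m - \<theta> + \<epsilon>) * z" using z0 by simp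
      then show ?thesis using True by linarith
    next
      case False
      then have "\<theta> - 1 - \<epsilon> \<le> (\<theta> - 1 - \<epsilon>) * (L * z)" using zlow by (simp add: L_def mult_le_cancel_left1)
      also have "\<dots> \<le> (q - m - \<theta> + \<epsilon>) * z" using mult_right_mono[OF b z0] by (simp add: mult.assoc)
      finally show ?thesis .
    qed
  qed
  then have "(q + \<theta> - \<epsilon>) * (1 + z) \<le> q' * (1 + z)" using 1 by (simp add: algebra_simps)
  then have "q + \<theta> - \<epsilon> \<le> q'" using z0 by (simp add: mult_le_cancel_right)
  then show ?thesis by (simp add: q_def q'_def \<theta>_def)
qed

section \<open>Asymptotic bound for graphs without the forbidden subgraph\<close>

text \<open>
  Fewer than \<open>t\<close> vertices in \<open>T\<close> leave one of the \<open>t\<close> edges of \<open>P\<close> untouched, and each part \<open>Q c\<close> has a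
  vertex outside \<open>T\<close>. Together these are \<open>r + 1\<close> pairwise adjacent vertices outside \<open>T\<close>, too many for
  \<open>r\<close> colours.
\<close>

lemma no_F_in_coloured_join:
  assumes "coloured V T h r" and T: "card T < t" and st: "2 * t \<le> s"
  shows "\<not> has_F s t (r - 1) V (coloured_join T h)"
proof
  interpret coloured V T h r by fact
  assume "has_F s t (r - 1) V (coloured_join T h)"
  then obtain P Q where PQ: "P \<subseteq> V" "matching E P t"
    "\<And>c. c < r - 1 \<Longrightarrow> Q c \<subseteq> V \<and> card (Q c) = s \<and> (\<forall>u\<in>P. \<forall>v\<in>Q c. E u v)" "complete_parts E (r - 1) Q"
    unfolding has_F_def by blast
  obtain e where e: "inj_on e {..<2 * t}" "e ` {..<2 * t} \<subseteq> P" "\<And>a. a < t \<Longrightarrow> E (e (2 * a)) (e (2 * a + 1))"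
    using PQ(2) by (auto simp: matching_def)
  have "\<exists>a<t. e (2 * a) \<notin> T \<and> e (2 * a + 1) \<notin> T"
  proof (rule ccontr)
    assume neg: "\<not> ?thesis"
    \<comment> \<open>Otherwise every edge of the matching contributes its own vertex of \<open>T\<close>.\<close>
    define g where "g = (\<lambda>a. if e (2 * a) \<in> T then e (2 * a) else e (2 * a + 1))"
    have gT: "g ` {..<t} \<subseteq> T" using neg by (auto simp: g_def)
    have "inj_on g {..<t}"
    proof (rule inj_onI)
      fix a b assume ab: "a \<in> {..<t}" "b \<in> {..<t}" "g a = g b"
      have ex: "\<exists>i. i \<in> {2 * a, 2 * a + 1} \<and> g a = e i" for a
        by (cases "e (2 * a) \<in> T") (auto simp: g_def)
      obtain i where i: "i \<in> {2 * a, 2 * a + 1}" "g a = e i" using ex[of a] by blast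
      obtain j where j: "j \<in> {2 * b, 2 * b + 1}" "g b = e j" using ex[of b] by blast
      have "i = j" using inj_onD[OF e(1), of i j] i j ab by auto
      moreover have "a = i div 2" "b = j div 2" using i(1) j(1) by auto
      ultimately show "a = b" by simp
    qed
    then have "t \<le> card T" using card_inj_on_le[OF _ gT finT] by simp
    then show False using T by simp
  qed
  then obtain a where a: "a < t" "e (2 * a) \<notin> T" "e (2 * a + 1) \<notin> T" by auto
  define u v where "u = e (2 * a)" and "v = e (2 * a + 1)"
  have uv: "u \<in> P - T" "v \<in> P - T" "E u v" using a e by (auto simp: u_def v_def)
  have "\<exists>w. w \<in> Q c - T" if "c < r - 1" for c
  proof -
    have "card (Q c) = s" using PQ(3)[OF that] by auto
    then have "\<not> Q c \<subseteq> T" using card_mono[OF finT, of "Q c"] T st by auto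
    then show ?thesis by auto
  qed
  then obtain w where w: "\<And>c. c < r - 1 \<Longrightarrow> w c \<in> Q c - T" by metis
  have hu: "h u < r" using hr[of u] uv PQ(1) by auto
  then have r0: "r > 0" by simp
  define f where "f = (\<lambda>c. if c < r - 1 then h (w c) else if c = r - 1 then h u else h v)"
  have "\<not> r < r - 1" "r \<noteq> r - 1" using r0 by auto
  then have fr: "f (r - 1) = h u" "f r = h v" by (auto simp: f_def)
  have diff: "h x \<noteq> h y" if "E x y" "x \<notin> T" "y \<notin> T" for x y using that by (auto simp: coloured_join_def)
  have "inj_on f {..r}"
  proof (rule linorder_inj_onI)
    fix c d assume cd: "c < d" "c \<in> {..r}" "d \<in> {..r}"
    consider "d < r - 1" | "d = r - 1" | "d = r" "c = r - 1" | "d = r" "c < r - 1" using cd by fastforce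
    then show "f c \<noteq> f d"
    proof cases
      case 1
      then have "c < r - 1" using cd by simp
      then have "E (w c) (w d)" using complete_partsD[OF PQ(4) _ 1, of c "w c" "w d"] w[of c] w[OF 1] cd by auto
      then show ?thesis using diff w[of c] w[OF 1] 1 \<open>c < r - 1\<close> by (auto simp: f_def)
    next
      case 2
      then have c: "c < r - 1" using cd by simp
      have "E u (w c)" using PQ(3)[OF c] w[OF c] uv by auto
      then have "h u \<noteq> h (w c)" using diff w[OF c] uv by auto
      then show ?thesis using c 2 by (simp add: f_def)
    next
      case 3
      then show ?thesis using diff[of u v] uv fr by auto
    next
      case 4
      have "E v (w c)" using PQ(3)[OF 4(2)] w[OF 4(2)] uv by auto
      then have "h v \<noteq> h (w c)" using diff w[OF 4(2)] uv by auto
      then show ?thesis using 4 fr by (auto simp: f_def)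
    qed
  qed auto
  moreover have "f ` {..r} \<subseteq> {..<r}"
  proof -
    have "h (w c) < r" if "c < r - 1" for c using hr[of "w c"] w[OF that] PQ(3)[OF that] by auto
    moreover have "h v < r" using hr[of v] uv PQ(1) by auto
    ultimately show ?thesis using hu by (auto simp: f_def)
  qed
  ultimately have "card {..r} \<le> card {..<r}" by (intro card_inj_on_le) auto
  then show False by simp
qed

lemma qrad_cong:
  assumes "\<And>u v. u \<in> V \<Longrightarrow> v \<in> V \<Longrightarrow> E u v \<longleftrightarrow> E' u v"
  shows "qrad V E = qrad V E'"
proof -
  have "nbs V E v = nbs V E' v" if "v \<in> V" for v using assms that by (auto simp: nbs_def)
  then have "qform V E = qform V E'" by (auto simp: qform_def fun_eq_iff intro!: sum.cong)
  then show ?thesis by (simp add: qrad_def)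
qed

definition F_free :: "nat \<Rightarrow> nat \<Rightarrow> nat \<Rightarrow> 'a set \<Rightarrow> ('a \<Rightarrow> 'a \<Rightarrow> bool) \<Rightarrow> bool" where
  "F_free s t r V E \<longleftrightarrow> sgraph V E \<and> \<not> has_F s t (r - 1) V E"

lemma F_free_mono: "F_free s t r V E \<Longrightarrow> U \<subseteq> V \<Longrightarrow> F_free s t r U E"
  unfolding F_free_def using sgraph_mono has_F_mono by metis

lemma F_free_turan_join:
  assumes "r > 0" "1 \<le> t" "2 * t \<le> s" "t \<le> n"
  shows "F_free s t r {..<n} (turan_join (t - 1) r)"
proof -
  have "coloured {..<n} {..<t - 1} (\<lambda>v. (v - (t - 1)) mod r) r" using assms by (intro coloured_turan) auto
  from no_F_in_coloured_join[OF this _ assms(3)] show ?thesis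
    using assms by (auto simp: F_free_def turan_join_def sgraph_coloured_join)
qed

text \<open>
  Minimum degree above \<open>(1 - 1/r + \<eta>) n\<close> yields \<open>r + 1\<close> complete parts of order \<open>s\<close>, which contain the
  forbidden graph.
\<close>

lemma flat_min_degree_contradiction:
  fixes \<theta> \<eta> :: real
  assumes r: "r \<ge> 3" and st: "2 * t \<le> s" and \<eta>: "\<eta> > 0" and \<theta>: "\<theta> = 2 - 2 / r + 8 * \<eta>" "\<theta> \<le> 2"
    and \<delta>: "0 \<le> \<delta>" "\<delta> \<le> \<eta> / 10" "\<delta> \<le> 1"
  shows "\<exists>N. \<forall>V (E :: 'a \<Rightarrow> 'a \<Rightarrow> bool). F_free s t r V E \<longrightarrow> card V \<ge> N \<longrightarrow> flat_eig \<delta> V E \<longrightarrow> qrad V E < \<theta> * (real (card V) - 1) - 1"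
proof -
  obtain N0 where N0: "\<forall>V (E :: 'a \<Rightarrow> 'a \<Rightarrow> bool). sgraph V E \<longrightarrow> card V \<ge> N0 \<longrightarrow>
    (r > 0 \<longrightarrow> (\<forall>v\<in>V. real (card (nbs V E v)) \<ge> (1 - 1 / r + \<eta>) * card V)) \<longrightarrow>
    (\<exists>A. (\<forall>i<Suc r. A i \<subseteq> V \<and> card (A i) = s) \<and> complete_parts E (Suc r) A)"
    using erdos_stone_min_degree[OF \<eta>, where 'a = 'a, of r s] by (rule exE)
  obtain N1 :: nat where N1: "real N1 \<ge> 2 / \<eta>" using real_arch_simple by blast
  have r3: "2 / real r \<le> 2 / 3" using r by (simp add: field_simps)
  show ?thesis
  proof (intro exI[of _ "max N0 (max N1 9)"] allI impI, rule ccontr)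
    fix V :: "'a set" and E assume K: "F_free s t r V E" and nV: "max N0 (max N1 9) \<le> card V" and fl: "flat_eig \<delta> V E"
      and "\<not> qrad V E < \<theta> * (real (card V) - 1) - 1"
    then have q: "qrad V E \<ge> \<theta> * (real (card V) - 1) - 1" by simp
    have G: "sgraph V E" "\<not> has_F s t (r - 1) V E" using K by (auto simp: F_free_def)
    define n where "n = real (card V)"
    have n: "n \<ge> 9" "n \<ge> 2 / \<eta>" using nV N1 by (auto simp: n_def)
    have \<theta>3: "\<theta> \<ge> 4/3" using \<theta> r3 \<eta> by linarith
    have q': "qrad V E \<ge> \<theta> * n - 3" using q \<theta>(2) by (simp add: n_def algebra_simps)
    moreover have "4/3 * n \<le> \<theta> * n" using \<theta>3 n by (intro mult_right_mono) auto
    ultimately have "qrad V E \<ge> n" using n(1) by linarith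
    then have qn: "qrad V E \<ge> card V" by (simp add: n_def)
    have "real (card (nbs V E v)) \<ge> (1 - 1 / r + \<eta>) * card V" if "v \<in> V" for v
    proof -
      have "real (card (nbs V E v)) \<ge> qrad V E / 2 - 5/2 * \<delta> * n"
        using flat_min_degree[OF G(1) fl that \<delta>(1,3) qn] by (simp add: n_def)
      moreover have "\<delta> * n \<le> \<eta> / 10 * n" using \<delta>(2) n by (intro mult_right_mono) auto
      moreover have "\<eta> * n \<ge> 2" using n(2) \<eta> by (simp add: field_simps)
      moreover have "\<theta> * n = 2 * ((1 - 1 / r) * n) + 8 * (\<eta> * n)" unfolding \<theta>(1) by (simp add: algebra_simps)
      ultimately have "real (card (nbs V E v)) \<ge> (1 - 1 / r) * n + \<eta> * n" using q' by linarith
      then show ?thesis by (simp add: n_def algebra_simps)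
    qed
    then obtain A where A: "\<And>i. i < Suc r \<Longrightarrow> A i \<subseteq> V \<and> card (A i) = s" "complete_parts E (Suc r) A"
      using N0[rule_format, OF G(1)] nV by auto
    have "Suc (Suc (r - 1)) = Suc r" using r by simp
    from has_F_of_complete_parts[OF G(1), of "r - 1" A, unfolded this, OF A(2) A(1) st]
    have "has_F s t (r - 1) V E" by simp
    then show False using G by simp
  qed
qed

text \<open>
  Let \<open>qs n\<close> be the supremum of \<open>qrad\<close> over graphs of order \<open>n\<close> without the forbidden graph. By
  \<open>qrad_delete_ratio\<close>, \<open>qs n / (n - 1)\<close> decreases, say to \<open>\<theta>\<close>; so \<open>qs n \<ge> \<theta> (n - 1)\<close> always, and
  \<open>qs n\<close> is at most \<open>(\<theta> + e) n\<close> eventually. If \<open>\<theta> > 2 - 2/r\<close>, apply \<open>reduce_to_flat\<close> to the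
  benchmark \<open>\<theta> (n - 1) - 1\<close>, where the summand \<open>-1\<close> leaves room for near-extremal graphs, and contradict
  \<open>flat_min_degree_contradiction\<close>.
\<close>

lemma F_free_asymptotic_bound:
  fixes \<epsilon> :: real
  assumes r: "r \<ge> 3" and t: "1 \<le> t" "2 * t \<le> s" and \<epsilon>: "\<epsilon> > 0"
  shows "\<exists>N. \<forall>V (E :: nat \<Rightarrow> nat \<Rightarrow> bool). F_free s t r V E \<longrightarrow> card V \<ge> N \<longrightarrow> qrad V E \<le> (2 - 2 / r + \<epsilon>) * card V"
proof -
  define Qs where "Qs = (\<lambda>n. {qrad V E | V (E :: nat \<Rightarrow> nat \<Rightarrow> bool). F_free s t r V E \<and> card V = n})"
  define qs where "qs = (\<lambda>n. Sup (Qs n))"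
  define \<theta>0 where "\<theta>0 = 2 - 2 / real r"
  have \<theta>0: "4/3 \<le> \<theta>0" "\<theta>0 \<le> 2" using r by (auto simp: \<theta>0_def field_simps)
  have ub: "x \<le> 2 * real n" if xQ: "x \<in> Qs n" and n0: "n > 0" for x n
  proof -
    obtain V and E :: "nat \<Rightarrow> nat \<Rightarrow> bool" where "x = qrad V E" "F_free s t r V E" "card V = n" using xQ by (auto simp: Qs_def)
    moreover from this have "V \<noteq> {}" using n0 by auto
    ultimately show ?thesis using qrad_le[of V E] by (auto simp: F_free_def)
  qed
  have bdd: "bdd_above (Qs n)" if "n > 0" for n by (rule bdd_aboveI[of _ "2 * real n"]) (use ub[OF _ that] in auto)
  have mem: "turan_q (t - 1) r n \<in> Qs n" if "n \<ge> t" for n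
    unfolding Qs_def turan_q_def using F_free_turan_join[of r t s n] r t that
    by (intro CollectI exI[of _ "{..<n}"] exI[of _ "turan_join (t - 1) r"]) auto
  have le_qs: "x \<le> qs n" if "x \<in> Qs n" "n > 0" for x n unfolding qs_def using that bdd by (intro cSup_upper) auto
  have qs_low: "qs n \<ge> \<theta>0 * n - 2" if "n \<ge> t" for n
  proof -
    have "t - 1 \<le> n" "n > 0" "r \<ge> 1" using that t r by auto
    then have "turan_q (t - 1) r n \<ge> \<theta>0 * n - 2" unfolding \<theta>0_def by (intro turan_q_lower)
    then show ?thesis using le_qs[OF mem[OF that] \<open>n > 0\<close>] by linarith
  qed
  have qs_up: "qs n \<le> 2 * real n" if "n \<ge> t" for n
    unfolding qs_def using mem[OF that] ub[of _ n] that t by (intro cSup_least) auto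
  \<comment> \<open>Large enough for the Turan join to exist and for \<open>4/3 n - 2 \<ge> n - 1\<close>.\<close>
  define n0 where "n0 = max t 9"
  have qs1: "qs n \<ge> real n - 1" if "n \<ge> n0" for n
  proof -
    have "4/3 * real n \<le> \<theta>0 * n" using \<theta>0 by (intro mult_right_mono) auto
    moreover have "n \<ge> t" "real n \<ge> 9" using that by (auto simp: n0_def)
    ultimately show ?thesis using qs_low[of n] by linarith
  qed
  have step: "qs (Suc n) * (real n - 1) \<le> qs n * n" if n: "n \<ge> n0" for n
  proof -
    have n9: "n \<ge> 9" "n \<ge> t" using n by (auto simp: n0_def)
    have "x \<le> qs n * n / (real n - 1)" if xQ: "x \<in> Qs (Suc n)" for x
    proof -
      obtain V and E :: "nat \<Rightarrow> nat \<Rightarrow> bool" where V: "x = qrad V E" "F_free s t r V E" "card V = Suc n" using xQ by (auto simp: Qs_def)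
      have G: "sgraph V E" using V(2) by (simp add: F_free_def)
      have "x * (real n - 1) \<le> qs n * n"
      proof (cases "x \<ge> n")
        case True
        then obtain v where v: "v \<in> V" "qrad V E * (real (card V) - 2) \<le> qrad (V - {v}) E * (real (card V) - 1)"
          using qrad_delete_ratio[OF G] V(1,3) n9 by auto
        have "finite V" using G by (rule sgraphD)
        then have "card (V - {v}) = n" using V(3) v(1) by simp
        then have "qrad (V - {v}) E \<in> Qs n" using F_free_mono[OF V(2), of "V - {v}"] by (auto simp: Qs_def)
        then have "qrad (V - {v}) E \<le> qs n" using le_qs n9 by simp
        then have "qrad (V - {v}) E * n \<le> qs n * n" by (intro mult_right_mono) auto
        then show ?thesis using v(2) V(1,3) by simp
      next
        case False
        then have "x * (real n - 1) \<le> n * (real n - 1)" using n9 by (intro mult_right_mono) auto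
        also have "\<dots> \<le> n * qs n" using qs1[OF n] by (intro mult_left_mono) auto
        finally show ?thesis by (simp add: mult.commute)
      qed
      then show ?thesis using n9 by (simp add: pos_le_divide_eq)
    qed
    then have "qs (Suc n) \<le> qs n * n / (real n - 1)"
      unfolding qs_def using mem[of "Suc n"] n9 by (intro cSup_least) auto
    then show ?thesis using n9 by (simp add: pos_le_divide_eq)
  qed
  define a where "a = (\<lambda>i. qs (n0 + i) / (real (n0 + i) - 1))"
  have n09: "n0 \<ge> 9" by (simp add: n0_def)
  have "decseq a"
  proof (rule decseq_SucI)
    fix i
    define n where "n = n0 + i"
    have n: "n \<ge> n0" "real n > 1" using n09 by (auto simp: n_def)
    have "qs (Suc n) / real n \<le> qs n / (real n - 1)" using step[OF n(1)] n(2) by (simp add: divide_simps mult.commute)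
    then show "a (Suc i) \<le> a i" by (simp add: a_def n_def)
  qed
  moreover have "0 \<le> a i" for i using qs1[of "n0 + i"] n09 by (simp add: a_def)
  ultimately obtain \<theta> where \<theta>: "a \<longlonglongrightarrow> \<theta>" "\<And>i. \<theta> \<le> a i" using decseq_convergent by blast
  have qs_ge: "qs n \<ge> \<theta> * (real n - 1)" if "n \<ge> n0" for n
  proof -
    have "\<theta> \<le> qs n / (real n - 1)" using \<theta>(2)[of "n - n0"] that by (simp add: a_def)
    then show ?thesis using that n09 by (simp add: pos_le_divide_eq)
  qed
  have qs_le: "\<exists>N. \<forall>n\<ge>N. n \<ge> n0 \<longrightarrow> qs n \<le> (\<theta> + e) * n" if e: "e > 0" "\<theta> + e \<ge> 0" for e
  proof -
    have "eventually (\<lambda>i. a i < \<theta> + e) sequentially" using order_tendstoD(2)[OF \<theta>(1), of "\<theta> + e"] e by simp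
    then obtain N where N: "\<And>i. i \<ge> N \<Longrightarrow> a i < \<theta> + e" by (auto simp: eventually_sequentially)
    have "qs n \<le> (\<theta> + e) * n" if "n \<ge> N + n0" for n
    proof -
      have "qs n / (real n - 1) < \<theta> + e" using N[of "n - n0"] that by (simp add: a_def)
      then have "qs n \<le> (\<theta> + e) * (real n - 1)" using that n09 by (simp add: pos_divide_less_eq)
      also have "\<dots> \<le> (\<theta> + e) * n" using e by (intro mult_left_mono) auto
      finally show ?thesis .
    qed
    then show ?thesis by blast
  qed
  have \<theta>2: "\<theta> \<le> 2"
  proof (rule ccontr)
    assume "\<not> \<theta> \<le> 2"
    then have p: "\<theta> - 2 > 0" by simp
    obtain n1 :: nat where n1: "real n1 > \<theta> / (\<theta> - 2)" using reals_Archimedean2 by blast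
    define n where "n = max n1 n0"
    have "real n1 \<le> real n" by (simp add: n_def)
    then have n: "real n > \<theta> / (\<theta> - 2)" "n \<ge> n0" using n1 by (linarith, simp add: n_def)
    have "\<theta> * (real n - 1) \<le> 2 * real n" using qs_ge[OF n(2)] qs_up[of n] n(2) by (simp add: n0_def)
    then have "(\<theta> - 2) * n \<le> \<theta>" by (simp add: algebra_simps)
    then show False using n(1) p by (simp add: pos_divide_less_eq mult.commute)
  qed
  have "\<theta> \<le> \<theta>0"
  proof (rule ccontr)
    assume "\<not> \<theta> \<le> \<theta>0"
    define \<eta> where "\<eta> = (\<theta> - \<theta>0) / 8"
    have "8 * \<eta> = \<theta> - \<theta>0" by (simp add: \<eta>_def)
    then have \<eta>: "\<eta> > 0" "\<theta> = 2 - 2 / r + 8 * \<eta>" using \<open>\<not> \<theta> \<le> \<theta>0\<close> by (linarith, simp add: \<theta>0_def)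
    define \<delta> where "\<delta> = min 1 (\<eta> / 10)"
    have \<delta>: "0 < \<delta>" "\<delta> \<le> \<eta> / 10" "\<delta> \<le> 1" using \<eta> by (auto simp: \<delta>_def)
    define e where "e = \<delta> / 24"
    have e: "0 < e" "24 * e \<le> \<delta>" using \<delta> by (auto simp: e_def)
    have \<theta>43: "4/3 \<le> \<theta>" using \<theta>0 \<open>\<not> \<theta> \<le> \<theta>0\<close> by simp
    obtain M1 where M1: "\<And>n. n \<ge> M1 \<Longrightarrow> n \<ge> n0 \<Longrightarrow> qs n \<le> (\<theta> + e) * n" using qs_le[OF e(1)] \<theta>43 e by auto
    obtain M2 where M2: "\<And>V (E :: nat \<Rightarrow> nat \<Rightarrow> bool). F_free s t r V E \<Longrightarrow> card V \<ge> M2 \<Longrightarrow> flat_eig \<delta> V E \<Longrightarrow>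
        qrad V E < \<theta> * (real (card V) - 1) - 1"
      using flat_min_degree_contradiction[OF r t(2) \<eta> \<theta>2 less_imp_le[OF \<delta>(1)] \<delta>(2,3), where 'a = nat] by blast
    obtain M3 :: nat where M3: "real M3 \<ge> 1 / e" using real_arch_simple by blast
    define N1 where "N1 = max n0 (max M1 (max M2 M3))"
    have N1: "N1 \<ge> n0" "N1 \<ge> M1" "N1 \<ge> M2" "N1 \<ge> M3" by (auto simp: N1_def)
    have N1e: "real N1 \<ge> 1 / e" using M3 N1(4) by (meson of_nat_le_iff order_trans)
    define b where "b = (\<lambda>m. \<theta> * (real m - 1) - 1)"
    have "\<exists>N2. \<forall>V (E :: nat \<Rightarrow> nat \<Rightarrow> bool). F_free s t r V E \<longrightarrow> card V \<ge> N2 \<longrightarrow> qrad V E \<ge> b (card V) \<longrightarrow>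
      (\<exists>U\<subseteq>V. card U \<ge> N1 \<and> flat_eig \<delta> U E \<and> qrad U E \<ge> b (card U) \<and> (U = V \<or> qrad U E > b (card U)))"
    proof (rule reduce_to_flat[OF _ _ e \<delta>(3) \<theta>43 \<theta>2 _ N1e])
      show "F_free s t r V E \<Longrightarrow> sgraph V E" for V and E :: "nat \<Rightarrow> nat \<Rightarrow> bool" by (simp add: F_free_def)
      show "F_free s t r V E \<Longrightarrow> U \<subseteq> V \<Longrightarrow> F_free s t r U E" for V U and E :: "nat \<Rightarrow> nat \<Rightarrow> bool" by (rule F_free_mono)
      show "2 \<le> N1" using N1(1) n09 by simp
      show "qrad V E \<le> (\<theta> + e) * card V" if "F_free s t r V E" "N1 \<le> card V" for V and E :: "nat \<Rightarrow> nat \<Rightarrow> bool"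
      proof -
        have "qrad V E \<in> Qs (card V)" using that by (auto simp: Qs_def)
        then have "qrad V E \<le> qs (card V)" using le_qs that N1(1) n09 by simp
        then show ?thesis using M1[of "card V"] that N1 by simp
      qed
      show "b m + \<theta> - e \<le> b (Suc m)" for m using e by (simp add: b_def algebra_simps)
    qed
    then obtain N2 where N2: "\<And>V (E :: nat \<Rightarrow> nat \<Rightarrow> bool). F_free s t r V E \<Longrightarrow> card V \<ge> N2 \<Longrightarrow> qrad V E \<ge> b (card V) \<Longrightarrow>
      (\<exists>U\<subseteq>V. card U \<ge> N1 \<and> flat_eig \<delta> U E \<and> qrad U E \<ge> b (card U) \<and> (U = V \<or> qrad U E > b (card U)))" by blast
    define n where "n = max n0 N2"
    have n: "n \<ge> n0" "n \<ge> N2" by (auto simp: n_def)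
    have "qs n - 1 < Sup (Qs n)" by (simp add: qs_def)
    moreover have "Qs n \<noteq> {}" using mem[of n] n by (auto simp: n0_def)
    moreover have "bdd_above (Qs n)" using bdd n n09 by simp
    ultimately obtain x where x: "x \<in> Qs n" "qs n - 1 < x" using less_cSup_iff[of "Qs n" "qs n - 1"] by blast
    then obtain V and E :: "nat \<Rightarrow> nat \<Rightarrow> bool" where V: "x = qrad V E" "F_free s t r V E" "card V = n" by (auto simp: Qs_def)
    have "qrad V E \<ge> b (card V)" using x(2) V qs_ge[OF n(1)] by (simp add: b_def)
    then obtain U where U: "U \<subseteq> V" "card U \<ge> N1" "flat_eig \<delta> U E" "qrad U E \<ge> b (card U)"
      using N2[OF V(2)] V(3) n(2) by blast
    have "qrad U E < b (card U)" using M2[OF F_free_mono[OF V(2) U(1)] _ U(3)] U(2) N1(3) by (simp add: b_def)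
    then show False using U(4) by simp
  qed
  obtain N where N: "\<And>n. n \<ge> N \<Longrightarrow> n \<ge> n0 \<Longrightarrow> qs n \<le> (\<theta>0 + \<epsilon>) * n"
  proof -
    have "\<theta> + (\<theta>0 - \<theta> + \<epsilon>) \<ge> 0" "\<theta>0 - \<theta> + \<epsilon> > 0" using \<theta>0 \<epsilon> \<open>\<theta> \<le> \<theta>0\<close> by auto
    then have "\<exists>N. \<forall>n\<ge>N. n \<ge> n0 \<longrightarrow> qs n \<le> (\<theta> + (\<theta>0 - \<theta> + \<epsilon>)) * n" using qs_le by blast
    then show ?thesis using that by auto
  qed
  show ?thesis
  proof (intro exI[of _ "max N n0"] allI impI)
    fix V and E :: "nat \<Rightarrow> nat \<Rightarrow> bool" assume V: "F_free s t r V E" "max N n0 \<le> card V"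
    have "qrad V E \<in> Qs (card V)" using V by (auto simp: Qs_def)
    then have "qrad V E \<le> qs (card V)" using le_qs V(2) n09 by simp
    then show "qrad V E \<le> (2 - 2 / r + \<epsilon>) * card V" using N[of "card V"] V(2) by (simp add: \<theta>0_def)
  qed
qed

section \<open>Labelled graphs, isomorphism and subgraphs\<close>

abbreviation adj :: "nat pair_pre_digraph \<Rightarrow> nat \<Rightarrow> nat \<Rightarrow> bool" where
  "adj G u v \<equiv> (u, v) \<in> parcs G"

lemma simple_graph_sgraph:
  assumes "G \<in> simple_graphs n"
  shows "sgraph {..<n} (adj G)" "pverts G = {..<n}" "parcs G \<subseteq> {..<n} \<times> {..<n}" "num_verts G = n"
proof -
  have pg: "pair_graph G" and pv: "pverts G = {..<n}" using assms by (auto simp: simple_graphs_def)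
  interpret pair_graph G by fact
  have "sym (parcs G)" using pair_sym_arcs by (simp add: symmetric_def)
  moreover have "\<not> adj G u u" for u using pair_no_loops[of "(u, u)"] by auto
  ultimately show "sgraph {..<n} (adj G)" by (auto simp: sgraph_def sym_def)
  show "pverts G = {..<n}" by fact
  show "parcs G \<subseteq> {..<n} \<times> {..<n}" using wellformed' pv by auto
  show "num_verts G = n" by (simp add: num_verts_def pv)
qed

lemma simple_graphsI:
  assumes "pverts G = {..<n}" "parcs G \<subseteq> {..<n} \<times> {..<n}" "sgraph {..<n} (adj G)"
  shows "G \<in> simple_graphs n"
proof -
  have "finite (parcs G)" using assms(2) by (rule finite_subset) auto
  moreover have "sym (parcs G)" using assms(3) by (auto simp: sgraph_def sym_def)
  moreover have "fst e \<noteq> snd e" if "e \<in> parcs G" for e using that assms(3) by (cases e) (auto simp: sgraph_def)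
  ultimately have "pair_graph G"
    using assms(1,2) by unfold_locales (auto simp: symmetric_def)
  then show ?thesis using assms(1) by (simp add: simple_graphs_def)
qed

lemma signless_laplacian_mult:
  assumes G: "G \<in> simple_graphs n" and v: "v \<in> carrier_vec n" and i: "i < n"
  shows "(signless_laplacian G *\<^sub>v v) $ i = (\<Sum>u\<in>nbs {..<n} (adj G) i. v $ i + v $ u)"
proof -
  note g = simple_graph_sgraph[OF G]
  have "out_arcs (with_proj G) i = Pair i ` nbs {..<n} (adj G) i"
    using g(3) by (auto simp: out_arcs_def nbs_def)
  then have deg: "out_degree (with_proj G) i = card (nbs {..<n} (adj G) i)"
    by (simp add: out_degree_def card_image inj_on_def)
  have "(signless_laplacian G *\<^sub>v v) $ i = (\<Sum>j\<in>{0..<n}. signless_laplacian G $$ (i, j) * v $ j)"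
    using i v g(4) by (simp add: signless_laplacian_def degree_matrix_def adjacency_matrix_def scalar_prod_def)
  also have "\<dots> = (\<Sum>j\<in>{..<n}. (if j = i then real (card (nbs {..<n} (adj G) i)) * v $ i else 0) + (if adj G i j then v $ j else 0))"
    using i g(4) deg by (intro sum.cong) (auto simp: signless_laplacian_def degree_matrix_def adjacency_matrix_def algebra_simps)
  also have "\<dots> = real (card (nbs {..<n} (adj G) i)) * v $ i + (\<Sum>j\<in>{..<n}. if adj G i j then v $ j else 0)"
    using i by (simp add: sum.distrib)
  also have "(\<Sum>j\<in>{..<n}. if adj G i j then v $ j else 0) = (\<Sum>j\<in>nbs {..<n} (adj G) i. v $ j)"
    unfolding nbs_def by (intro sum.inter_filter[symmetric]) simp
  finally show ?thesis by (simp add: sum.distrib)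
qed

text \<open>
  The maximiser of the Rayleigh quotient is an eigenvector, and no eigenvalue exceeds the Rayleigh
  quotient of its eigenvector.
\<close>

lemma q_index_eq_qrad:
  assumes G: "G \<in> simple_graphs n" and n: "n > 0"
  shows "q_index G = qrad {..<n} (adj G)"
proof -
  note g = simple_graph_sgraph[OF G]
  define Q where "Q = signless_laplacian G"
  have Q: "Q \<in> carrier_mat n n" using g(4) by (simp add: Q_def signless_laplacian_def degree_matrix_def adjacency_matrix_def)
  have ne: "{..<n} \<noteq> {}" using n by auto
  define \<mu> where "\<mu> = qrad {..<n} (adj G)"
  obtain x where x: "sqnorm {..<n} x = 1"
    "\<And>v. v \<in> {..<n} \<Longrightarrow> \<mu> * x v = (\<Sum>u\<in>nbs {..<n} (adj G) v. x v + x u)"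
    using qrad_eigenvector[OF g(1) ne] unfolding \<mu>_def by metis
  have "eigenvalue Q \<mu>"
    unfolding eigenvalue_def eigenvector_def
  proof (intro exI[of _ "vec n x"] conjI)
    show "vec n x \<in> carrier_vec (dim_row Q)" using Q by simp
    show "vec n x \<noteq> 0\<^sub>v (dim_row Q)"
    proof
      assume "vec n x = 0\<^sub>v (dim_row Q)"
      then have "x i = 0" if "i < n" for i using that Q by (metis index_vec index_zero_vec(1) carrier_matD(1))
      then show False using x(1) by (simp add: sqnorm_def)
    qed
    show "Q *\<^sub>v vec n x = \<mu> \<cdot>\<^sub>v vec n x"
    proof (rule eq_vecI)
      fix i assume "i < dim_vec (\<mu> \<cdot>\<^sub>v vec n x)"
      then have i: "i < n" by simp
      have "(Q *\<^sub>v vec n x) $ i = (\<Sum>u\<in>nbs {..<n} (adj G) i. vec n x $ i + vec n x $ u)"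
        unfolding Q_def by (rule signless_laplacian_mult[OF G _ i]) simp
      also have "\<dots> = (\<Sum>u\<in>nbs {..<n} (adj G) i. x i + x u)" using i by (intro sum.cong) (auto simp: nbs_def)
      finally show "(Q *\<^sub>v vec n x) $ i = (\<mu> \<cdot>\<^sub>v vec n x) $ i" using x(2)[of i] i by simp
    qed (use Q in simp)
  qed
  moreover have "k \<le> \<mu>" if ev: "eigenvalue Q k" for k
  proof -
    obtain v where v: "v \<in> carrier_vec n" "v \<noteq> 0\<^sub>v n" "Q *\<^sub>v v = k \<cdot>\<^sub>v v"
      using ev Q by (auto simp: eigenvalue_def eigenvector_def)
    define y where "y = (\<lambda>i. v $ i)"
    have ky: "(\<Sum>u\<in>nbs {..<n} (adj G) i. y i + y u) = k * y i" if "i < n" for i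
      using signless_laplacian_mult[OF G v(1) that] v(1,3) that by (simp add: Q_def y_def)
    have "qform {..<n} (adj G) y = (\<Sum>i<n. y i * (k * y i))"
      unfolding qform_self[OF g(1)] by (intro sum.cong refl) (simp only: lessThan_iff ky)
    also have "\<dots> = k * sqnorm {..<n} y" by (simp add: sqnorm_def sum_distrib_left power2_eq_square mult_ac)
    finally have "k * sqnorm {..<n} y \<le> \<mu> * sqnorm {..<n} y"
      using qform_le_qrad[of "{..<n}" "adj G" y] by (simp add: \<mu>_def)
    moreover have "sqnorm {..<n} y > 0"
    proof -
      have "\<exists>i<n. y i \<noteq> 0"
      proof (rule ccontr)
        assume "\<not> ?thesis"
        then have "v = 0\<^sub>v n" using v(1) by (intro eq_vecI) (auto simp: y_def)
        then show False using v(2) by simp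
      qed
      then obtain i where i: "i < n" "y i \<noteq> 0" by auto
      have "(y i)\<^sup>2 \<le> sqnorm {..<n} y" unfolding sqnorm_def by (rule member_le_sum) (use i in auto)
      then show ?thesis using i(2) by (smt (verit) zero_less_power2)
    qed
    ultimately show ?thesis by (simp add: mult_le_cancel_right)
  qed
  ultimately have "Max (spectrum Q) = \<mu>"
    using card_finite_spectrum(1)[OF Q] by (intro Max_eqI) (auto simp: spectrum_def)
  then show ?thesis by (simp add: q_index_def Q_def \<mu>_def)
qed

text \<open>
  For graphs whose arcs are pairs of vertices the vertex map determines the arc map.
\<close>

lemma graph_iso_iff:
  assumes wf: "parcs G \<subseteq> pverts G \<times> pverts G"
  shows "graph_iso G H \<longleftrightarrow> (\<exists>f. inj_on f (pverts G) \<and> pverts H = f ` pverts G \<and> parcs H = (\<lambda>(u, v). (f u, f v)) ` parcs G)"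
proof
  assume "graph_iso G H"
  then obtain hom where hom: "pre_digraph.digraph_isomorphism (with_proj G) hom" "with_proj H = app_iso hom (with_proj G)"
    by (auto simp: graph_iso_def digraph_iso_def)
  have inj: "inj_on (iso_verts hom) (pverts G)"
    and arc: "\<And>a. a \<in> parcs G \<Longrightarrow> iso_verts hom (fst a) = iso_tail hom (iso_arcs hom a) \<and> iso_verts hom (snd a) = iso_head hom (iso_arcs hom a)"
    using hom(1) by (auto simp: pre_digraph.digraph_isomorphism_def)
  have "verts (with_proj H) = iso_verts hom ` pverts G" "arcs (with_proj H) = iso_arcs hom ` parcs G"
    "tail (with_proj H) = iso_tail hom" "head (with_proj H) = iso_head hom"
    unfolding hom(2) by (simp_all add: app_iso_def)
  then have H: "pverts H = iso_verts hom ` pverts G" "parcs H = iso_arcs hom ` parcs G" "iso_tail hom = fst" "iso_head hom = snd"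
    by simp_all
  have "iso_arcs hom a = (\<lambda>(u, v). (iso_verts hom u, iso_verts hom v)) a" if "a \<in> parcs G" for a
    using arc[OF that] H by (cases a) (auto intro: prod_eqI)
  then have "parcs H = (\<lambda>(u, v). (iso_verts hom u, iso_verts hom v)) ` parcs G"
    unfolding H(2) by (intro image_cong refl)
  then show "\<exists>f. inj_on f (pverts G) \<and> pverts H = f ` pverts G \<and> parcs H = (\<lambda>(u, v). (f u, f v)) ` parcs G"
    using inj H(1) by blast
next
  assume "\<exists>f. inj_on f (pverts G) \<and> pverts H = f ` pverts G \<and> parcs H = (\<lambda>(u, v). (f u, f v)) ` parcs G"
  then obtain f where f: "inj_on f (pverts G)" "pverts H = f ` pverts G" "parcs H = (\<lambda>(u, v). (f u, f v)) ` parcs G" by auto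
  define hom where "hom = \<lparr>iso_verts = f, iso_arcs = (\<lambda>(u, v). (f u, f v)), iso_head = snd, iso_tail = fst\<rparr>"
  have "wf_digraph (with_proj G)" using wf by unfold_locales auto
  moreover have "inj_on (\<lambda>(u, v). (f u, f v)) (parcs G)"
    using f(1) wf by (auto simp: inj_on_def)
  ultimately have "pre_digraph.digraph_isomorphism (with_proj G) hom"
    using f(1) by (auto simp: pre_digraph.digraph_isomorphism_def hom_def)
  moreover have "with_proj H = app_iso hom (with_proj G)"
    using f by (simp add: with_proj_def app_iso_def hom_def)
  ultimately show "graph_iso G H" by (auto simp: graph_iso_def digraph_iso_def)
qed

lemma free_of_iff_no_embedding:
  assumes wf: "parcs F \<subseteq> pverts F \<times> pverts F" and wG: "parcs G \<subseteq> pverts G \<times> pverts G"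
  shows "free_of F G \<longleftrightarrow> \<not> (\<exists>f. inj_on f (pverts F) \<and> f ` pverts F \<subseteq> pverts G \<and> (\<forall>(u, v)\<in>parcs F. (f u, f v) \<in> parcs G))"
proof -
  have "(\<exists>H. subgraph (with_proj H) (with_proj G) \<and> graph_iso F H) \<longleftrightarrow>
     (\<exists>f. inj_on f (pverts F) \<and> f ` pverts F \<subseteq> pverts G \<and> (\<forall>(u, v)\<in>parcs F. (f u, f v) \<in> parcs G))" (is "?L \<longleftrightarrow> ?R")
  proof
    assume ?L
    then obtain H f where H: "subgraph (with_proj H) (with_proj G)" and f: "inj_on f (pverts F)" "pverts H = f ` pverts F" "parcs H = (\<lambda>(u, v). (f u, f v)) ` parcs F"
      unfolding graph_iso_iff[OF wf] by auto
    have "pverts H \<subseteq> pverts G" "parcs H \<subseteq> parcs G" using H by (auto simp: subgraph_def)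
    then show ?R using f by (intro exI[of _ f]) auto
  next
    assume ?R
    then obtain f where f: "inj_on f (pverts F)" "f ` pverts F \<subseteq> pverts G" "\<forall>(u, v)\<in>parcs F. (f u, f v) \<in> parcs G" by auto
    define H where "H = \<lparr>pverts = f ` pverts F, parcs = (\<lambda>(u, v). (f u, f v)) ` parcs F\<rparr>"
    have "graph_iso F H" unfolding graph_iso_iff[OF wf] using f by (intro exI[of _ f]) (auto simp: H_def)
    moreover have "wf_digraph (with_proj H)" using wf by unfold_locales (auto simp: H_def)
    moreover have "wf_digraph (with_proj G)" using wG by unfold_locales auto
    moreover have "pverts H \<subseteq> pverts G" "parcs H \<subseteq> parcs G" using f by (auto simp: H_def)
    ultimately show ?L by (intro exI[of _ H]) (auto simp: subgraph_def compatible_def)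
  qed
  then show ?thesis by (simp add: free_of_def)
qed

lemma disjoint_copies_K2:
  "pverts (disjoint_copies t (complete_graph 2)) = {..<2 * t}"
  "parcs (disjoint_copies t (complete_graph 2)) = {(i, j). i < 2 * t \<and> j < 2 * t \<and> i \<noteq> j \<and> i div 2 = j div 2}"
proof (induction t)
  case 0
  { case 1 show ?case by (simp add: complete_graph_def) }
  { case 2 show ?case by (simp add: complete_graph_def) }
next
  case (Suc t)
  have n2: "num_verts (complete_graph 2) = 2" by (simp add: num_verts_def complete_graph_def)
  { case 1
    have "{..<2} \<union> (\<lambda>i. 2 + i) ` {..<2 * t} = {..<2 * Suc t}"
    proof (intro equalityI subsetI)
      fix x assume "x \<in> {..<2 * Suc t}"
      then show "x \<in> {..<2} \<union> (\<lambda>i. 2 + i) ` {..<2 * t}"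
        by (cases "x < 2") (auto intro!: image_eqI[of _ _ "x - 2"])
    qed auto
    then show ?case using Suc by (simp add: disjoint_union_def Let_def n2 shift_graph_def) (simp add: complete_graph_def) }
  { case 2
    have "{(i, j). i < 2 \<and> j < 2 \<and> i \<noteq> j} \<union> (\<lambda>(i, j). (2 + i, 2 + j)) ` {(i, j). i < 2 * t \<and> j < 2 * t \<and> i \<noteq> j \<and> i div 2 = j div 2}
        = {(i, j). i < 2 * Suc t \<and> j < 2 * Suc t \<and> i \<noteq> j \<and> i div 2 = j div (2::nat)}" (is "?L = ?R")
    proof (intro equalityI subsetI)
      fix x assume "x \<in> ?R"
      then obtain i j where x: "x = (i, j)" "i < 2 * Suc t" "j < 2 * Suc t" "i \<noteq> j" "i div 2 = j div 2" by auto
      show "x \<in> ?L"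
      proof (cases "i < 2")
        case True
        then have "j < 2" using x(5) by auto
        then show ?thesis using True x by auto
      next
        case False
        then have "2 \<le> i" "2 \<le> j" using x(5) by (auto simp: not_less) (metis div_less le_less_linear div_greater_zero_iff less_irrefl pos2)
        then have "(i - 2, j - 2) \<in> {(i, j). i < 2 * t \<and> j < 2 * t \<and> i \<noteq> j \<and> i div 2 = j div 2}" using x
          by (auto simp: div_if)
        moreover have "x = (\<lambda>(i, j). (2 + i, 2 + j)) (i - 2, j - 2)" using x(1) \<open>2 \<le> i\<close> \<open>2 \<le> j\<close> by (simp only: case_prod_conv le_add_diff_inverse)
        ultimately show ?thesis by blast
      qed
    qed auto
    then show ?case using Suc by (simp add: disjoint_union_def Let_def n2 shift_graph_def) (simp add: complete_graph_def) }
qed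

lemma join_arcs:
  assumes "pverts A = {..<a}" "pverts B = {..<b}" "parcs A \<subseteq> {..<a} \<times> {..<a}" "parcs B \<subseteq> {..<b} \<times> {..<b}"
  shows "pverts (graph_join A B) = {..<a + b}"
    "adj (graph_join A B) i j \<longleftrightarrow> i < a + b \<and> j < a + b \<and>
      ((i < a \<and> j < a \<and> adj A i j) \<or> (i < a \<and> a \<le> j) \<or> (a \<le> i \<and> j < a) \<or> (a \<le> i \<and> a \<le> j \<and> adj B (i - a) (j - a)))"
    "pverts (disjoint_union A B) = {..<a + b}"
    "adj (disjoint_union A B) i j \<longleftrightarrow> adj A i j \<or> (a \<le> i \<and> a \<le> j \<and> adj B (i - a) (j - a))"
proof -
  have na: "num_verts A = a" using assms by (simp add: num_verts_def)
  have im: "(\<lambda>i. a + i) ` {..<b} = {a..<a + b}"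
  proof (intro equalityI subsetI)
    fix x assume "x \<in> {a..<a + b}"
    then show "x \<in> (\<lambda>i. a + i) ` {..<b}" by (intro image_eqI[of _ _ "x - a"]) auto
  qed auto
  have ai: "(i, j) \<in> (\<lambda>(i, j). (a + i, a + j)) ` parcs B \<longleftrightarrow> a \<le> i \<and> a \<le> j \<and> adj B (i - a) (j - a)" for i j
  proof
    assume "a \<le> i \<and> a \<le> j \<and> adj B (i - a) (j - a)"
    then show "(i, j) \<in> (\<lambda>(i, j). (a + i, a + j)) ` parcs B" by (intro image_eqI[of _ _ "(i - a, j - a)"]) auto
  qed auto
  have un: "{..<a} \<union> {a..<a + b} = {..<a + b}" by auto
  show pd: "pverts (disjoint_union A B) = {..<a + b}"
    using assms un im by (simp add: disjoint_union_def Let_def shift_graph_def na)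
  then show "pverts (graph_join A B) = {..<a + b}" by (simp add: graph_join_def Let_def)
  show ad: "adj (disjoint_union A B) i j \<longleftrightarrow> adj A i j \<or> (a \<le> i \<and> a \<le> j \<and> adj B (i - a) (j - a))"
    using ai[of i j] by (simp add: disjoint_union_def Let_def shift_graph_def na)
  have "adj A i j \<Longrightarrow> i < a \<and> j < a" "adj B (i - a) (j - a) \<Longrightarrow> i - a < b \<and> j - a < b" using assms(3,4) by auto
  then show "adj (graph_join A B) i j \<longleftrightarrow> i < a + b \<and> j < a + b \<and>
      ((i < a \<and> j < a \<and> adj A i j) \<or> (i < a \<and> a \<le> j) \<or> (a \<le> i \<and> j < a) \<or> (a \<le> i \<and> a \<le> j \<and> adj B (i - a) (j - a)))"
    using assms(1,2) im ad by (simp add: graph_join_def Let_def shift_graph_def na) auto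
qed

section \<open>The extremal graphs\<close>

text \<open>
  The constants are chosen in the order \<open>\<beta>\<close>, \<open>K\<close>, \<open>\<gamma>\<close>: the dominator threshold \<open>\<beta>\<close> depends on \<open>t\<close> and \<open>r\<close>
  only, the bound \<open>K\<close> for the number of dominators depends on \<open>\<beta>\<close>, and \<open>\<gamma>\<close> has to be small compared with
  \<open>\<beta> / 2 ^ K\<close>.
\<close>

lemma parameter_choice:
  fixes s t r :: nat
  assumes r: "r \<ge> 3" and t: "1 \<le> t" "2 * t \<le> s"
  obtains \<beta> \<gamma> :: real and K :: nat where "0 < \<gamma>" "\<gamma> \<le> \<beta>" "1000 * t * r * r * r * \<beta> \<le> 1" "t \<le> (\<beta> / 2) ^ r * K"
    "4 * r * s * \<gamma> \<le> \<beta> / 2 ^ (K + 2)" "100 * r * r * s * \<gamma> \<le> 1"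
proof -
  define \<beta> where "\<beta> = 1 / real (1000 * t * r * r * r)"
  have p1: "real (1000 * t * r * r * r) > 0" using r t by simp
  have \<beta>: "\<beta> > 0" "real (1000 * t * r * r * r) * \<beta> \<le> 1" using p1 by (auto simp: \<beta>_def simp del: of_nat_mult)
  obtain K :: nat where K: "real K \<ge> t / (\<beta> / 2) ^ r" using real_arch_simple by blast
  have K': "t \<le> (\<beta> / 2) ^ r * K"
  proof -
    have "(\<beta> / 2) ^ r > 0" using \<beta> by simp
    then show ?thesis using K by (simp add: pos_divide_le_eq mult.commute)
  qed
  define c where "c = \<beta> / 2 ^ (K + 2)"
  have c: "c > 0" using \<beta> by (simp add: c_def)
  have p2: "real (4 * r * s) > 0" "real (100 * r * r * s) > 0" using r t by auto
  define \<gamma> where "\<gamma> = min \<beta> (min (c / real (4 * r * s)) (1 / real (100 * r * r * s)))"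
  have "\<gamma> > 0" using \<beta> c p2 by (simp add: \<gamma>_def del: of_nat_mult)
  moreover have "\<gamma> \<le> \<beta>" by (simp add: \<gamma>_def)
  moreover have "real (4 * r * s) * \<gamma> \<le> c"
  proof -
    have "\<gamma> \<le> c / real (4 * r * s)" by (simp add: \<gamma>_def del: of_nat_mult)
    then show ?thesis using p2(1) by (simp add: pos_le_divide_eq mult.commute del: of_nat_mult)
  qed
  moreover have "real (100 * r * r * s) * \<gamma> \<le> 1"
  proof -
    have "\<gamma> \<le> 1 / real (100 * r * r * s)" by (simp add: \<gamma>_def del: of_nat_mult)
    then show ?thesis using p2(2) by (simp add: pos_le_divide_eq mult.commute del: of_nat_mult)
  qed
  ultimately show ?thesis using that[of \<gamma> \<beta> K] \<beta>(2) K' by (simp add: c_def)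
qed

text \<open>
  The clique with \<open>k\<close> vertices joined to a complete \<open>r\<close>-partite graph with balanced parts, stated
  without reference to a labelling.
\<close>

definition balanced_join :: "nat \<Rightarrow> nat \<Rightarrow> 'a set \<Rightarrow> ('a \<Rightarrow> 'a \<Rightarrow> bool) \<Rightarrow> bool" where
  "balanced_join k r V E \<longleftrightarrow> (\<exists>T h. coloured V T h r \<and> card T = k \<and>
     (\<forall>u\<in>V. \<forall>v\<in>V. E u v \<longleftrightarrow> coloured_join T h u v) \<and>
     (\<forall>i<r. card (colour_class V T h i) = (card V - k) div r \<or> card (colour_class V T h i) = Suc ((card V - k) div r)))"

text \<open>
  A flat eigenvector gives the degree condition, hence the structure \<open>near_partite\<close>, and serves as
  the vector \<open>y\<close> in \<open>exchange\<close>. If the graph differs from the resulting join, then the join has larger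
  \<open>qrad\<close>, yet at most \<open>turan_q (t - 1) r (card V)\<close>, a contradiction.
\<close>

lemma flat_extremal:
  assumes r: "r \<ge> 3" and t: "1 \<le> t" "2 * t \<le> s"
  shows "\<exists>\<delta>>0. \<delta> \<le> 1 \<and> (\<exists>N. \<forall>V (E :: 'a \<Rightarrow> 'a \<Rightarrow> bool). F_free s t r V E \<longrightarrow> card V \<ge> N \<longrightarrow> flat_eig \<delta> V E \<longrightarrow>
    qrad V E \<ge> turan_q (t - 1) r (card V) \<longrightarrow> qrad V E = turan_q (t - 1) r (card V) \<and> balanced_join (t - 1) r V E)"
proof -
  obtain \<beta> \<gamma> :: real and K :: nat where par: "0 < \<gamma>" "\<gamma> \<le> \<beta>" "1000 * t * r * r * r * \<beta> \<le> 1" "t \<le> (\<beta> / 2) ^ r * K"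
    "4 * r * s * \<gamma> \<le> \<beta> / 2 ^ (K + 2)" "100 * r * r * s * \<gamma> \<le> 1"
    by (rule parameter_choice[OF r t]) (rule that)
  have r2: "r \<ge> 2" using r by simp
  obtain \<epsilon> where \<epsilon>0: "\<epsilon> > 0 \<and> (\<exists>N. \<forall>V (E :: 'a \<Rightarrow> 'a \<Rightarrow> bool). sgraph V E \<longrightarrow> card V \<ge> N \<longrightarrow> \<not> has_F s t (r - 1) V E \<longrightarrow>
    (\<forall>v\<in>V. real (card (nbs V E v)) \<ge> (1 - 1 / r - \<epsilon>) * card V) \<longrightarrow>
    (\<exists>A. (\<forall>i<r. A i \<subseteq> V \<and> (1 / r - \<gamma>) * card V \<le> card (A i) \<and> card (A i) \<le> (1 / r + \<gamma>) * card V \<and>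
          (\<forall>u\<in>A i. \<forall>v\<in>A i. \<not> E u v)) \<and>
      (\<forall>i<r. \<forall>j<r. i \<noteq> j \<longrightarrow> A i \<inter> A j = {}) \<and> card (V - (\<Union>i<r. A i)) \<le> \<gamma> * card V))"
    using independent_parts_of_min_degree[OF par(1) r2 t, where 'a = 'a] by (rule exE)
  have \<epsilon>: "\<epsilon> > 0" using \<epsilon>0 by (rule conjunct1)
  obtain N0 where N0: "\<forall>V (E :: 'a \<Rightarrow> 'a \<Rightarrow> bool). sgraph V E \<longrightarrow> card V \<ge> N0 \<longrightarrow> \<not> has_F s t (r - 1) V E \<longrightarrow>
    (\<forall>v\<in>V. real (card (nbs V E v)) \<ge> (1 - 1 / r - \<epsilon>) * card V) \<longrightarrow>
    (\<exists>A. (\<forall>i<r. A i \<subseteq> V \<and> (1 / r - \<gamma>) * card V \<le> card (A i) \<and> card (A i) \<le> (1 / r + \<gamma>) * card V \<and>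
          (\<forall>u\<in>A i. \<forall>v\<in>A i. \<not> E u v)) \<and>
      (\<forall>i<r. \<forall>j<r. i \<noteq> j \<longrightarrow> A i \<inter> A j = {}) \<and> card (V - (\<Union>i<r. A i)) \<le> \<gamma> * card V)"
    using conjunct2[OF \<epsilon>0] by (rule exE)
  define \<mu> where "\<mu> = min \<epsilon> \<gamma>"
  have \<mu>: "\<mu> > 0" "\<mu> \<le> \<epsilon>" "\<mu> \<le> \<gamma>" using \<epsilon> par(1) by (auto simp: \<mu>_def)
  define \<delta> where "\<delta> = min 1 (\<mu> / 5)"
  have \<delta>: "\<delta> > 0" "\<delta> \<le> 1" "\<delta> \<le> \<mu> / 5" using \<mu> by (auto simp: \<delta>_def)
  obtain N1 :: nat where N1: "real N1 \<ge> 2 * (s + 1) / \<mu>" using real_arch_simple by blast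
  show ?thesis
  proof (intro exI[of _ \<delta>] exI[of _ "max N0 (max N1 24)"] conjI allI impI)
    show "\<delta> > 0" "\<delta> \<le> 1" by fact+
  next
    fix V :: "'a set" and E assume K: "F_free s t r V E" and nV: "max N0 (max N1 24) \<le> card V" and fl: "flat_eig \<delta> V E"
      and q: "qrad V E \<ge> turan_q (t - 1) r (card V)"
    define n where "n = real (card V)"
    have n: "n \<ge> 24" "n \<ge> 2 * (s + 1) / \<mu>" using nV N1 by (auto simp: n_def)
    have \<mu>n: "\<mu> * n \<ge> 2 * (s + 1)" using n(2) \<mu>(1) by (simp add: pos_divide_le_eq mult.commute)
    have G: "sgraph V E" "\<not> has_F s t (r - 1) V E" using K by (auto simp: F_free_def)
    have fin: "finite V" using G by (auto dest: sgraphD)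
    have ne: "V \<noteq> {}" using n by (auto simp: n_def)
    have "real s * 1 \<le> s * n" using n(1) by (intro mult_left_mono) auto
    have \<mu>1: "\<mu> \<le> 1 / 100"
    proof -
      have "0 < r * r * s" using r t by simp
      then have "1 \<le> r * r * s" by linarith
      then have "real 1 \<le> real (r * r * s)" by (rule of_nat_mono)
      then have "1 * \<gamma> \<le> real (r * r * s) * \<gamma>" using par(1) by (intro mult_right_mono) auto
      then show ?thesis using par(6) \<mu>(3) by simp
    qed
    have tn: "t - 1 \<le> card V"
    proof -
      have "\<mu> * n \<le> 1 * n" using \<mu>1 n by (intro mult_right_mono) auto
      then have "real s \<le> card V" using \<mu>n by (simp add: n_def)
      then show ?thesis using t by simp
    qed
    have q2: "qrad V E \<ge> (2 - 2 / r) * n - 2"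
      using turan_q_lower[of r "t - 1" "card V"] q tn r n by (simp add: n_def)
    have r3: "2 / real r \<le> 2 / 3" using r by (simp add: field_simps)
    have "4/3 * n \<le> (2 - 2 / r) * n" using r3 n by (intro mult_right_mono) auto
    then have q3: "qrad V E \<ge> 5/4 * n" using q2 n(1) by linarith
    then have qn: "qrad V E > card V" "qrad V E \<ge> card V" using n(1) by (auto simp: n_def)
    have degm: "real (card (nbs V E v)) \<ge> (1 - 1 / r - \<mu>) * n" if "v \<in> V" for v
    proof -
      have "real (card (nbs V E v)) \<ge> qrad V E / 2 - 5/2 * \<delta> * n"
        using flat_min_degree[OF G(1) fl that _ \<delta>(2) qn(2)] \<delta>(1) by (simp add: n_def)
      moreover have "\<delta> * n \<le> \<mu> / 5 * n" using \<delta>(3) n by (intro mult_right_mono) auto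
      moreover have "\<mu> * n \<ge> 2" using \<mu>n by simp
      moreover have "(2 - 2 / r) * n = 2 * ((1 - 1 / r) * n)" by (simp add: algebra_simps)
      ultimately have "real (card (nbs V E v)) \<ge> (1 - 1 / r) * n - \<mu> * n" using q2 by linarith
      then show ?thesis by (simp add: algebra_simps)
    qed
    have deg: "real (card (nbs V E v)) \<ge> (1 - 1 / r - e) * card V" if "v \<in> V" "\<mu> \<le> e" for v e
    proof -
      have "(1 - 1 / r - e) * n \<le> (1 - 1 / r - \<mu>) * n" using that n by (intro mult_right_mono) auto
      then show ?thesis using degm[OF that(1)] by (simp add: n_def)
    qed
    have "\<exists>A. (\<forall>i<r. A i \<subseteq> V \<and> (1 / r - \<gamma>) * card V \<le> card (A i) \<and> card (A i) \<le> (1 / r + \<gamma>) * card V \<and>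
          (\<forall>u\<in>A i. \<forall>v\<in>A i. \<not> E u v)) \<and>
      (\<forall>i<r. \<forall>j<r. i \<noteq> j \<longrightarrow> A i \<inter> A j = {}) \<and> card (V - (\<Union>i<r. A i)) \<le> \<gamma> * card V"
      by (rule N0[rule_format, OF G(1) _ G(2)]) (use nV deg \<mu>(2) in auto)
    then obtain A where A0: "(\<forall>i<r. A i \<subseteq> V \<and> (1 / r - \<gamma>) * card V \<le> card (A i) \<and> card (A i) \<le> (1 / r + \<gamma>) * card V \<and>
          (\<forall>u\<in>A i. \<forall>v\<in>A i. \<not> E u v)) \<and>
      (\<forall>i<r. \<forall>j<r. i \<noteq> j \<longrightarrow> A i \<inter> A j = {}) \<and> card (V - (\<Union>i<r. A i)) \<le> \<gamma> * card V" by (rule exE)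
    have A: "\<And>i. i < r \<Longrightarrow> A i \<subseteq> V" "\<And>i. i < r \<Longrightarrow> (1 / r - \<gamma>) * card V \<le> card (A i)"
      "\<And>i. i < r \<Longrightarrow> card (A i) \<le> (1 / r + \<gamma>) * card V" "\<And>i u v. i < r \<Longrightarrow> u \<in> A i \<Longrightarrow> v \<in> A i \<Longrightarrow> \<not> E u v"
      "\<And>i j. i < r \<Longrightarrow> j < r \<Longrightarrow> i \<noteq> j \<Longrightarrow> A i \<inter> A j = {}" "card (V - (\<Union>i<r. A i)) \<le> \<gamma> * card V"
      using A0 by blast+
    have \<gamma>n: "\<mu> * n \<le> \<gamma> * n" "\<gamma> * n \<le> \<beta> * n" using \<mu>(3) par(2) n by (auto intro!: mult_right_mono)
    interpret P: near_partite V E s t r \<gamma> A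
    proof unfold_locales
      show "real s \<le> \<gamma> * card V" using \<mu>n \<gamma>n by (simp add: n_def)
      show "v \<in> V \<Longrightarrow> real (card (nbs V E v)) \<ge> (1 - 1 / r - \<gamma>) * card V" for v using deg \<mu>(3) by auto
    qed (use G r t A par in auto)
    obtain y where y: "\<And>v. y v \<ge> 0" "sqnorm V y = card V" "qform V E y = qrad V E * card V"
      "\<And>v. v \<in> V \<Longrightarrow> (y v)\<^sup>2 \<ge> 1 - \<delta>" "\<And>v. v \<in> V \<Longrightarrow> y v * (qrad V E - card V) \<le> card V"
      by (rule flat_scaled[OF G(1) fl qn(1)]) blast
    have y4: "y v \<le> 4" if "v \<in> V" for v
    proof -
      have "y v * (n / 4) \<le> y v * (qrad V E - n)" using q3 y(1) by (intro mult_left_mono) auto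
      also have "\<dots> \<le> n" using y(5)[OF that] by (simp add: n_def)
      finally have "y v * n \<le> 4 * n" by simp
      then show ?thesis using n(1) by simp
    qed
    have "2 * real s \<le> \<beta> * card V" using \<mu>n \<gamma>n by (simp add: n_def)
    moreover have "\<delta> \<le> \<gamma>" using \<delta>(3) \<mu> by linarith
    ultimately obtain T h where Th: "T \<subseteq> V" "card T = t - 1" "\<forall>v\<in>V - T. h v < r"
      "qform V E y < qform V (coloured_join T h) y \<or> (\<forall>u\<in>V. \<forall>v\<in>V. E u v \<longleftrightarrow> coloured_join T h u v)"
      using P.exchange[of \<beta> K \<delta> y] par(2-5) \<delta>(1) y y4 by auto
    have col: "coloured V T h r" using fin Th by unfold_locales auto
    have r0: "r > 0" and n0: "card V > 0" using r n by (auto simp: n_def)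
    have same: "\<forall>u\<in>V. \<forall>v\<in>V. E u v \<longleftrightarrow> coloured_join T h u v"
    proof (rule ccontr)
      assume "\<not> ?thesis"
      then have "qform V E y < qform V (coloured_join T h) y" using Th(4) by blast
      also have "\<dots> \<le> qrad V (coloured_join T h) * card V" using qform_le_qrad[OF fin, of "coloured_join T h" y] y(2) by simp
      finally have "qrad V E * n < qrad V (coloured_join T h) * n" using y(3) by (simp add: n_def)
      then have lt: "qrad V E < qrad V (coloured_join T h)" using n(1) by simp
      then have "qrad V (coloured_join T h) \<le> turan_q (t - 1) r (card V)"
        by (intro qrad_coloured_le_turan(1)[OF col r0 refl n0 Th(2)]) (use qn in simp)
      then show False using lt q by simp
    qed
    then have qe: "qrad V E = qrad V (coloured_join T h)" by (intro qrad_cong) auto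
    then have "qrad V (coloured_join T h) > card V" using qn by simp
    note bal = qrad_coloured_le_turan[OF col r0 refl n0 Th(2) this]
    have eq: "qrad V E = turan_q (t - 1) r (card V)" using bal(1) q qe by simp
    then show "qrad V E = turan_q (t - 1) r (card V)" .
    show "balanced_join (t - 1) r V E"
      unfolding balanced_join_def using col Th(2) same bal(2) eq qe by (intro exI[of _ T] exI[of _ h]) auto
  qed
qed

text \<open>
  A graph reaching the benchmark has a large subgraph \<open>U\<close> with a flat eigenvector which reaches the
  benchmark for its own order, and exceeds it strictly unless \<open>U = V\<close>. Since \<open>flat_extremal\<close> excludes
  strict excess, \<open>U = V\<close>.
\<close>

theorem F_free_qrad_extremal:
  assumes r: "r \<ge> 3" and t: "1 \<le> t" "2 * t \<le> s"
  shows "\<exists>N. \<forall>V (E :: nat \<Rightarrow> nat \<Rightarrow> bool). F_free s t r V E \<longrightarrow> card V \<ge> N \<longrightarrow>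
    qrad V E \<le> turan_q (t - 1) r (card V) \<and> (qrad V E = turan_q (t - 1) r (card V) \<longrightarrow> balanced_join (t - 1) r V E)"
proof -
  obtain \<delta> M where \<delta>: "\<delta> > 0" "\<delta> \<le> 1" and M: "\<And>V (E :: nat \<Rightarrow> nat \<Rightarrow> bool). F_free s t r V E \<Longrightarrow> card V \<ge> M \<Longrightarrow> flat_eig \<delta> V E \<Longrightarrow>
    qrad V E \<ge> turan_q (t - 1) r (card V) \<Longrightarrow> qrad V E = turan_q (t - 1) r (card V) \<and> balanced_join (t - 1) r V E"
    using flat_extremal[OF r t, where 'a = nat] by blast
  define \<epsilon> where "\<epsilon> = \<delta> / 24"
  have \<epsilon>: "0 < \<epsilon>" "24 * \<epsilon> \<le> \<delta>" using \<delta> by (auto simp: \<epsilon>_def)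
  define \<theta> where "\<theta> = 2 - 2 / real r"
  have \<theta>: "4/3 \<le> \<theta>" "\<theta> \<le> 2" using r by (auto simp: \<theta>_def field_simps)
  obtain N0 where N0: "\<And>V (E :: nat \<Rightarrow> nat \<Rightarrow> bool). F_free s t r V E \<Longrightarrow> card V \<ge> N0 \<Longrightarrow> qrad V E \<le> (\<theta> + \<epsilon>) * card V"
    using F_free_asymptotic_bound[OF r t \<epsilon>(1)] unfolding \<theta>_def by blast
  obtain N1 :: nat where N1: "real N1 \<ge> (4 + 16 * real (t - 1)) / \<epsilon>" using real_arch_simple by blast
  define N where "N = max M (max N0 (max N1 (t - 1 + r + 18)))"
  have N: "N \<ge> M" "N \<ge> N0" "N \<ge> N1" "N \<ge> t - 1 + r" "N \<ge> 18" by (auto simp: N_def)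
  have Ne: "\<epsilon> * m \<ge> 4 + 16 * real (t - 1)" if "m \<ge> N" for m :: nat
  proof -
    have "real N1 \<le> m" using that N(3) by linarith
    then have "(4 + 16 * real (t - 1)) / \<epsilon> \<le> m" using N1 by linarith
    then show ?thesis using \<epsilon>(1) by (simp add: pos_divide_le_eq mult.commute)
  qed
  have "1 / \<epsilon> \<le> real N"
  proof -
    have "1 \<le> \<epsilon> * N" using Ne[of N] by linarith
    then show ?thesis using \<epsilon>(1) by (simp add: pos_divide_le_eq mult.commute)
  qed
  have "\<exists>N2. \<forall>V (E :: nat \<Rightarrow> nat \<Rightarrow> bool). F_free s t r V E \<longrightarrow> card V \<ge> N2 \<longrightarrow> qrad V E \<ge> turan_q (t - 1) r (card V) \<longrightarrow>
      (\<exists>U\<subseteq>V. card U \<ge> N \<and> flat_eig \<delta> U E \<and> qrad U E \<ge> turan_q (t - 1) r (card U) \<and> (U = V \<or> qrad U E > turan_q (t - 1) r (card U)))"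
  proof (rule reduce_to_flat[OF _ _ \<epsilon> \<delta>(2) \<theta> _ \<open>1 / \<epsilon> \<le> real N\<close>])
    show "F_free s t r V E \<Longrightarrow> sgraph V E" for V and E :: "nat \<Rightarrow> nat \<Rightarrow> bool" by (simp add: F_free_def)
    show "F_free s t r V E \<Longrightarrow> U \<subseteq> V \<Longrightarrow> F_free s t r U E" for V U and E :: "nat \<Rightarrow> nat \<Rightarrow> bool" by (rule F_free_mono)
    show "2 \<le> N" using N by simp
    show "qrad V E \<le> (\<theta> + \<epsilon>) * card V" if "F_free s t r V E" "N \<le> card V" for V and E :: "nat \<Rightarrow> nat \<Rightarrow> bool"
      using N0 that N by auto
    show "turan_q (t - 1) r m + \<theta> - \<epsilon> \<le> turan_q (t - 1) r (Suc m)" if "N \<le> m" for m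
      using turan_q_increment[OF r \<epsilon>(1), of "t - 1" m] Ne[OF that] that N by (simp add: \<theta>_def)
  qed
  then obtain N2 where N2: "\<And>V (E :: nat \<Rightarrow> nat \<Rightarrow> bool). F_free s t r V E \<Longrightarrow> card V \<ge> N2 \<Longrightarrow> qrad V E \<ge> turan_q (t - 1) r (card V) \<Longrightarrow>
      (\<exists>U\<subseteq>V. card U \<ge> N \<and> flat_eig \<delta> U E \<and> qrad U E \<ge> turan_q (t - 1) r (card U) \<and> (U = V \<or> qrad U E > turan_q (t - 1) r (card U)))"
    by blast
  have main: "qrad V E = turan_q (t - 1) r (card V) \<and> balanced_join (t - 1) r V E"
    if V: "F_free s t r V E" "card V \<ge> N2" "qrad V E \<ge> turan_q (t - 1) r (card V)" for V and E :: "nat \<Rightarrow> nat \<Rightarrow> bool"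
  proof -
    obtain U where U: "U \<subseteq> V" "card U \<ge> N" "flat_eig \<delta> U E" "qrad U E \<ge> turan_q (t - 1) r (card U)" "U = V \<or> qrad U E > turan_q (t - 1) r (card U)"
      using N2[OF V] by auto
    have "qrad U E = turan_q (t - 1) r (card U) \<and> balanced_join (t - 1) r U E"
      using M[OF F_free_mono[OF V(1) U(1)] _ U(3,4)] U(2) N(1) by auto
    then show ?thesis using U(5) by auto
  qed
  show ?thesis
  proof (intro exI[of _ N2] allI impI)
    fix V and E :: "nat \<Rightarrow> nat \<Rightarrow> bool" assume V: "F_free s t r V E" "card V \<ge> N2"
    show "qrad V E \<le> turan_q (t - 1) r (card V) \<and> (qrad V E = turan_q (t - 1) r (card V) \<longrightarrow> balanced_join (t - 1) r V E)"
    proof (cases "qrad V E \<ge> turan_q (t - 1) r (card V)")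
      case True
      then show ?thesis using main[OF V] by simp
    qed simp
  qed
qed

text \<open>
  Two balanced sequences with equal sum have equally many terms \<open>Suc k\<close>, so a permutation of the
  indices turns one into the other.
\<close>

lemma bij_betw_extend_colours:
  fixes r :: nat and b b' :: "nat \<Rightarrow> nat"
  assumes b: "\<And>i. i < r \<Longrightarrow> b i = k \<or> b i = Suc k" and b': "\<And>i. i < r \<Longrightarrow> b' i = k \<or> b' i = Suc k"
    and sum: "(\<Sum>i<r. b i) = (\<Sum>i<r. b' i)"
  obtains \<pi> where "bij_betw \<pi> {..<r} {..<r}" "\<And>i. i < r \<Longrightarrow> b' (\<pi> i) = b i"
proof -
  define L where "L = (\<lambda>b :: nat \<Rightarrow> nat. {i\<in>{..<r}. b i = Suc k})"
  have cnt: "(\<Sum>i<r. b i) = r * k + card (L b)" if "\<And>i. i < r \<Longrightarrow> b i = k \<or> b i = Suc k" for b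
  proof -
    have "(\<Sum>i<r. b i) = (\<Sum>i<r. k + (if b i = Suc k then 1 else 0))" using that by (intro sum.cong) auto
    also have "\<dots> = r * k + card (L b)" by (simp add: sum.distrib L_def sum.If_cases Int_def)
    finally show ?thesis .
  qed
  have c1: "card (L b) = card (L b')" using cnt[OF b] cnt[OF b'] sum by simp
  have fL: "finite (L b)" "finite (L b')" "L b \<subseteq> {..<r}" "L b' \<subseteq> {..<r}" by (auto simp: L_def)
  have c2: "card ({..<r} - L b) = card ({..<r} - L b')" using c1 fL by (simp add: card_Diff_subset)
  obtain f where f: "bij_betw f (L b) (L b')" using finite_same_card_bij[OF fL(1,2) c1] by blast
  obtain g where g: "bij_betw g ({..<r} - L b) ({..<r} - L b')" using finite_same_card_bij[OF _ _ c2] by auto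
  define \<pi> where "\<pi> = (\<lambda>i. if i \<in> L b then f i else g i)"
  have "bij_betw \<pi> (L b) (L b')" using f by (subst bij_betw_cong[of _ _ f]) (auto simp: \<pi>_def)
  moreover have "bij_betw \<pi> ({..<r} - L b) ({..<r} - L b')" using g by (subst bij_betw_cong[of _ _ g]) (auto simp: \<pi>_def)
  ultimately have "bij_betw \<pi> (L b \<union> ({..<r} - L b)) (L b' \<union> ({..<r} - L b'))" by (rule bij_betw_combine) auto
  moreover have "L b \<union> ({..<r} - L b) = {..<r}" "L b' \<union> ({..<r} - L b') = {..<r}" using fL by auto
  ultimately have bij: "bij_betw \<pi> {..<r} {..<r}" by simp
  have "b' (\<pi> i) = b i" if i: "i < r" for i
  proof (cases "i \<in> L b")
    case True
    then have "\<pi> i \<in> L b'" using f by (auto simp: \<pi>_def bij_betw_def)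
    then show ?thesis using True by (auto simp: L_def)
  next
    case False
    then have "g i \<in> {..<r} - L b'" using g i by (auto simp: bij_betw_def)
    then have "\<pi> i \<in> {..<r} - L b'" using False by (simp add: \<pi>_def)
    then show ?thesis using False i b[OF i] b'[of "\<pi> i"] by (auto simp: L_def)
  qed
  then show ?thesis using that bij by blast
qed

lemma coloured_join_isomorphic:
  assumes "coloured V T h r" "coloured V' T' h' r" and T: "card T = card T'" and \<pi>: "bij_betw \<pi> {..<r} {..<r}"
    and cls: "\<And>i. i < r \<Longrightarrow> card (colour_class V' T' h' (\<pi> i)) = card (colour_class V T h i)" and V: "card V = card V'"
  obtains f where "bij_betw f V V'" "\<And>u v. u \<in> V \<Longrightarrow> v \<in> V \<Longrightarrow> coloured_join T h u v \<longleftrightarrow> coloured_join T' h' (f u) (f v)"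
proof -
  interpret c: coloured V T h r by fact
  interpret c': coloured V' T' h' r by fact
  obtain g0 where g0: "bij_betw g0 T T'" using finite_same_card_bij[OF c.finT c'.finT T] by blast
  have "\<exists>g. bij_betw g (c.B i) (c'.B (\<pi> i))" if "i < r" for i
    using finite_same_card_bij[OF c.finB c'.finB] cls[OF that] by metis
  then obtain g where g: "\<And>i. i < r \<Longrightarrow> bij_betw (g i) (c.B i) (c'.B (\<pi> i))" by metis
  define f where "f = (\<lambda>v. if v \<in> T then g0 v else g (h v) v)"
  have fT: "f v \<in> T'" if "v \<in> T" for v using g0 that by (auto simp: f_def bij_betw_def)
  have fB: "f v \<in> V' - T'" "h' (f v) = \<pi> (h v)" if "v \<in> V - T" for v
  proof -
    have "v \<in> c.B (h v)" "h v < r" using that c.hr by (auto simp: colour_class_def)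
    then have "g (h v) v \<in> c'.B (\<pi> (h v))" using g[of "h v"] by (auto simp: bij_betw_def)
    then show "f v \<in> V' - T'" "h' (f v) = \<pi> (h v)" using that by (auto simp: f_def colour_class_def)
  qed
  have T_iff: "f v \<in> T' \<longleftrightarrow> v \<in> T" if "v \<in> V" for v using fT fB that by auto
  have \<pi>_iff: "\<pi> i = \<pi> j \<longleftrightarrow> i = j" if "i < r" "j < r" for i j using \<pi> that by (auto simp: bij_betw_def inj_on_def)
  have h_iff: "h' (f u) = h' (f v) \<longleftrightarrow> h u = h v" if "u \<in> V - T" "v \<in> V - T" for u v
    using fB(2)[OF that(1)] fB(2)[OF that(2)] \<pi>_iff c.hr that by auto
  have inj: "inj_on f V"
  proof (rule inj_onI)
    fix u v assume uv: "u \<in> V" "v \<in> V" "f u = f v"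
    show "u = v"
    proof (cases "u \<in> T")
      case True
      then have "v \<in> T" using T_iff uv by metis
      then show ?thesis using True uv(3) g0 by (auto simp: f_def bij_betw_def inj_on_def)
    next
      case False
      then have "v \<notin> T" using T_iff uv by metis
      then have "h u = h v" using h_iff[of u v] uv False by auto
      moreover have "u \<in> c.B (h u)" "v \<in> c.B (h v)" "h u < r" using uv False \<open>v \<notin> T\<close> c.hr by (auto simp: colour_class_def)
      ultimately show ?thesis using g[of "h u"] uv(3) False \<open>v \<notin> T\<close> by (auto simp: f_def bij_betw_def inj_on_def)
    qed
  qed
  have sub: "f ` V \<subseteq> V'" using fT fB c'.TV by blast
  have "card (f ` V) = card V'" using card_image[OF inj] V by simp
  then have "f ` V = V'" using sub c'.finV by (metis card_subset_eq)
  then have bij: "bij_betw f V V'" using inj by (simp add: bij_betw_def)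
  have "coloured_join T h u v \<longleftrightarrow> coloured_join T' h' (f u) (f v)" if uv: "u \<in> V" "v \<in> V" for u v
  proof -
    have "f u = f v \<longleftrightarrow> u = v" using inj uv by (auto simp: inj_on_def)
    then show ?thesis using T_iff[OF uv(1)] T_iff[OF uv(2)] h_iff[of u v] uv unfolding coloured_join_def by blast
  qed
  then show ?thesis using that bij by blast
qed

lemma balanced_join_isomorphic_turan:
  assumes bj: "balanced_join k r V E" and r: "r > 0" and V: "card V = n" "k \<le> n"
  obtains f where "bij_betw f V {..<n}" "\<And>u v. u \<in> V \<Longrightarrow> v \<in> V \<Longrightarrow> E u v \<longleftrightarrow> turan_join k r (f u) (f v)"
proof -
  obtain T h where Th: "coloured V T h r" "card T = k" "\<And>u v. u \<in> V \<Longrightarrow> v \<in> V \<Longrightarrow> E u v \<longleftrightarrow> coloured_join T h u v"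
    "\<And>i. i < r \<Longrightarrow> card (colour_class V T h i) = (n - k) div r \<or> card (colour_class V T h i) = Suc ((n - k) div r)"
    using bj V unfolding balanced_join_def by blast
  interpret c: coloured V T h r by fact
  have cH: "coloured {..<n} {..<k} (\<lambda>v. (v - k) mod r) r" by (rule coloured_turan[OF r V(2)])
  interpret H: coloured "{..<n}" "{..<k}" "\<lambda>v. (v - k) mod r" r by (rule cH)
  have bH: "card (H.B i) = (n - k) div r \<or> card (H.B i) = Suc ((n - k) div r)" if "i < r" for i
    using card_turan_class[OF that V(2)] by simp
  have sum: "(\<Sum>i<r. card (c.B i)) = (\<Sum>i<r. card (H.B i))" using c.card_classes H.card_classes Th(2) V by simp
  have "\<exists>\<pi>. bij_betw \<pi> {..<r} {..<r} \<and> (\<forall>i<r. card (H.B (\<pi> i)) = card (c.B i))"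
  proof (rule bij_betw_extend_colours[of r "\<lambda>i. card (c.B i)" "(n - k) div r" "\<lambda>i. card (H.B i)"])
    show "(\<Sum>i<r. card (c.B i)) = (\<Sum>i<r. card (H.B i))" by (rule sum)
  qed (use Th(4) bH in blast)+
  then obtain \<pi> where \<pi>: "bij_betw \<pi> {..<r} {..<r}" "\<And>i. i < r \<Longrightarrow> card (H.B (\<pi> i)) = card (c.B i)" by blast
  obtain f where "bij_betw f V {..<n}" "\<And>u v. u \<in> V \<Longrightarrow> v \<in> V \<Longrightarrow> coloured_join T h u v \<longleftrightarrow> coloured_join {..<k} (\<lambda>v. (v - k) mod r) (f u) (f v)"
    by (rule coloured_join_isomorphic[OF Th(1) cH _ \<pi>]) (use Th V that in auto)
  then show ?thesis using that Th(3) by (simp add: turan_join_def)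
qed

lemma adj_join_complete_turan:
  "pverts (graph_join (complete_graph k) (turan_graph N r)) = {..<k + N}"
  "adj (graph_join (complete_graph k) (turan_graph N r)) i j \<longleftrightarrow> i < k + N \<and> j < k + N \<and> turan_join k r i j"
proof -
  have pv: "pverts (complete_graph k) = {..<k}" "pverts (turan_graph N r) = {..<N}"
    "parcs (complete_graph k) \<subseteq> {..<k} \<times> {..<k}" "parcs (turan_graph N r) \<subseteq> {..<N} \<times> {..<N}"
    by (auto simp: complete_graph_def turan_graph_def)
  show "pverts (graph_join (complete_graph k) (turan_graph N r)) = {..<k + N}" by (rule join_arcs(1)[OF pv])
  have e: "adj (complete_graph k) i j \<longleftrightarrow> i < k \<and> j < k \<and> i \<noteq> j"
    "adj (turan_graph N r) (i - k) (j - k) \<longleftrightarrow> i - k < N \<and> j - k < N \<and> (i - k) mod r \<noteq> (j - k) mod r"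
    by (auto simp: complete_graph_def turan_graph_def)
  show "adj (graph_join (complete_graph k) (turan_graph N r)) i j \<longleftrightarrow> i < k + N \<and> j < k + N \<and> turan_join k r i j"
    unfolding join_arcs(2)[OF pv] e turan_join_def coloured_join_def by (cases "i < k"; cases "j < k") auto
qed

lemma turan_join_graph:
  fixes r :: nat
  assumes t: "1 \<le> t" "t \<le> n"
  defines "H \<equiv> graph_join (complete_graph (t - 1)) (turan_graph (n - t + 1) r)"
  shows "H \<in> simple_graphs n" "i < n \<Longrightarrow> j < n \<Longrightarrow> adj H i j \<longleftrightarrow> turan_join (t - 1) r i j"
proof -
  have n: "t - 1 + (n - t + 1) = n" using t by simp
  have V: "pverts H = {..<n}" using adj_join_complete_turan(1)[of "t - 1" "n - t + 1" r] unfolding n H_def .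
  have a: "adj H i j \<longleftrightarrow> i < n \<and> j < n \<and> turan_join (t - 1) r i j" for i j
    using adj_join_complete_turan(2)[of i j "t - 1" "n - t + 1" r] unfolding n H_def .
  show "adj H i j \<longleftrightarrow> turan_join (t - 1) r i j" if "i < n" "j < n" using a[of i j] that by blast
  have "sgraph {..<n} (adj H)" unfolding sgraph_def by (auto simp: a) (auto simp: turan_join_def coloured_join_def)
  moreover have "parcs H \<subseteq> {..<n} \<times> {..<n}" using a by auto
  ultimately show "H \<in> simple_graphs n" using V by (intro simple_graphsI)
qed

section \<open>The extremal problem for labelled graphs\<close>

definition forbidden_graph :: "nat \<Rightarrow> nat \<Rightarrow> nat \<Rightarrow> nat pair_pre_digraph" where
  "forbidden_graph s t p = graph_join
     (disjoint_union (disjoint_copies t (complete_graph 2)) (complement (complete_graph (s - 2 * t))))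
     (turan_graph (s * p) p)"

lemma forbidden_graph_arcs:
  assumes "2 * t \<le> s"
  shows "pverts (forbidden_graph s t p) = {..<s + s * p}"
    "adj (forbidden_graph s t p) i j \<longleftrightarrow> i < s + s * p \<and> j < s + s * p \<and>
      ((i < 2 * t \<and> j < 2 * t \<and> i \<noteq> j \<and> i div 2 = j div 2) \<or> (i < s \<and> s \<le> j) \<or> (s \<le> i \<and> j < s) \<or>
       (s \<le> i \<and> s \<le> j \<and> (i - s) mod p \<noteq> (j - s) mod p))"
proof -
  define M where "M = disjoint_union (disjoint_copies t (complete_graph 2)) (complement (complete_graph (s - 2 * t)))"
  have c: "pverts (complement (complete_graph (s - 2 * t))) = {..<s - 2 * t}" "parcs (complement (complete_graph (s - 2 * t))) = {}"
    by (auto simp: complement_def complete_graph_def)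
  have cs: "parcs (complement (complete_graph (s - 2 * t))) \<subseteq> {..<s - 2 * t} \<times> {..<s - 2 * t}" using c by simp
  have ds: "parcs (disjoint_copies t (complete_graph 2)) \<subseteq> {..<2 * t} \<times> {..<2 * t}" by (auto simp: disjoint_copies_K2)
  have st: "2 * t + (s - 2 * t) = s" using assms by simp
  have M1: "pverts M = {..<s}" unfolding M_def using join_arcs(3)[OF disjoint_copies_K2(1) c(1) ds cs] st by simp
  have M2: "adj M i j \<longleftrightarrow> i < 2 * t \<and> j < 2 * t \<and> i \<noteq> j \<and> i div 2 = j div 2" for i j
    unfolding M_def join_arcs(4)[OF disjoint_copies_K2(1) c(1) ds cs] by (simp add: c disjoint_copies_K2)
  have M3: "parcs M \<subseteq> {..<s} \<times> {..<s}" using M2 assms by auto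
  have T: "pverts (turan_graph (s * p) p) = {..<s * p}" "parcs (turan_graph (s * p) p) \<subseteq> {..<s * p} \<times> {..<s * p}"
    by (auto simp: turan_graph_def)
  have F: "forbidden_graph s t p = graph_join M (turan_graph (s * p) p)" by (simp add: forbidden_graph_def M_def)
  show "pverts (forbidden_graph s t p) = {..<s + s * p}" unfolding F by (rule join_arcs(1)[OF M1 T(1) M3 T(2)])
  show "adj (forbidden_graph s t p) i j \<longleftrightarrow> i < s + s * p \<and> j < s + s * p \<and>
      ((i < 2 * t \<and> j < 2 * t \<and> i \<noteq> j \<and> i div 2 = j div 2) \<or> (i < s \<and> s \<le> j) \<or> (s \<le> i \<and> j < s) \<or>
       (s \<le> i \<and> s \<le> j \<and> (i - s) mod p \<noteq> (j - s) mod p))"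
    unfolding F join_arcs(2)[OF M1 T(1) M3 T(2)] using assms by (auto simp: M2 turan_graph_def)
qed

text \<open>
  The property depends only on the edges within \<open>V\<close>, and it is preserved by adding edges.
\<close>

lemma has_F_cong:
  assumes EE: "\<And>u v. u \<in> V \<Longrightarrow> v \<in> V \<Longrightarrow> E u v \<Longrightarrow> E' u v" and F: "has_F s t p V E"
  shows "has_F s t p V E'"
proof -
  obtain P Q where PQ: "P \<subseteq> V" "card P = s" "matching E P t"
    "\<forall>c<p. Q c \<subseteq> V \<and> card (Q c) = s \<and> (\<forall>u\<in>P. \<forall>v\<in>Q c. E u v)" "complete_parts E p Q"
    using F unfolding has_F_def by (elim exE conjE)
  obtain e where e: "inj_on e {..<2 * t}" "e ` {..<2 * t} \<subseteq> P" "\<forall>a<t. E (e (2 * a)) (e (2 * a + 1))"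
    using PQ(3) unfolding matching_def by (elim exE conjE)
  have eV: "e i \<in> V" if "i < 2 * t" for i using e(2) PQ(1) that by blast
  have "\<forall>a<t. E' (e (2 * a)) (e (2 * a + 1))"
  proof (intro allI impI)
    fix a assume "a < t"
    then show "E' (e (2 * a)) (e (2 * a + 1))" using e(3) by (intro EE eV) auto
  qed
  then have "matching E' P t" using e(1,2) unfolding matching_def by blast
  moreover
  have "\<forall>c<p. Q c \<subseteq> V \<and> card (Q c) = s \<and> (\<forall>u\<in>P. \<forall>v\<in>Q c. E' u v)"
    using PQ(1,4) by (auto intro!: EE)
  moreover have "complete_parts E' p Q"
    unfolding complete_parts_def
  proof (intro allI impI ballI)
    fix c d u v assume "c < p" "d < p" "c \<noteq> d" "u \<in> Q c" "v \<in> Q d"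
    then show "E' u v" using PQ(4) by (intro EE complete_partsD[OF PQ(5), of c d]) auto
  qed
  ultimately show ?thesis using PQ(1,2) unfolding has_F_def by blast
qed

text \<open>
  The vertices below \<open>2 t\<close> go to the matching, the remaining ones below \<open>s\<close> to the rest of \<open>P\<close>, and the
  vertex \<open>s + l\<close> goes to the element of \<open>Q (l mod p)\<close> with number \<open>l div p\<close>.
\<close>

lemma embedding_of_has_F:
  assumes G: "sgraph V E" and F: "has_F s t p V E" and st: "2 * t \<le> s" and p: "p > 0"
  shows "\<exists>f. inj_on f (pverts (forbidden_graph s t p)) \<and> f ` pverts (forbidden_graph s t p) \<subseteq> V \<and>
    (\<forall>(u, v)\<in>parcs (forbidden_graph s t p). E (f u) (f v))"
proof -
  obtain P Q where PQ: "P \<subseteq> V" "card P = s" "matching E P t"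
    "\<And>c. c < p \<Longrightarrow> Q c \<subseteq> V \<and> card (Q c) = s \<and> (\<forall>u\<in>P. \<forall>v\<in>Q c. E u v)" "complete_parts E p Q"
    using F unfolding has_F_def by blast
  obtain e where e: "inj_on e {..<2 * t}" "e ` {..<2 * t} \<subseteq> P" "\<And>a. a < t \<Longrightarrow> E (e (2 * a)) (e (2 * a + 1))"
    using PQ(3) by (auto simp: matching_def)
  have finV: "finite V" and irr: "\<And>u. \<not> E u u" and sym: "\<And>u v. E u v \<Longrightarrow> E v u" using G by (auto simp: sgraph_def)
  have fP: "finite P" using PQ(1) finV by (rule finite_subset)
  have fQ: "finite (Q c)" if "c < p" for c using PQ(4)[OF that] finV by (auto intro: finite_subset)
  have "card (P - e ` {..<2 * t}) = card {2 * t..<s}"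
    using e(1,2) fP PQ(2) by (simp add: card_Diff_subset card_image)
  then obtain g where g: "bij_betw g {2 * t..<s} (P - e ` {..<2 * t})"
    using finite_same_card_bij[of "{2 * t..<s}" "P - e ` {..<2 * t}"] fP by auto
  define k where "k = (\<lambda>i. if i < 2 * t then e i else g i)"
  have k: "inj_on k {..<s}" "k ` {..<s} \<subseteq> P"
  proof -
    have "bij_betw k {..<2 * t} (e ` {..<2 * t})"
      using e(1) by (subst bij_betw_cong[of _ _ e]) (auto simp: k_def bij_betw_def)
    moreover have "bij_betw k {2 * t..<s} (P - e ` {..<2 * t})"
      using g by (subst bij_betw_cong[of _ _ g]) (auto simp: k_def)
    ultimately have "bij_betw k ({..<2 * t} \<union> {2 * t..<s}) (e ` {..<2 * t} \<union> (P - e ` {..<2 * t}))"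
      by (rule bij_betw_combine) auto
    moreover have "{..<2 * t} \<union> {2 * t..<s} = {..<s}" using st by auto
    moreover have "e ` {..<2 * t} \<union> (P - e ` {..<2 * t}) = P" using e(2) by auto
    ultimately have "bij_betw k {..<s} P" by simp
    then show "inj_on k {..<s}" "k ` {..<s} \<subseteq> P" by (auto simp: bij_betw_def)
  qed
  have "\<exists>q. bij_betw q {..<s} (Q c)" if "c < p" for c
    using finite_same_card_bij[of "{..<s}" "Q c"] PQ(4)[OF that] fQ[OF that] by auto
  then obtain q where q: "\<And>c. c < p \<Longrightarrow> bij_betw (q c) {..<s} (Q c)" by metis
  define f where "f = (\<lambda>i. if i < s then k i else q ((i - s) mod p) ((i - s) div p))"
  have f1: "f i \<in> P" if "i < s" for i using k that by (auto simp: f_def)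
  have f2: "f i \<in> Q ((i - s) mod p)" "(i - s) mod p < p" "(i - s) div p < s" if "s \<le> i" "i < s + s * p" for i
  proof -
    show 1: "(i - s) mod p < p" using p by simp
    have "i - s < s * p" using that by simp
    then show "(i - s) div p < s" using p by (simp add: less_mult_imp_div_less)
    then show "f i \<in> Q ((i - s) mod p)" using q[OF 1] that by (auto simp: f_def bij_betw_def)
  qed
  have inj: "inj_on f {..<s + s * p}"
  proof (rule linorder_inj_onI)
    fix i j assume ij: "i < j" "i \<in> {..<s + s * p}" "j \<in> {..<s + s * p}"
    consider "j < s" | "i < s" "s \<le> j" | "s \<le> i" using ij by linarith
    then show "f i \<noteq> f j"
    proof cases
      case 1
      then show ?thesis using k(1) ij by (auto simp: f_def inj_on_def)
    next
      case 2
      then have "E (f i) (f j)" using f1[of i] f2[of j] PQ(4)[of "(j - s) mod p"] ij by auto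
      then show ?thesis using irr by metis
    next
      case 3
      then have j: "s \<le> j" using ij by simp
      note fi = f2[OF 3] and fj = f2[OF j]
      show ?thesis
      proof (cases "(i - s) mod p = (j - s) mod p")
        case True
        have "(i - s) div p \<noteq> (j - s) div p"
        proof
          assume "(i - s) div p = (j - s) div p"
          then have "i - s = j - s" using True by (metis div_mult_mod_eq)
          then show False using 3 j ij by simp
        qed
        then show ?thesis using q[OF fi(2)] fi fj ij 3 j True by (auto simp: f_def bij_betw_def inj_on_def)
      next
        case False
        have "E (f i) (f j)" by (rule complete_partsD[OF PQ(5) fi(2) fj(2) False fi(1) fj(1)]) (use ij in auto)
        then show ?thesis using irr by metis
      qed
    qed
  qed auto
  have img: "f ` {..<s + s * p} \<subseteq> V"
  proof
    fix x assume "x \<in> f ` {..<s + s * p}"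
    then obtain i where i: "i < s + s * p" "x = f i" by auto
    show "x \<in> V"
    proof (cases "i < s")
      case True
      then show ?thesis using f1 i PQ(1) by auto
    next
      case False
      then show ?thesis using f2[of i] PQ(4)[of "(i - s) mod p"] i by auto
    qed
  qed
  have arc: "E (f i) (f j)" if "adj (forbidden_graph s t p) i j" for i j
  proof -
    note a = that[unfolded forbidden_graph_arcs(2)[OF st]]
    have lt: "i < s + s * p" "j < s + s * p" using a by auto
    consider "i < 2 * t" "j < 2 * t" "i \<noteq> j" "i div 2 = j div 2" | "i < s" "s \<le> j" | "s \<le> i" "j < s"
      | "s \<le> i" "s \<le> j" "(i - s) mod p \<noteq> (j - s) mod p" using a by auto
    then show ?thesis
    proof cases
      case 1
      define a where "a = i div 2"
      have "a < t" using 1 by (simp add: a_def)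
      have "(i = 2 * a \<and> j = 2 * a + 1) \<or> (i = 2 * a + 1 \<and> j = 2 * a)" using 1 unfolding a_def by presburger
      moreover have "f i = e i" "f j = e j" using 1 st by (auto simp: f_def k_def)
      ultimately show ?thesis using e(3)[OF \<open>a < t\<close>] sym by auto
    next
      case 2
      then show ?thesis using f1[of i] f2[OF _ lt(2)] PQ(4)[of "(j - s) mod p"] by auto
    next
      case 3
      then have "E (f j) (f i)" using f1[of j] f2[OF _ lt(1)] PQ(4)[of "(i - s) mod p"] by auto
      then show ?thesis by (rule sym)
    next
      case 4
      then show ?thesis using complete_partsD[OF PQ(5) f2(2)[OF 4(1) lt(1)] f2(2)[OF 4(2) lt(2)] 4(3) f2(1)[OF 4(1) lt(1)] f2(1)[OF 4(2) lt(2)]] by simp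
    qed
  qed
  show ?thesis unfolding forbidden_graph_arcs(1)[OF st] using inj img arc by (intro exI[of _ f]) auto
qed

lemma has_F_of_embedding:
  assumes st: "2 * t \<le> s" and p: "p > 0"
    and f: "inj_on f (pverts (forbidden_graph s t p))" "f ` pverts (forbidden_graph s t p) \<subseteq> V"
    "\<And>u v. adj (forbidden_graph s t p) u v \<Longrightarrow> E (f u) (f v)"
  shows "has_F s t p V E"
proof -
  note F = forbidden_graph_arcs[OF st, where p = p]
  define L where "L = (\<lambda>c. {i. s \<le> i \<and> i < s + s * p \<and> (i - s) mod p = c})"
  have cL: "card (L c) = s" if "c < p" for c
  proof -
    have "L c = (\<lambda>l. l + s) ` {l. l < s * p \<and> l mod p = c}"
    proof (intro equalityI subsetI)
      fix i assume "i \<in> L c"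
      then show "i \<in> (\<lambda>l. l + s) ` {l. l < s * p \<and> l mod p = c}" by (intro image_eqI[of _ _ "i - s"]) (auto simp: L_def)
    qed (auto simp: L_def)
    then show ?thesis using card_residue_class[OF that, of "s * p"] p by (simp add: card_image)
  qed
  have inj: "inj_on f A" if "A \<subseteq> {..<s + s * p}" for A using f(1) that unfolding F(1) by (rule inj_on_subset)
  have LN: "L c \<subseteq> {..<s + s * p}" for c by (auto simp: L_def)
  show ?thesis
    unfolding has_F_def
  proof (intro exI[of _ "f ` {..<s}"] exI[of _ "\<lambda>c. f ` L c"] conjI allI impI ballI)
    show "f ` {..<s} \<subseteq> V" using f(2) unfolding F(1) by auto
    show "card (f ` {..<s}) = s" using card_image[OF inj, of "{..<s}"] by simp
    show "matching E (f ` {..<s}) t"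
      unfolding matching_def
    proof (intro exI[of _ f] conjI allI impI)
      show "inj_on f {..<2 * t}" using st by (intro inj) auto
      show "f ` {..<2 * t} \<subseteq> f ` {..<s}" using st by (intro image_mono) auto
      show "E (f (2 * a)) (f (2 * a + 1))" if "a < t" for a
        by (rule f(3)) (use that st in \<open>simp add: F(2)\<close>)
    qed
    fix c assume c: "c < p"
    show "f ` L c \<subseteq> V" using f(2) LN unfolding F(1) by blast
    show "card (f ` L c) = s" using card_image[OF inj[OF LN]] cL[OF c] by simp
    fix u v assume "u \<in> f ` {..<s}" "v \<in> f ` L c"
    then show "E u v" using f(3) by (auto simp: F(2) L_def)
  next
    show "complete_parts E p (\<lambda>c. f ` L c)"
      unfolding complete_parts_def using f(3) by (auto simp: F(2) L_def)
  qed
qed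

lemma free_of_forbidden_graph_iff:
  assumes G: "G \<in> simple_graphs n" and st: "2 * t \<le> s" and r: "r > 1"
  shows "free_of (forbidden_graph s t (r - 1)) G \<longleftrightarrow> F_free s t r {..<n} (adj G)"
proof -
  note g = simple_graph_sgraph[OF G]
  have wf: "parcs (forbidden_graph s t (r - 1)) \<subseteq> pverts (forbidden_graph s t (r - 1)) \<times> pverts (forbidden_graph s t (r - 1))"
    using forbidden_graph_arcs[OF st, where p = "r - 1"] by auto
  have wG: "parcs G \<subseteq> pverts G \<times> pverts G" using g by simp
  have r1: "r - 1 > 0" using r by simp
  have "(\<exists>f. inj_on f (pverts (forbidden_graph s t (r - 1))) \<and> f ` pverts (forbidden_graph s t (r - 1)) \<subseteq> pverts G \<and>
      (\<forall>(u, v)\<in>parcs (forbidden_graph s t (r - 1)). (f u, f v) \<in> parcs G)) \<longleftrightarrow> has_F s t (r - 1) {..<n} (adj G)"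
    (is "?L \<longleftrightarrow> ?R")
  proof
    assume ?L
    then obtain f where f: "inj_on f (pverts (forbidden_graph s t (r - 1)))" "f ` pverts (forbidden_graph s t (r - 1)) \<subseteq> {..<n}"
      "\<forall>(u, v)\<in>parcs (forbidden_graph s t (r - 1)). (f u, f v) \<in> parcs G" unfolding g(2) by blast
    show ?R by (rule has_F_of_embedding[OF st r1 f(1,2)]) (use f(3) in blast)
  next
    assume ?R
    from embedding_of_has_F[OF g(1) this st r1] show ?L unfolding g(2) .
  qed
  then show ?thesis unfolding free_of_iff_no_embedding[OF wf wG] F_free_def using g(1) by simp
qed

theorem theorem1p5:
  fixes s t r :: nat and F :: "nat pair_pre_digraph"
  assumes "1 \<le> t" and "real t \<le> real s / 2" and "r \<ge> 3"
    and "F = graph_join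
           (disjoint_union (disjoint_copies t (complete_graph 2))
                           (complement (complete_graph (s - 2 * t))))
           (turan_graph (s * (r - 1)) (r - 1))"
  shows "\<exists>N. \<forall>n \<ge> N.
    graph_join (complete_graph (t - 1)) (turan_graph (n - t + 1) r) \<in> EX_q n F \<and>
    (\<forall>G \<in> EX_q n F. graph_iso G (graph_join (complete_graph (t - 1)) (turan_graph (n - t + 1) r)))"
proof -
  have st: "2 * t \<le> s" using assms(2) by linarith
  have F: "F = forbidden_graph s t (r - 1)" using assms(4) by (simp add: forbidden_graph_def)
  obtain N where N: "\<And>V (E :: nat \<Rightarrow> nat \<Rightarrow> bool). F_free s t r V E \<Longrightarrow> card V \<ge> N \<Longrightarrow>
    qrad V E \<le> turan_q (t - 1) r (card V) \<and> (qrad V E = turan_q (t - 1) r (card V) \<longrightarrow> balanced_join (t - 1) r V E)"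
    using F_free_qrad_extremal[OF assms(3,1) st] by blast
  show ?thesis
  proof (intro exI[of _ "max N t"] allI impI)
    fix n assume n: "n \<ge> max N t"
    define H where "H = graph_join (complete_graph (t - 1)) (turan_graph (n - t + 1) r)"
    have r0: "r > 0" "r > 1" and tn: "t \<le> n" "n > 0" and Nn: "n \<ge> N" using assms n by auto
    have Hs: "H \<in> simple_graphs n" and Ha: "\<And>i j. i < n \<Longrightarrow> j < n \<Longrightarrow> adj H i j \<longleftrightarrow> turan_join (t - 1) r i j"
      using turan_join_graph[OF assms(1) tn(1)] unfolding H_def by blast+
    have free: "free_of F G \<longleftrightarrow> F_free s t r {..<n} (adj G)" if "G \<in> simple_graphs n" for G
      unfolding F by (rule free_of_forbidden_graph_iff[OF that st r0(2)])
    have q: "q_index G = qrad {..<n} (adj G)" if "G \<in> simple_graphs n" for G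
      by (rule q_index_eq_qrad[OF that tn(2)])
    have qH: "q_index H = turan_q (t - 1) r n"
      unfolding q[OF Hs] turan_q_def by (rule qrad_cong) (simp add: Ha)
    have "F_free s t r {..<n} (turan_join (t - 1) r)" by (rule F_free_turan_join[OF r0(1) assms(1) st tn(1)])
    then have "\<not> has_F s t (r - 1) {..<n} (adj H)"
      using has_F_cong[of "{..<n}" "adj H" "turan_join (t - 1) r" s t "r - 1"] Ha unfolding F_free_def by blast
    then have Hf: "free_of F H" using free[OF Hs] simple_graph_sgraph(1)[OF Hs] by (simp add: F_free_def)
    have max: "q_index G \<le> turan_q (t - 1) r n" if "G \<in> simple_graphs n" "free_of F G" for G
      using N[of "{..<n}" "adj G"] free that q Nn by auto
    have HEX: "H \<in> EX_q n F" unfolding EX_q_def using Hs Hf max qH by auto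
    have "graph_iso G H" if G: "G \<in> EX_q n F" for G
    proof -
      have Gs: "G \<in> simple_graphs n" and Gf: "free_of F G" and ge: "q_index H \<le> q_index G"
        using G Hs Hf by (auto simp: EX_q_def)
      have "qrad {..<n} (adj G) = turan_q (t - 1) r n" using max[OF Gs Gf] ge qH q[OF Gs] by simp
      then have "balanced_join (t - 1) r {..<n} (adj G)" using N[of "{..<n}" "adj G"] free[OF Gs] Gf Nn by auto
      then obtain f where f: "bij_betw f {..<n} {..<n}" "\<And>u v. u \<in> {..<n} \<Longrightarrow> v \<in> {..<n} \<Longrightarrow> adj G u v \<longleftrightarrow> turan_join (t - 1) r (f u) (f v)"
        by (rule balanced_join_isomorphic_turan[OF _ r0(1), of "t - 1" "{..<n}" "adj G" n]) (use tn(1) in simp_all)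
      note g = simple_graph_sgraph[OF Gs] and h = simple_graph_sgraph[OF Hs]
      have fn: "f u < n" if "u < n" for u using f(1) that by (auto simp: bij_betw_def)
      have eq: "adj G u v \<longleftrightarrow> adj H (f u) (f v)" if "u < n" "v < n" for u v using f(2)[of u v] Ha fn that by simp
      have "parcs H = (\<lambda>(u, v). (f u, f v)) ` parcs G"
      proof (intro equalityI subsetI)
        fix a assume "a \<in> parcs H"
        then obtain i j where a: "a = (i, j)" "i < n" "j < n" "adj H i j" using h(3) by (cases a) auto
        have "i \<in> f ` {..<n}" "j \<in> f ` {..<n}" using f(1) a by (auto simp: bij_betw_def)
        then obtain u v where uv: "u < n" "v < n" "i = f u" "j = f v" by auto
        then have "adj G u v" using eq a by simp
        then show "a \<in> (\<lambda>(u, v). (f u, f v)) ` parcs G" using a uv by (intro image_eqI[of _ _ "(u, v)"]) auto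
      next
        fix a assume "a \<in> (\<lambda>(u, v). (f u, f v)) ` parcs G"
        then obtain u v where "a = (f u, f v)" "adj G u v" by auto
        moreover have "u < n" "v < n" using \<open>adj G u v\<close> g(3) by auto
        ultimately show "a \<in> parcs H" using eq by simp
      qed
      moreover have "inj_on f (pverts G)" "pverts H = f ` pverts G"
        using f(1) by (simp_all add: g(2) h(2) bij_betw_def)
      moreover have "parcs G \<subseteq> pverts G \<times> pverts G" using g(2,3) by simp
      ultimately show ?thesis by (subst graph_iso_iff) auto
    qed
    then show "graph_join (complete_graph (t - 1)) (turan_graph (n - t + 1) r) \<in> EX_q n F \<and>
      (\<forall>G \<in> EX_q n F. graph_iso G (graph_join (complete_graph (t - 1)) (turan_graph (n - t + 1) r)))"
      using HEX by (simp add: H_def)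
  qed
qed

end
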